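(* Let $W=W(B_n)$ with $n\ge 2$, realized as the group of signed permutations of $\{\pm1,\dots,\pm n\}$. For a triple partition $\lambda=(\lambda^1,\lambda^2,\lambda^3)$ of $n$, partition $\{1,\dots,n\}$ into consecutive blocks whose sizes are the parts of $\lambda^1$, then of $\lambda^2$, then of $\lambda^3$, and let $W_\lambda=\prod_i W(A_{\lambda^1_i-1})\times\prod_i W(B_{\lambda^2_i})\times\prod_i W(D_{\lambda^3_i})$ be the product of the groups $\mathfrak{S}_I$ for the blocks $I$ of $\lambda^1$, $B_I$ for the blocks $I$ of $\lambda^2$, and $D_I$ for the blocks $I$ of $\lambda^3$. Then: (1) the sets $\{W_\lambda\mid \lambda \text{ a triple partition of } n,\ \lambda^3>1\}$ form a set of representatives of the $W$-conjugacy classes of reflection subgroups of $W$; (2) the parabolic closure of $W_\lambda$ is of type $W(B_{n-m})\times\prod_i W(A_{\lambda^1_i-1})$, where $\lambda^1$ is a partition of $m$; (3) the Coxeter elements of $W_\lambda$ have cycle type $(\lambda^1,\ \lambda^2\cup(\lambda^3-1)\cup 1^{\ell(\lambda^3)})$; (4) in particular, the map $\gamma\colon\mathcal{R}\to\mathcal{C}$ is surjective but not injective.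
   Context: Partitions: a partition $\lambda=(\lambda_1\ge\dots\ge\lambda_k>0)$, $\ell(\lambda)=k$, $\emptyset$ is the empty partition; $\lambda^1\cup\lambda^2$ is the partition with the parts of both; $\lambda+m=(\lambda_1+m,\dots,\lambda_k+m)$ (so $\lambda^3-1$ subtracts $1$ from each part); $\lambda>m$ means every part exceeds $m$ (vacuous for $\emptyset$); $1^k$ is the partition with $k$ parts equal to $1$. An $r$-partition of $n$ is a sequence $(\lambda^1,\dots,\lambda^r)$ of partitions with $\lambda^1\cup\dots\cup\lambda^r$ a partition of $n$ (triple partition: $r=3$; double partition: $r=2$). For $I\subseteq\{1,\dots,n\}$: $\mathfrak{S}_I$ is the group of permutations of $I$ (acting as signed permutations without sign changes, generated by the reflections $(i\,j)(-i\,-j)$, $i,j\in I$), $B_I$ is the group of all signed permutations of $\pm I$, and $D_I$ is the subgroup of $B_I$ of elements with an even number of sign changes (generated by $(i\,j)(-i\,-j)$ and $(i\,-j)(-i\,j)$, $i,j\in I$); $D_I$ is trivial if $|I|=1$. Reflections of $W$ are the elements $(i\,j)(-i\,-j)$, $(i\,-j)(-i\,j)$ ($i\ne j$) and $(i\,-i)$; a reflection subgroup is a subgroup generated by reflections. Cycle type: an element $w$ permutes the lines $\langle e_i\rangle$; a cycle of $w$ on these lines is negative if an odd number of the $e_i$ in it are mapped to negatives, positive otherwise; the cycle type of $w$ is the double partition $(\lambda^1,\lambda^2)$ where $\lambda^1$ lists the lengths of positive cycles and $\lambda^2$ those of negative cycles; two elements are conjugate iff they have the same cycle type. Parabolic closure: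 for $X\subseteq W$, $\mathrm{cl}(X)$ is the pointwise stabilizer in $W$ of the fixed-point space of $X$ in the reflection representation $\mathbb{R}^n$. A Coxeter element of a reflection subgroup $R$ is a product, in some order, of a Coxeter generating set of $R$. $\gamma$ maps the conjugacy class of a reflection subgroup $R$ to the conjugacy class in $W$ of a Coxeter element of $R$; $\mathcal{R}$ and $\mathcal{C}$ are the sets of conjugacy classes of reflection subgroups and of elements of $W$.
   Formalization: The condition λ³>1 is assumed in (2) and (3) as well as in (1), since both fail whenever λ³ has a part equal to 1 (e.g. λ=(∅,∅,(1,1)), where W_λ is trivial); Coxeter generating sets are taken to consist of reflections of W. *)

theory Defs
  imports Complex_Main "HOL-Combinatorics.Transposition" "HOL-Library.Multiset"
begin

definition spts :: "nat \<Rightarrow> int set" where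
  "spts n = {i. i \<noteq> 0 \<and> \<bar>i\<bar> \<le> int n}"

definition Wn :: "nat \<Rightarrow> (int \<Rightarrow> int) set" where
  "Wn n = {w. bij_betw w (spts n) (spts n) \<and> (\<forall>i. w (- i) = - w i)
              \<and> (\<forall>i. i \<notin> spts n \<longrightarrow> w i = i)}"

definition refls :: "nat \<Rightarrow> (int \<Rightarrow> int) set" where
  "refls n =
     {transpose i j \<circ> transpose (-i) (-j) | i j. i \<in> {1..int n} \<and> j \<in> {1..int n} \<and> i \<noteq> j}
   \<union> {transpose i (-j) \<circ> transpose (-i) j | i j. i \<in> {1..int n} \<and> j \<in> {1..int n} \<and> i \<noteq> j}
   \<union> {transpose i (-i) | i. i \<in> {1..int n}}"

definition is_subgroup :: "nat \<Rightarrow> (int \<Rightarrow> int) set \<Rightarrow> bool" where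
  "is_subgroup n H \<longleftrightarrow> H \<subseteq> Wn n \<and> id \<in> H \<and> (\<forall>a\<in>H. \<forall>b\<in>H. a \<circ> b \<in> H)
                       \<and> (\<forall>a\<in>H. inv a \<in> H)"

definition gen :: "nat \<Rightarrow> (int \<Rightarrow> int) set \<Rightarrow> (int \<Rightarrow> int) set" where
  "gen n X = \<Inter> {H. is_subgroup n H \<and> X \<subseteq> H}"

definition refl_subgroup :: "nat \<Rightarrow> (int \<Rightarrow> int) set \<Rightarrow> bool" where
  "refl_subgroup n R \<longleftrightarrow> (\<exists>X. X \<subseteq> refls n \<and> R = gen n X)"

definition conj_sub :: "nat \<Rightarrow> (int \<Rightarrow> int) set \<Rightarrow> (int \<Rightarrow> int) set \<Rightarrow> bool" where
  "conj_sub n H K \<longleftrightarrow> (\<exists>g\<in>Wn n. K = (\<lambda>h. g \<circ> h \<circ> inv g) ` H)"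

definition conj_el :: "nat \<Rightarrow> (int \<Rightarrow> int) \<Rightarrow> (int \<Rightarrow> int) \<Rightarrow> bool" where
  "conj_el n v w \<longleftrightarrow> (\<exists>g\<in>Wn n. w = g \<circ> v \<circ> inv g)"

definition is_part :: "nat list \<Rightarrow> bool" where
  "is_part l \<longleftrightarrow> sorted_wrt (\<ge>) l \<and> 0 \<notin> set l"

definition triple_part :: "nat \<Rightarrow> nat list \<Rightarrow> nat list \<Rightarrow> nat list \<Rightarrow> bool" where
  "triple_part n l1 l2 l3 \<longleftrightarrow> is_part l1 \<and> is_part l2 \<and> is_part l3
      \<and> sum_list l1 + sum_list l2 + sum_list l3 = n"

definition blk :: "nat list \<Rightarrow> nat \<Rightarrow> int set" where
  "blk L k = {int (sum_list (take k L)) + 1 .. int (sum_list (take (Suc k) L))}"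

definition restr :: "(int \<Rightarrow> int) \<Rightarrow> int set \<Rightarrow> (int \<Rightarrow> int)" where
  "restr w I = (\<lambda>i. if \<bar>i\<bar> \<in> I then w i else i)"

definition SymI :: "nat \<Rightarrow> int set \<Rightarrow> (int \<Rightarrow> int) set" where
  "SymI n I = {w \<in> Wn n. (\<forall>i. \<bar>i\<bar> \<notin> I \<longrightarrow> w i = i) \<and> (\<forall>i\<in>I. w i \<in> I)}"

definition BI :: "nat \<Rightarrow> int set \<Rightarrow> (int \<Rightarrow> int) set" where
  "BI n I = {w \<in> Wn n. \<forall>i. \<bar>i\<bar> \<notin> I \<longrightarrow> w i = i}"

definition DI :: "nat \<Rightarrow> int set \<Rightarrow> (int \<Rightarrow> int) set" where
  "DI n I = {w \<in> BI n I. even (card {i\<in>I. w i < 0})}"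

definition Wlam :: "nat \<Rightarrow> nat list \<Rightarrow> nat list \<Rightarrow> nat list \<Rightarrow> (int \<Rightarrow> int) set" where
  "Wlam n l1 l2 l3 = (let L = l1 @ l2 @ l3 in
     {w \<in> Wn n.
        (\<forall>k < length l1. restr w (blk L k) \<in> SymI n (blk L k))
      \<and> (\<forall>k < length l2. restr w (blk L (length l1 + k)) \<in> BI n (blk L (length l1 + k)))
      \<and> (\<forall>k < length l3. restr w (blk L (length l1 + length l2 + k))
                          \<in> DI n (blk L (length l1 + length l2 + k)))})"

text \<open>Vectors x in R^n are functions with coordinates x 1, ..., x n; the signed
 permutation w acts by e_i |-> e_(w i), where e_(-j) = - e_j.  Then x is fixed by w
 iff for all i in {1..n}: x_i = sgn(w i) * x_|w i|.\<close>
definition extv :: "(nat \<Rightarrow> real) \<Rightarrow> int \<Rightarrow> real" where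
  "extv x i = (if i > 0 then x (nat i) else if i < 0 then - x (nat (- i)) else 0)"

definition fixes_vec :: "nat \<Rightarrow> (int \<Rightarrow> int) \<Rightarrow> (nat \<Rightarrow> real) \<Rightarrow> bool" where
  "fixes_vec n w x \<longleftrightarrow> (\<forall>i\<in>{1..n}. extv x (w (int i)) = x i)"

definition fixspace :: "nat \<Rightarrow> (int \<Rightarrow> int) set \<Rightarrow> (nat \<Rightarrow> real) set" where
  "fixspace n X = {x. (\<forall>i. i \<notin> {1..n} \<longrightarrow> x i = 0) \<and> (\<forall>w\<in>X. fixes_vec n w x)}"

definition pclos :: "nat \<Rightarrow> (int \<Rightarrow> int) set \<Rightarrow> (int \<Rightarrow> int) set" where
  "pclos n X = {w \<in> Wn n. \<forall>x \<in> fixspace n X. fixes_vec n w x}"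

definition elt_order :: "(int \<Rightarrow> int) \<Rightarrow> nat" where
  "elt_order g = (LEAST k. k > 0 \<and> (g ^^ k) = id)"

inductive coxeq :: "(int \<Rightarrow> int) set \<Rightarrow> (int \<Rightarrow> int) list \<Rightarrow> (int \<Rightarrow> int) list \<Rightarrow> bool"
  for S where
  refl: "coxeq S u u"
| sym: "coxeq S u v \<Longrightarrow> coxeq S v u"
| trans: "coxeq S u v \<Longrightarrow> coxeq S v w \<Longrightarrow> coxeq S u w"
| sq: "s \<in> S \<Longrightarrow> coxeq S (u @ [s, s] @ v) (u @ v)"
| braid: "s \<in> S \<Longrightarrow> t \<in> S \<Longrightarrow>
            coxeq S (u @ concat (replicate (elt_order (s \<circ> t)) [s, t]) @ v) (u @ v)"

definition evalw :: "(int \<Rightarrow> int) list \<Rightarrow> (int \<Rightarrow> int)" where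
  "evalw ws = foldr (\<circ>) ws id"

definition coxeter_system :: "nat \<Rightarrow> (int \<Rightarrow> int) set \<Rightarrow> (int \<Rightarrow> int) set \<Rightarrow> bool" where
  "coxeter_system n R S \<longleftrightarrow> S \<subseteq> R \<and> gen n S = R \<and> (\<forall>s\<in>S. s \<noteq> id \<and> s \<circ> s = id)
     \<and> (\<forall>ws. set ws \<subseteq> S \<and> evalw ws = id \<longrightarrow> coxeq S ws [])"

definition coxeter_gen :: "nat \<Rightarrow> (int \<Rightarrow> int) set \<Rightarrow> (int \<Rightarrow> int) set \<Rightarrow> bool" where
  "coxeter_gen n R S \<longleftrightarrow> S \<subseteq> refls n \<and> coxeter_system n R S"

definition coxeter_elem :: "nat \<Rightarrow> (int \<Rightarrow> int) set \<Rightarrow> (int \<Rightarrow> int) \<Rightarrow> bool" where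
  "coxeter_elem n R c \<longleftrightarrow>
     (\<exists>S ws. coxeter_gen n R S \<and> distinct ws \<and> set ws = S \<and> c = evalw ws)"

text \<open>The cycle of w on the lines <e_i> through i (represented by indices in {1..n}).\<close>
definition line_cycle :: "(int \<Rightarrow> int) \<Rightarrow> int \<Rightarrow> int set" where
  "line_cycle w i = {\<bar>(w ^^ k) i\<bar> | k. True}"

definition cycles :: "nat \<Rightarrow> (int \<Rightarrow> int) \<Rightarrow> int set set" where
  "cycles n w = line_cycle w ` {1..int n}"

definition neg_cycle :: "(int \<Rightarrow> int) \<Rightarrow> int set \<Rightarrow> bool" where
  "neg_cycle w C \<longleftrightarrow> odd (card {j \<in> C. w j < 0})"

definition cycle_type :: "nat \<Rightarrow> (int \<Rightarrow> int) \<Rightarrow> nat multiset \<times> nat multiset" where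
  "cycle_type n w =
     (image_mset card (mset_set {C \<in> cycles n w. \<not> neg_cycle w C}),
      image_mset card (mset_set {C \<in> cycles n w. neg_cycle w C}))"

end

theory Submission
  imports Defs "HOL-Combinatorics.Permutations"
begin

text \<open>
  A reflection subgroup of \<open>W\<close> is determined by its orbits on \<open>{\<plusminus>1, \<dots>, \<plusminus>n}\<close> together with the sign
  changes it contains: if \<open>i\<close> and \<open>j\<close> lie in one orbit on different lines, then the reflection
  exchanging them belongs to the subgroup. Hence the sizes of the three kinds of orbits classify reflection
  subgroups up to conjugacy.

  If \<open>S\<close> is a Coxeter generating set consisting of reflections, then shifting the mirrors of \<open>S\<close>
  arbitrarily, and changing the sign in a reflection \<open>e\<^sub>i \<plusminus> e\<^sub>j\<close> whose partner is not in \<open>S\<close>, preserves all relations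
  between two generators, so the finite group generated by \<open>S\<close> still acts. This makes the signed graph with
  edge set \<open>S\<close> as acyclic as possible: its components are trees, trees with one sign change, or
  trees with one edge doubled by its partner. In the geometric representation a cycle of the Coxeter diagram would
  produce elements of infinite order, which forces the doubled edge to sit at the end of the tree.
  In each of these cases the product of the reflections, in any order, merges orbits step by step, and its cycle
  type can be read off.

  Conversely, any signed permutation \<open>w\<close> is a product of chains of reflections running along its cycles,
  and an enumeration of cosets of point stabilizers shows that these chains form a Coxeter generating set.
\<close>

text \<open>In (3) the generating set is arbitrary: only the orders of products of two generators
  and the completeness of these relations are given, so no simple system is at hand. Each claim
  about the shape of \<open>S\<close> is therefore proved by exhibiting an action that satisfies the
  pairwise relations and a word that would have infinite order in it. Two actions are needed. The
  affine one tolerates a doubled edge in the middle of a tree, and there the order of multiplication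
  would matter: e_1 - e_2, e_2 - e_3, e_2 + e_3, e_3 - e_4 generate a group of type D_4, but the
  product of the middle two followed by the outer two has negative cycles of lengths 2 and 2 instead
  of 3 and 1. The Coxeter diagram of these four reflections is a 4-cycle, which the geometric
  representation excludes. The condition that the parts of the third partition exceed 1 removes the
  coincidence of D_1 with A_0. In (4), the simultaneous sign change of two coordinates is a Coxeter
  element both of B_1 x B_1 and of D_2.\<close>

text \<open>Every reflection has this form; for \<open>j = - i\<close> it is a sign change.\<close>

definition sref :: "int \<Rightarrow> int \<Rightarrow> int \<Rightarrow> int" where
  "sref i j p = (if p = i then j else if p = j then i
     else if p = - i then - j else if p = - j then - i else p)"

section \<open>Signed permutations and their reflections\<close>

lemma finite_spts [simp]: "finite (spts n)"
proof -
  have "spts n \<subseteq> {- int n..int n}" by (auto simp: spts_def)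
  then show ?thesis by (rule finite_subset) simp
qed

lemma uminus_spts [simp]: "- i \<in> spts n \<longleftrightarrow> i \<in> spts n"
  by (auto simp: spts_def)

lemma abs_spts: "i \<in> spts n \<longleftrightarrow> \<bar>i\<bar> \<in> {1..int n}"
  by (auto simp: spts_def)

lemma spts_nonzero: "i \<in> spts n \<Longrightarrow> i \<noteq> 0"
  by (auto simp: spts_def)

lemma Wn_iff: "w \<in> Wn n \<longleftrightarrow> w permutes spts n \<and> (\<forall>i. w (- i) = - w i)"
  unfolding Wn_def using bij_imp_permutes permutes_imp_bij permutes_not_in by fastforce

lemma Wn_permutes: "w \<in> Wn n \<Longrightarrow> w permutes spts n"
  by (simp add: Wn_iff)

lemma Wn_uminus: "w \<in> Wn n \<Longrightarrow> w (- i) = - w i"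
  by (simp add: Wn_iff)

lemma Wn_eq_iff: "w \<in> Wn n \<Longrightarrow> w i = w j \<longleftrightarrow> i = j"
  by (meson Wn_permutes injD permutes_inj)

lemma Wn_eq_uminus_iff: "w \<in> Wn n \<Longrightarrow> w i = - w j \<longleftrightarrow> i = - j"
  by (metis Wn_eq_iff Wn_uminus)

lemma Wn_abs_eq_iff: "w \<in> Wn n \<Longrightarrow> \<bar>w i\<bar> = \<bar>w j\<bar> \<longleftrightarrow> \<bar>i\<bar> = \<bar>j\<bar>"
  by (simp add: abs_eq_iff Wn_eq_iff Wn_eq_uminus_iff)

lemma Wn_in_spts: "w \<in> Wn n \<Longrightarrow> w i \<in> spts n \<longleftrightarrow> i \<in> spts n"
  by (meson Wn_permutes permutes_in_image)

lemma Wn_not_in: "w \<in> Wn n \<Longrightarrow> i \<notin> spts n \<Longrightarrow> w i = i"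
  by (meson Wn_permutes permutes_not_in)

lemma Wn_abs_abs: "w \<in> Wn n \<Longrightarrow> \<bar>w \<bar>i\<bar>\<bar> = \<bar>w i\<bar>"
  by (simp add: abs_if Wn_uminus)

lemma Wn_bij: "w \<in> Wn n \<Longrightarrow> bij w"
  by (meson Wn_permutes permutes_bij)

lemma Wn_inv_simps [simp]:
  assumes "w \<in> Wn n"
  shows "w (inv w i) = i" "inv w (w i) = i" "w \<circ> inv w = id" "inv w \<circ> w = id" "inv (inv w) = w"
  using permutes_inverses[OF Wn_permutes[OF assms]] Wn_bij[OF assms]
  by (auto simp: fun_eq_iff inv_inv_eq)

lemma id_Wn [simp]: "id \<in> Wn n"
  by (simp add: Wn_iff permutes_id)

lemma comp_Wn: "v \<in> Wn n \<Longrightarrow> w \<in> Wn n \<Longrightarrow> v \<circ> w \<in> Wn n"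
  by (simp add: Wn_iff permutes_compose)

lemma inv_Wn: 
  assumes "w \<in> Wn n"
  shows "inv w \<in> Wn n"
proof -
  have "inv w (- i) = - inv w i" for i
  proof -
    have "w (- inv w i) = - i" using Wn_uminus[OF assms] assms by simp
    then have "inv w (w (- inv w i)) = inv w (- i)" by simp
    then show ?thesis using assms by simp
  qed
  then show ?thesis
    using assms by (simp add: Wn_iff permutes_inv)
qed

lemma permutes_finite_order:
  assumes w: "w permutes A" and "finite A"
  shows "\<exists>k>0. w ^^ k = id"
proof -
  have fin: "finite {p. p permutes A}" using assms(2) by (simp add: finite_permutations)
  have pw: "w ^^ k \<in> {p. p permutes A}" for k
    by (induction k) (use w permutes_compose[of _ A w] in \<open>auto simp: permutes_id[unfolded id_def] o_def\<close>)
  have "\<not> inj (\<lambda>k. w ^^ k)"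
  proof
    assume "inj (\<lambda>k. w ^^ k)"
    moreover have "finite (range (\<lambda>k. w ^^ k))" by (rule finite_subset[OF _ fin]) (use pw in blast)
    ultimately have "finite (UNIV :: nat set)" by (rule finite_imageD[rotated])
    then show False by simp
  qed
  then obtain a b where ab: "w ^^ a = w ^^ b" "a < b"
    by (metis injI linorder_neqE_nat)
  have "w ^^ (b - a) = id"
  proof
    fix x
    have "inj (w ^^ a)" using permutes_inj[OF w] by (rule inj_fn)
    moreover have "(w ^^ a) ((w ^^ (b - a)) x) = (w ^^ a) x"
    proof -
      have "w ^^ b = w ^^ a \<circ> w ^^ (b - a)" using ab(2) by (simp flip: funpow_add)
      then show ?thesis using ab by (metis comp_apply)
    qed
    ultimately show "(w ^^ (b - a)) x = id x" by (simp add: inj_eq)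
  qed
  then show ?thesis using ab(2) by (intro exI[of _ "b - a"]) simp
qed

lemma Wn_finite_order: "w \<in> Wn n \<Longrightarrow> \<exists>k>0. w ^^ k = id"
  by (rule permutes_finite_order[OF Wn_permutes]) auto

lemma funpow_Wn: "w \<in> Wn n \<Longrightarrow> w ^^ k \<in> Wn n"
  by (induction k) (auto intro: comp_Wn)

lemma funpow_elt_order: "w \<in> Wn n \<Longrightarrow> elt_order w > 0 \<and> w ^^ elt_order w = id"
  unfolding elt_order_def by (rule LeastI_ex) (rule Wn_finite_order)

lemma sref_simps [simp]:
  "sref i j i = j" "sref i j j = i" "sref i i = id" "i \<noteq> 0 \<Longrightarrow> sref i j (- i) = - j"
  by (auto simp: sref_def fun_eq_iff)

lemma sref_uminus_right_ne: "j \<noteq> 0 \<Longrightarrow> sref i (- j) \<noteq> sref i j"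
  by (metis sref_simps(1) neg_equal_iff_equal neg_equal_zero)

lemma sref_commute: "sref i j = sref j i"
  by (auto simp: sref_def fun_eq_iff)

lemma sref_uminus: "i \<noteq> 0 \<Longrightarrow> j \<noteq> 0 \<Longrightarrow> sref (- i) (- j) = sref i j"
  by (auto simp: sref_def fun_eq_iff)

lemma sref_other: "\<bar>p\<bar> \<noteq> \<bar>i\<bar> \<Longrightarrow> \<bar>p\<bar> \<noteq> \<bar>j\<bar> \<Longrightarrow> sref i j p = p"
  by (auto simp: sref_def)

lemma sref_involution [simp]: "i \<noteq> 0 \<Longrightarrow> j \<noteq> 0 \<Longrightarrow> sref i j (sref i j p) = p"
  by (auto simp: sref_def)

lemma sref_comp_self [simp]: "i \<noteq> 0 \<Longrightarrow> j \<noteq> 0 \<Longrightarrow> sref i j \<circ> sref i j = id"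
  by (auto simp: fun_eq_iff)

lemma sref_odd: "i \<noteq> 0 \<Longrightarrow> j \<noteq> 0 \<Longrightarrow> sref i j (- p) = - sref i j p"
  by (auto simp: sref_def)

lemma sref_moves: "sref i j p \<noteq> p \<Longrightarrow>
   (p = i \<and> sref i j p = j) \<or> (p = j \<and> sref i j p = i) \<or>
   (p = - i \<and> sref i j p = - j) \<or> (p = - j \<and> sref i j p = - i)"
  by (auto simp: sref_def split: if_splits)

lemma sref_eq_moved:
  assumes "i \<noteq> 0" "j \<noteq> 0" "sref i j p \<noteq> p"
  shows "sref i j = sref p (sref i j p)"
  using sref_moves[OF assms(3)] assms sref_commute sref_uminus by metis

lemma sref_Wn:
  assumes "i \<in> spts n" "j \<in> spts n"
  shows "sref i j \<in> Wn n"
proof -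
  have nz: "i \<noteq> 0" "j \<noteq> 0" using assms spts_nonzero by auto
  have "sref i j permutes spts n"
  proof (rule bij_imp_permutes)
    show "bij_betw (sref i j) (spts n) (spts n)"
      by (rule bij_betwI[where g = "sref i j"]) (use nz assms in \<open>auto simp: sref_def\<close>)
    show "sref i j x = x" if "x \<notin> spts n" for x
      using that assms by (auto simp: sref_def)
  qed
  then show ?thesis using nz by (simp add: Wn_iff sref_odd)
qed

lemma sref_eq_transpose: "i \<noteq> 0 \<Longrightarrow> j \<noteq> 0 \<Longrightarrow> \<bar>i\<bar> \<noteq> \<bar>j\<bar> \<Longrightarrow>
    sref i j = transpose i j \<circ> transpose (- i) (- j)"
  by (rule ext) (auto simp: sref_def transpose_def)

lemma sref_half_eq_transpose: "sref i (- i) = transpose i (- i)"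
  by (rule ext) (auto simp: sref_def transpose_def)

lemma refls_sref: "refls n = {sref i j | i j. i \<in> spts n \<and> j \<in> spts n \<and> i \<noteq> j}" (is "_ = ?R")
proof
  show "refls n \<subseteq> ?R"
  proof
    fix s assume "s \<in> refls n"
    then consider
      (a) i j where "s = transpose i j \<circ> transpose (-i) (-j)" "i \<in> {1..int n}" "j \<in> {1..int n}" "i \<noteq> j"
    | (b) i j where "s = transpose i (-j) \<circ> transpose (-i) j" "i \<in> {1..int n}" "j \<in> {1..int n}" "i \<noteq> j"
    | (c) i where "s = transpose i (-i)" "i \<in> {1..int n}"
      unfolding refls_def by blast
    then show "s \<in> ?R"
    proof cases
      case a
      then have "s = sref i j" by (subst sref_eq_transpose) auto
      moreover have "i \<in> spts n" "j \<in> spts n" using a by (auto simp: spts_def)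
      ultimately show ?thesis using a by blast
    next
      case b
      then have "s = sref i (- j)" by (subst sref_eq_transpose) auto
      moreover have "i \<in> spts n" "- j \<in> spts n" "i \<noteq> - j" using b by (auto simp: spts_def)
      ultimately show ?thesis by blast
    next
      case c
      then have "s = sref i (- i)" by (simp add: sref_half_eq_transpose)
      moreover have "i \<in> spts n" "- i \<in> spts n" "i \<noteq> - i" using c by (auto simp: spts_def)
      ultimately show ?thesis by blast
    qed
  qed
  have pos: "sref i j \<in> refls n" if "i \<in> {1..int n}" "j \<in> spts n" "i \<noteq> j" for i j
  proof -
    have "j \<noteq> 0" using that spts_nonzero by auto
    then consider "j = - i" | "j > 0" "j \<noteq> i" | "j < 0" "j \<noteq> - i"
      using \<open>i \<noteq> j\<close> by linarith
    then show ?thesis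
    proof cases
      case 1
      then show ?thesis using that unfolding refls_def by (auto simp: sref_half_eq_transpose)
    next
      case 2
      then have "sref i j = transpose i j \<circ> transpose (- i) (- j)" "j \<in> {1..int n}"
        using that by (auto intro: sref_eq_transpose simp: spts_def)
      then show ?thesis using that unfolding refls_def by blast
    next
      case 3
      then have "sref i j = transpose i (-(-j)) \<circ> transpose (- i) (- j)" "- j \<in> {1..int n}" "i \<noteq> - j"
        using that by (auto intro: sref_eq_transpose simp: spts_def)
      then show ?thesis using that unfolding refls_def by blast
    qed
  qed
  show "?R \<subseteq> refls n"
  proof clarify
    fix i j assume ij: "i \<in> spts n" "j \<in> spts n" "i \<noteq> j"
    show "sref i j \<in> refls n"
    proof (cases "i > 0")
      case True
      then show ?thesis using ij pos by (auto simp: spts_def)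
    next
      case False
      have "sref (- i) (- j) \<in> refls n"
        by (rule pos) (use False ij in \<open>auto simp: spts_def\<close>)
      then show ?thesis using ij spts_nonzero by (metis sref_uminus)
    qed
  qed
qed

lemma sref_in_refls: "i \<in> spts n \<Longrightarrow> j \<in> spts n \<Longrightarrow> i \<noteq> j \<Longrightarrow> sref i j \<in> refls n"
  unfolding refls_sref by blast

lemma reflsE:
  assumes "s \<in> refls n"
  obtains i j where "s = sref i j" "i \<in> spts n" "j \<in> spts n" "i \<noteq> j"
  using assms unfolding refls_sref by blast

lemma refls_Wn: "refls n \<subseteq> Wn n"
  by (auto elim!: reflsE intro: sref_Wn)

lemma refls_involution: "s \<in> refls n \<Longrightarrow> s (s x) = x"
  by (metis reflsE spts_nonzero sref_involution)

lemma refls_comp_self: "s \<in> refls n \<Longrightarrow> s \<circ> s = id"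
  by (auto simp: fun_eq_iff refls_involution)

lemma refls_not_id: "s \<in> refls n \<Longrightarrow> s \<noteq> id"
  by (elim reflsE) (metis sref_simps(1) id_apply)

lemma refls_moved:
  assumes "s \<in> refls n" "s x \<noteq> x"
  shows "s = sref x (s x)" "x \<in> spts n" "s x \<in> spts n"
proof -
  obtain i j where ij: "s = sref i j" "i \<in> spts n" "j \<in> spts n" "i \<noteq> j"
    using assms(1) by (rule reflsE)
  show "s = sref x (s x)" using ij assms sref_eq_moved spts_nonzero by metis
  show "x \<in> spts n" "s x \<in> spts n"
    using Wn_not_in[of s n x] Wn_in_spts[of s n x] assms refls_Wn by auto
qed

lemma sref_conj:
  assumes "g \<in> Wn n"
  shows "g \<circ> sref i j \<circ> inv g = sref (g i) (g j)"
proof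
  fix p
  define q where "q = inv g p"
  have "p = g q" using assms by (simp add: q_def)
  moreover have "g (sref i j q) = sref (g i) (g j) (g q)"
    by (simp add: sref_def Wn_eq_iff[OF assms] Wn_eq_uminus_iff[OF assms] Wn_uminus[OF assms])
  ultimately show "(g \<circ> sref i j \<circ> inv g) p = sref (g i) (g j) p"
    using assms by simp
qed

lemma sref_conj_sref:
  assumes "i \<noteq> 0" "j \<noteq> 0" 
  shows "sref i j \<circ> sref k l \<circ> sref i j = sref (sref i j k) (sref i j l)"
proof -
  obtain n where "i \<in> spts n" "j \<in> spts n"
    using assms by (intro that[of "nat (\<bar>i\<bar> + \<bar>j\<bar>)"]) (auto simp: spts_def)
  then have "sref i j \<in> Wn n" by (rule sref_Wn)
  moreover have "inv (sref i j) = sref i j"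
    using assms by (intro inv_unique_comp) auto
  ultimately show ?thesis using sref_conj by metis
qed

section \<open>Generated subgroups and words in reflections\<close>

lemma is_subgroup_Wn: "is_subgroup n (Wn n)"
  by (auto simp: is_subgroup_def comp_Wn inv_Wn)

lemma gen_Wn: "X \<subseteq> Wn n \<Longrightarrow> gen n X \<subseteq> Wn n"
  unfolding gen_def using is_subgroup_Wn by blast

lemma gen_superset: "X \<subseteq> gen n X"
  unfolding gen_def by blast

lemma gen_least: "is_subgroup n H \<Longrightarrow> X \<subseteq> H \<Longrightarrow> gen n X \<subseteq> H"
  unfolding gen_def by blast

lemma gen_mono: "X \<subseteq> Y \<Longrightarrow> gen n X \<subseteq> gen n Y"
  unfolding gen_def by blast

lemma is_subgroup_gen: "X \<subseteq> Wn n \<Longrightarrow> is_subgroup n (gen n X)"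
  using gen_Wn unfolding is_subgroup_def gen_def by blast

lemma is_subgroupD:
  assumes "is_subgroup n H"
  shows "H \<subseteq> Wn n" "id \<in> H" "a \<in> H \<Longrightarrow> b \<in> H \<Longrightarrow> a \<circ> b \<in> H" "a \<in> H \<Longrightarrow> inv a \<in> H"
  using assms by (auto simp: is_subgroup_def)

lemma evalw_simps [simp]: "evalw [] = id" "evalw (s # ws) = s \<circ> evalw ws"
  by (auto simp: evalw_def)

lemma evalw_append [simp]: "evalw (u @ v) = evalw u \<circ> evalw v"
  by (induction u) (auto simp: fun_eq_iff)

lemma evalw_in_subgroup: "is_subgroup n H \<Longrightarrow> set ws \<subseteq> H \<Longrightarrow> evalw ws \<in> H"
  by (induction ws) (auto simp: is_subgroup_def)

text \<open>Reflections are involutions, so reversing a word inverts it and words without inverse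
  letters already form a subgroup.\<close>

lemma gen_evalw:
  assumes "X \<subseteq> refls n"
  shows "gen n X = {evalw ws | ws. set ws \<subseteq> X}" (is "_ = ?E")
proof
  have XW: "X \<subseteq> Wn n" using assms refls_Wn by blast
  show "?E \<subseteq> gen n X"
    using evalw_in_subgroup[OF is_subgroup_gen[OF XW]] gen_superset[of X n] by blast
  have inv: "evalw ws \<circ> evalw (rev ws) = id" "set ws \<subseteq> X \<Longrightarrow> evalw ws \<in> Wn n" if "set ws \<subseteq> X" for ws
    using that
  proof (induction ws)
    case (Cons s ws)
    { case 1
      then have "s \<in> refls n" using assms by auto
      then have "s (s x) = x" for x by (rule refls_involution)
      then show ?case using Cons(1) 1 by (auto simp: fun_eq_iff)
    next
      case 2
      then have "s \<in> Wn n" "evalw ws \<in> Wn n" using Cons XW by auto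
      then show ?case using comp_Wn by (simp add: o_def)
    }
  qed auto
  have "is_subgroup n ?E"
    unfolding is_subgroup_def
  proof (intro conjI ballI)
    show "?E \<subseteq> Wn n" using inv(2) by blast
    show "id \<in> ?E" by (auto intro!: exI[of _ "[]"])
    fix a assume "a \<in> ?E"
    then obtain u where u: "a = evalw u" "set u \<subseteq> X" by blast
    have "inv a = evalw (rev u)"
      using inv(1)[of u] inv(1)[of "rev u"] u(2) unfolding u(1) by (intro inv_unique_comp) simp_all
    then show "inv a \<in> ?E" using u by (intro CollectI exI[of _ "rev u"]) auto
    fix b assume "b \<in> ?E"
    then obtain v where v: "b = evalw v" "set v \<subseteq> X" by blast
    show "a \<circ> b \<in> ?E" using u v by (intro CollectI exI[of _ "u @ v"]) auto
  qed
  moreover have "X \<subseteq> ?E"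
  proof
    fix s assume "s \<in> X"
    then have "s = evalw [s] \<and> set [s] \<subseteq> X" by simp
    then show "s \<in> ?E" by blast
  qed
  ultimately show "gen n X \<subseteq> ?E" by (rule gen_least)
qed

section \<open>Orbits of reflection subgroups\<close>

definition orb :: "(int \<Rightarrow> int) set \<Rightarrow> int \<Rightarrow> int set" where
  "orb H i = (\<lambda>g. g i) ` H"

lemma orbI: "g \<in> H \<Longrightarrow> g i \<in> orb H i"
  by (simp add: orb_def)

lemma orb_refl: "is_subgroup n H \<Longrightarrow> i \<in> orb H i"
  unfolding orb_def using is_subgroupD(2) by (intro image_eqI[of _ _ id]) auto

lemma orb_trans:
  assumes "is_subgroup n H" "j \<in> orb H i" "k \<in> orb H j"
  shows "k \<in> orb H i"
proof -
  obtain g h where "g \<in> H" "j = g i" "h \<in> H" "k = h j"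
    using assms by (auto simp: orb_def)
  then show ?thesis using is_subgroupD(3)[OF assms(1)] orbI[of "h \<circ> g" H i] by simp
qed

lemma orb_sym:
  assumes "is_subgroup n H" "j \<in> orb H i"
  shows "i \<in> orb H j"
proof -
  obtain g where g: "g \<in> H" "j = g i"
    using assms by (auto simp: orb_def)
  then have "i = inv g j" "inv g \<in> H"
    using assms is_subgroupD(1,4)[OF assms(1)] by auto
  then show ?thesis by (auto simp: orb_def)
qed

lemma orb_uminus:
  assumes "is_subgroup n H" "j \<in> orb H i"
  shows "- j \<in> orb H (- i)"
proof -
  obtain g where g: "g \<in> H" "j = g i"
    using assms by (auto simp: orb_def)
  then have "- j = g (- i)"
    using is_subgroupD(1)[OF assms(1)] Wn_uminus by auto
  then show ?thesis using g by (auto simp: orb_def)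
qed

lemma orb_sref:
  assumes "sref i j \<in> H"
  shows "j \<in> orb H i"
  using orbI[OF assms, of i] by simp

lemma orb_spts:
  assumes "is_subgroup n H" "j \<in> orb H i"
  shows "j \<in> spts n \<longleftrightarrow> i \<in> spts n"
  using assms is_subgroupD(1) by (fastforce simp: orb_def Wn_in_spts)

lemma refl_subgroup_gen:
  assumes "refl_subgroup n R"
  shows "is_subgroup n R" "gen n (R \<inter> refls n) = R"
proof -
  obtain X where X: "X \<subseteq> refls n" "R = gen n X"
    using assms by (auto simp: refl_subgroup_def)
  show 1: "is_subgroup n R"
    using X refls_Wn is_subgroup_gen by blast
  show "gen n (R \<inter> refls n) = R"
  proof
    show "gen n (R \<inter> refls n) \<subseteq> R"
      by (rule gen_least[OF 1]) blast
    have "X \<subseteq> R \<inter> refls n" using X gen_superset by blast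
    then show "R \<subseteq> gen n (R \<inter> refls n)" using gen_mono X by blast
  qed
qed

lemma refl_subgroupI: "gen n (K \<inter> refls n) = K \<Longrightarrow> refl_subgroup n K"
  unfolding refl_subgroup_def by blast

lemma sref_conj_closed:
  assumes "is_subgroup n R" "sref i j \<in> R" "sref k l \<in> R" "i \<noteq> 0" "j \<noteq> 0"
  shows "sref (sref i j k) (sref i j l) \<in> R"
  using assms is_subgroupD(3)[OF assms(1)] sref_conj_sref by metis

text \<open>The two cases of the conclusion distinguish the components that behave like a block of
  type \<open>B\<close> from those that behave like a block of type \<open>D\<close>.\<close>

lemma sref_orbit_cases:
  assumes R: "refl_subgroup n R" and i: "i \<in> spts n" and j: "j \<in> orb R i"
  shows "j = i \<or> (\<bar>j\<bar> \<noteq> \<bar>i\<bar> \<and> sref i j \<in> R) \<or>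
     (j = - i \<and> (sref i (- i) \<in> R \<or>
        (\<exists>k\<in>spts n. \<bar>k\<bar> \<noteq> \<bar>i\<bar> \<and> sref i k \<in> R \<and> sref i (- k) \<in> R)))" (is "?E j")
proof -
  note sg = refl_subgroup_gen[OF R]
  have nz: "i \<noteq> 0" using i spts_nonzero by auto
  \<comment> \<open>The trichotomy survives one more reflection \<open>s = sref j k\<close>, hence
    propagates along a word. Conjugating the reflections already known yields
    \<open>sref i k\<close>; if instead \<open>s\<close> returns to the line of \<open>i\<close>,
    then \<open>sref i j\<close> and \<open>s\<close> together form the pair
    \<open>sref i j\<close>, \<open>sref i (- j)\<close> that witnesses \<open>- i\<close>.\<close>
  have step: "?E (s j)" if "?E j" "s \<in> R" "s \<in> refls n" for s j
  proof (cases "s j = j")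
    case False
    define k where "k = s j"
    have s: "s = sref j k" and jk: "j \<in> spts n" "k \<in> spts n"
      unfolding k_def by (fact refls_moved[OF that(3) False])+
    have jnz: "j \<noteq> 0" "k \<noteq> 0" using jk spts_nonzero by auto
    have sR: "sref j k \<in> R" using s that by simp
    consider "j = i" | "\<bar>j\<bar> \<noteq> \<bar>i\<bar>" "sref i j \<in> R" | "j = - i" "sref i (- i) \<in> R"
      | k0 where "j = - i" "k0 \<in> spts n" "\<bar>k0\<bar> \<noteq> \<bar>i\<bar>" "sref i k0 \<in> R" "sref i (- k0) \<in> R"
      using \<open>?E j\<close> by blast
    then have "?E k"
    proof cases
      case 1
      moreover have "k = i \<or> k = - i" if "\<bar>k\<bar> = \<bar>i\<bar>" using that by linarith
      ultimately show ?thesis using sR by blast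
    next
      case 2
      show ?thesis
      proof (cases "\<bar>k\<bar> = \<bar>i\<bar>")
        case True
        moreover have "sref i (- j) \<in> R" if "k = - i"
          using sR that sref_commute[of j "- i"] sref_uminus[of i "- j"] jnz nz by simp
        moreover have "k = i \<or> k = - i" using True by linarith
        ultimately show ?thesis using 2 jk by blast
      next
        case False
        have "sref (sref j k i) (sref j k j) \<in> R"
          using sref_conj_closed[OF sg(1) sR 2(2)] jnz by simp
        then show ?thesis using 2 False by (simp add: sref_other)
      qed
    next
      case 3
      show ?thesis
      proof (cases "\<bar>k\<bar> = \<bar>i\<bar>")
        case False
        have "sref (sref i (- i) j) (sref i (- i) k) \<in> R"
          using sref_conj_closed[OF sg(1) 3(2) sR] nz by simp
        then show ?thesis using 3 False nz by (simp add: sref_other)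
      next
        case True
        then have "k = i \<or> k = - i" by linarith
        then show ?thesis using 3(2) by blast
      qed
    next
      case 4
      have k0: "k0 \<noteq> 0" using spts_nonzero[OF 4(2)] .
      consider "\<bar>k\<bar> = \<bar>i\<bar>" | "\<bar>k\<bar> = \<bar>k0\<bar>" | "\<bar>k\<bar> \<noteq> \<bar>i\<bar>" "\<bar>k\<bar> \<noteq> \<bar>k0\<bar>" by blast
      then show ?thesis
      proof cases
        case 3
        have fixk: "sref i (- k0) k = k" "sref i k0 k = k" using 3 by (simp_all add: sref_other)
        have "sref (sref i (- k0) j) (sref i (- k0) k) \<in> R"
          by (rule sref_conj_closed[OF sg(1) 4(5) sR]) (use nz k0 in auto)
        then have "sref k0 k \<in> R" using 4(1) nz by (simp add: fixk)
        from sref_conj_closed[OF sg(1) 4(4) this nz k0]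
        show ?thesis using 3 by (simp add: fixk)
      next
        case 1
        then have "k = i \<or> k = - i" by linarith
        then show ?thesis using 4 by blast
      next
        case 2
        then have "k = k0 \<or> k = - k0" by linarith
        then have "sref i k \<in> R" using 4(4,5) by blast
        moreover have "\<bar>k\<bar> \<noteq> \<bar>i\<bar>" using 2 4(3) by simp
        ultimately show ?thesis by blast
      qed
    qed
    then show ?thesis by (simp add: k_def)
  qed (use that in simp)
  obtain g where g: "g \<in> R" "j = g i" using j by (auto simp: orb_def)
  then obtain ws where ws: "g = evalw ws" "set ws \<subseteq> R \<inter> refls n"
    using gen_evalw[of "R \<inter> refls n" n] sg(2) by blast
  have "?E (evalw ws i)" using ws(2)
  proof (induction ws)
    case (Cons s ws)
    then show ?case using step[of "evalw ws i" s] by simp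
  qed simp
  then show ?thesis using g ws by simp
qed

lemma sref_in_refl_subgroup:
  assumes "refl_subgroup n R" "i \<in> spts n" "j \<in> orb R i" "\<bar>j\<bar> \<noteq> \<bar>i\<bar>"
  shows "sref i j \<in> R"
  using sref_orbit_cases[OF assms(1-3)] assms(4) by auto

text \<open>Peel reflections off \<open>w\<close> from the left: the hypotheses supply an element of
  the generated group that fixes every fixed point of \<open>w\<close> and returns some
  \<open>w q\<close> to \<open>q\<close>, so the number of moved points drops. A diagonal
  \<open>w\<close> may contain no single sign change of the group; then two sign changes are removed
  at once, being the product of \<open>sref i k\<close> and \<open>sref i (- k)\<close>.\<close>

lemma subgroup_gen_refls:
  assumes K: "is_subgroup n K"
    and K1: "\<And>w i. w \<in> K \<Longrightarrow> \<bar>w i\<bar> \<noteq> \<bar>i\<bar> \<Longrightarrow> sref i (w i) \<in> K"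
    and K2: "\<And>w i. w \<in> K \<Longrightarrow> (\<And>j. \<bar>w j\<bar> = \<bar>j\<bar>) \<Longrightarrow> i \<in> spts n \<Longrightarrow> w i = - i \<Longrightarrow>
       sref i (- i) \<in> K \<or> 
       (\<exists>k\<in>spts n. \<bar>k\<bar> \<noteq> \<bar>i\<bar> \<and> w k = - k \<and> sref i k \<in> K \<and> sref i (- k) \<in> K)"
  shows "gen n (K \<inter> refls n) = K"
proof
  let ?G = "gen n (K \<inter> refls n)"
  show "?G \<subseteq> K" by (rule gen_least[OF K]) blast
  have G: "is_subgroup n ?G"
    by (rule is_subgroup_gen) (use refls_Wn in blast)
  have sG: "sref i j \<in> ?G" if "sref i j \<in> K" "i \<in> spts n" "j \<in> spts n" for i j
  proof (cases "i = j")
    case True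
    then show ?thesis using is_subgroupD(2)[OF G] by simp
  next
    case False
    then have "sref i j \<in> K \<inter> refls n" using that sref_in_refls by blast
    then show ?thesis using gen_superset by blast
  qed
  have "w \<in> ?G" if "w \<in> K" for w
    using that
  proof (induction "card {p \<in> spts n. w p \<noteq> p}" arbitrary: w rule: less_induct)
    case less
    have wW: "w \<in> Wn n" using less.prems K is_subgroupD by blast
    have step: "w \<in> ?G" if s: "s \<in> ?G" "\<And>p. w p = p \<Longrightarrow> s p = p" and q: "q \<in> spts n" "w q \<noteq> q" "s (w q) = q" for s q
    proof -
      have sK: "s \<in> K" using s \<open>?G \<subseteq> K\<close> by blast
      then have sW: "s \<in> Wn n" using K is_subgroupD by blast
      have "{p \<in> spts n. (s \<circ> w) p \<noteq> p} \<subset> {p \<in> spts n. w p \<noteq> p}"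
        using s q by force
      then have "card {p \<in> spts n. (s \<circ> w) p \<noteq> p} < card {p \<in> spts n. w p \<noteq> p}"
        by (intro psubset_card_mono) auto
      moreover have "s \<circ> w \<in> K" using sK less.prems is_subgroupD(3)[OF K] by blast
      ultimately have "s \<circ> w \<in> ?G" by (rule less.hyps)
      then have "inv s \<circ> (s \<circ> w) \<in> ?G" using s is_subgroupD(3,4)[OF G] by blast
      moreover have "inv s \<circ> (s \<circ> w) = w" using sW by (simp add: o_assoc)
      ultimately show ?thesis by simp
    qed
    consider "w = id" | i where "\<bar>w i\<bar> \<noteq> \<bar>i\<bar>" | i where "\<And>j. \<bar>w j\<bar> = \<bar>j\<bar>" "w i \<noteq> i"
      by (metis eq_id_iff)
    then show ?case
    proof cases
      case 1
      then show ?thesis using is_subgroupD(2)[OF G] by simp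
    next
      case 2
      have i: "i \<in> spts n" "w i \<in> spts n" using Wn_not_in[OF wW] Wn_in_spts[OF wW, of i] 2 by fastforce+
      show ?thesis
      proof (rule step[where q = i])
        show "sref i (w i) \<in> ?G" using K1[OF less.prems 2] i by (rule sG)
        show "sref i (w i) p = p" if "w p = p" for p
        proof (rule sref_other)
          show "\<bar>p\<bar> \<noteq> \<bar>i\<bar>" using that 2 Wn_abs_eq_iff[OF wW, of p i] by metis
          then show "\<bar>p\<bar> \<noteq> \<bar>w i\<bar>" using that Wn_abs_eq_iff[OF wW, of p i] by metis
        qed
      qed (use i 2 in auto)
    next
      case 3
      have i: "i \<in> spts n" using Wn_not_in[OF wW] 3 by auto
      have nz: "i \<noteq> 0" using i spts_nonzero by auto
      have wi: "w i = - i" using 3 by (metis abs_eq_iff)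
      consider "sref i (- i) \<in> K"
        | k where "k \<in> spts n" "\<bar>k\<bar> \<noteq> \<bar>i\<bar>" "w k = - k" "sref i k \<in> K" "sref i (- k) \<in> K"
        using K2[OF less.prems 3(1) i wi] by blast
      then show ?thesis
      proof cases
        case 1
        show ?thesis
        proof (rule step[where q = i])
          show "sref i (- i) \<in> ?G" using 1 i by (intro sG) auto
          show "sref i (- i) p = p" if "w p = p" for p
            using that wi nz Wn_uminus[OF wW, of i] by (auto simp: sref_def)
        qed (use i wi nz in auto)
      next
        case 2
        have k: "k \<noteq> 0" using 2 spts_nonzero by auto
        show ?thesis
        proof (rule step[where q = i])
          show "sref i k \<circ> sref i (- k) \<in> ?G" 
            using 2 i by (intro is_subgroupD(3)[OF G] sG) auto
          show "(sref i k \<circ> sref i (- k)) p = p" if "w p = p" for p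
            using that wi nz k 2(3) Wn_uminus[OF wW, of i] Wn_uminus[OF wW, of k] by (auto simp: sref_def)
          show "(sref i k \<circ> sref i (- k)) (w i) = i" using wi nz by simp
        qed (use i wi nz in auto)
      qed
    qed
  qed
  then show "K \<subseteq> ?G" by blast
qed

section \<open>Products of groups of types A, B and D\<close>

text \<open>The blocks are arbitrary sets of lines, not intervals, so that \<open>Wlam\<close> and
  the orbit structure of an unknown reflection subgroup fall under the same notion.\<close>

definition Wstr :: "nat \<Rightarrow> int set set \<Rightarrow> int set set \<Rightarrow> int set set \<Rightarrow> (int \<Rightarrow> int) set" where
  "Wstr n A B D = {w \<in> Wn n. (\<forall>C\<in>A \<union> B \<union> D. \<forall>i\<in>C. \<bar>w i\<bar> \<in> C) \<and> (\<forall>C\<in>A. \<forall>i\<in>C. w i > 0) \<and>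
     (\<forall>C\<in>D. even (card {i\<in>C. w i < 0}))}"

lemma Wn_zero_iff: "w \<in> Wn n \<Longrightarrow> w i = 0 \<longleftrightarrow> i = 0"
  by (metis Wn_eq_iff Wn_not_in spts_nonzero)

lemma sgn_abs_mult: "(sgn i * \<bar>i\<bar> :: int) = i" "(\<bar>i\<bar> * sgn i :: int) = i"
  by (simp_all add: sgn_if abs_if)

text \<open>The number of sign changes is not additive under composition, but the product of signs
  over an invariant block is multiplicative; parity is handled through that product.\<close>

lemma even_neg_iff:
  assumes "finite C" "\<And>i. i \<in> C \<Longrightarrow> w i \<noteq> (0::int)"
  shows "even (card {i\<in>C. w i < 0}) \<longleftrightarrow> (\<Prod>i\<in>C. sgn (w i)) = 1"
proof -
  have "(\<Prod>i\<in>C. sgn (w i)) = (\<Prod>i\<in>C. if w i < 0 then - 1 else 1)"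
    by (rule prod.cong) (use assms(2) in \<open>auto simp: sgn_if\<close>)
  also have "\<dots> = (- 1) ^ card {i\<in>C. w i < 0}"
    using assms(1) by (simp add: prod.If_cases Int_def)
  finally show ?thesis by (simp add: minus_one_power_iff)
qed

lemma Wn_abs_bij_betw:
  assumes "w \<in> Wn n" "finite C" "\<And>i. i \<in> C \<Longrightarrow> i > 0" "\<And>i. i \<in> C \<Longrightarrow> \<bar>w i\<bar> \<in> C"
  shows "bij_betw (\<lambda>i. \<bar>w i\<bar>) C C"
proof -
  have "inj_on (\<lambda>i. \<bar>w i\<bar>) C"
    using assms(3) Wn_abs_eq_iff[OF assms(1)] by (intro inj_onI) (metis abs_of_pos)
  then show ?thesis
    using assms(2,4) by (simp add: bij_betw_def card_image card_subset_eq image_subsetI)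
qed

lemma prod_sgn_comp:
  assumes "v \<in> Wn n" "w \<in> Wn n" "finite C" "\<And>i. i \<in> C \<Longrightarrow> i > 0" "\<And>i. i \<in> C \<Longrightarrow> \<bar>w i\<bar> \<in> C"
  shows "(\<Prod>i\<in>C. sgn ((v \<circ> w) i)) = (\<Prod>i\<in>C. sgn (v i)) * (\<Prod>i\<in>C. sgn (w i))"
proof -
  have "sgn ((v \<circ> w) i) = sgn (v \<bar>w i\<bar>) * sgn (w i)" for i
    using Wn_uminus[OF assms(1), of "w i"] Wn_zero_iff[OF assms(1), of 0] by (auto simp: abs_if sgn_if)
  then have "(\<Prod>i\<in>C. sgn ((v \<circ> w) i)) = (\<Prod>i\<in>C. sgn (v \<bar>w i\<bar>)) * (\<Prod>i\<in>C. sgn (w i))"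
    by (simp add: prod.distrib)
  also have "(\<Prod>i\<in>C. sgn (v \<bar>w i\<bar>)) = (\<Prod>i\<in>C. sgn (v i))"
    by (rule prod.reindex_bij_betw) (rule Wn_abs_bij_betw[OF assms(2-5)])
  finally show ?thesis .
qed

lemma even_neg_comp:
  assumes "v \<in> Wn n" "w \<in> Wn n" "finite C" "\<And>i. i \<in> C \<Longrightarrow> i > 0" "\<And>i. i \<in> C \<Longrightarrow> \<bar>w i\<bar> \<in> C"
    and "even (card {i\<in>C. v i < 0})" "even (card {i\<in>C. w i < 0})"
  shows "even (card {i\<in>C. (v \<circ> w) i < 0})"
proof -
  have nz: "u i \<noteq> 0" if "u \<in> Wn n" "i \<in> C" for u i
    using Wn_zero_iff[OF that(1), of i] assms(4)[OF that(2)] by simp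
  have "v \<circ> w \<in> Wn n" using assms by (simp add: comp_Wn)
  then show ?thesis
    using assms(6,7) even_neg_iff[OF assms(3) nz[OF assms(1)]] even_neg_iff[OF assms(3) nz[OF assms(2)]] 
      even_neg_iff[OF assms(3) nz[of "v \<circ> w"]] prod_sgn_comp[OF assms(1-5)]
    by simp
qed

text \<open>\<open>D_card\<close> excludes singletons: D_1 is trivial, like A_0, and the group could
  not tell such a block from one in \<open>A\<close>.\<close>

locale blocks =
  fixes n :: nat and A B D :: "int set set"
  assumes cover: "\<Union>(A \<union> B \<union> D) = {1..int n}"
    and disj: "C \<in> A \<union> B \<union> D \<Longrightarrow> C' \<in> A \<union> B \<union> D \<Longrightarrow> i \<in> C \<Longrightarrow> i \<in> C' \<Longrightarrow> C = C'"
    and nonempty: "{} \<notin> A \<union> B \<union> D"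
    and types: "A \<inter> B = {}" "A \<inter> D = {}" "B \<inter> D = {}"
    and D_card: "C \<in> D \<Longrightarrow> card C > 1"
begin

abbreviation "W \<equiv> Wstr n A B D"

lemma block_subset: "C \<in> A \<union> B \<union> D \<Longrightarrow> C \<subseteq> {1..int n}"
  using cover by blast

lemma block_finite: "C \<in> A \<union> B \<union> D \<Longrightarrow> finite C"
  by (meson block_subset finite_atLeastAtMost_int finite_subset)

lemma block_pos: "C \<in> A \<union> B \<union> D \<Longrightarrow> i \<in> C \<Longrightarrow> i > 0"
  using block_subset by fastforce

lemma block_abs: "C \<in> A \<union> B \<union> D \<Longrightarrow> i \<in> C \<Longrightarrow> \<bar>i\<bar> = i"
  using block_pos by fastforce

lemma finite_blocks: "finite (A \<union> B \<union> D)"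
  by (rule finite_subset[of _ "Pow {1..int n}"]) (use block_subset in auto)

lemma block_of: "i \<in> spts n \<Longrightarrow> \<exists>C\<in>A \<union> B \<union> D. \<bar>i\<bar> \<in> C"
  using cover abs_spts by blast

lemma block_spts: "C \<in> A \<union> B \<union> D \<Longrightarrow> \<bar>i\<bar> \<in> C \<Longrightarrow> i \<in> spts n"
  using block_subset abs_spts by blast

lemma W_Wn: "w \<in> W \<Longrightarrow> w \<in> Wn n"
  by (simp add: Wstr_def)

lemma W_block: "w \<in> W \<Longrightarrow> C \<in> A \<union> B \<union> D \<Longrightarrow> \<bar>w i\<bar> \<in> C \<longleftrightarrow> \<bar>i\<bar> \<in> C"
proof -
  have 1: "\<bar>w i\<bar> \<in> C" if "w \<in> W" "C \<in> A \<union> B \<union> D" "\<bar>i\<bar> \<in> C" for C i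
  proof -
    have "\<bar>w \<bar>i\<bar>\<bar> \<in> C" using that unfolding Wstr_def by blast
    then show ?thesis using Wn_abs_abs[OF W_Wn[OF that(1)]] by simp
  qed
  assume w: "w \<in> W" and C: "C \<in> A \<union> B \<union> D"
  show ?thesis
  proof
    assume wi: "\<bar>w i\<bar> \<in> C"
    then have "i \<in> spts n" using block_spts[OF C wi] Wn_in_spts[OF W_Wn[OF w]] by blast
    then obtain C' where C': "C' \<in> A \<union> B \<union> D" "\<bar>i\<bar> \<in> C'" using block_of by blast
    then have "\<bar>w i\<bar> \<in> C'" using 1 w by blast
    then show "\<bar>i\<bar> \<in> C" using disj[OF C C'(1) wi] C'(2) by simp
  qed (use 1 w C in blast)
qed

lemma W_sgn: 
  assumes "w \<in> W" "C \<in> A" "\<bar>i\<bar> \<in> C"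
  shows "w i > 0 \<longleftrightarrow> i > 0"
proof -
  have "w \<bar>i\<bar> > 0" using assms unfolding Wstr_def by blast
  moreover have "i \<noteq> 0" using block_pos[of C "\<bar>i\<bar>"] assms by auto
  ultimately show ?thesis using Wn_uminus[OF W_Wn[OF assms(1)], of i] by (auto simp: abs_if split: if_splits)
qed

lemma is_subgroup_W: "is_subgroup n W"
  unfolding is_subgroup_def
proof (intro conjI ballI)
  show "W \<subseteq> Wn n" using W_Wn by blast
  have "even (card {i\<in>C. id i < 0})" if "C \<in> D" for C
  proof -
    have "{i \<in> C. id i < 0} = {}" using block_pos[of C] that by fastforce
    then show ?thesis by (simp only: card.empty even_zero)
  qed
  moreover have "id i > 0" if "C \<in> A" "i \<in> C" for C i
    using that block_pos[of C i] by simp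
  moreover have "\<bar>id i\<bar> \<in> C" if "C \<in> A \<union> B \<union> D" "i \<in> C" for C i
    using that block_abs[of C i] by simp
  ultimately show "id \<in> W"
    unfolding Wstr_def using id_Wn by blast
next
  fix v w assume v: "v \<in> W" and w: "w \<in> W"
  have "(v \<circ> w) i > 0" if "C \<in> A" "i \<in> C" for C i
  proof -
    have i: "\<bar>i\<bar> = i" "i > 0" using that block_abs[of C i] block_pos[of C i] by auto
    then have "\<bar>w i\<bar> \<in> C" using W_block[OF w, of C i] that by simp
    then show ?thesis using W_sgn[OF v that(1), of "w i"] W_sgn[OF w that(1), of i] that i by simp
  qed
  moreover have "\<bar>(v \<circ> w) i\<bar> \<in> C" if "C \<in> A \<union> B \<union> D" "i \<in> C" for C i
    using W_block[OF v that(1), of "w i"] W_block[OF w that(1), of i] block_pos[OF that] that(2) by simp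
  moreover have "even (card {i\<in>C. (v \<circ> w) i < 0})" if "C \<in> D" for C
  proof (rule even_neg_comp[OF W_Wn[OF v] W_Wn[OF w]])
    show "finite C" "\<And>i. i \<in> C \<Longrightarrow> i > 0" using that block_finite block_pos by auto
    show "even (card {i\<in>C. v i < 0})" "even (card {i\<in>C. w i < 0})" 
      using v w that by (auto simp: Wstr_def)
    show "\<bar>w i\<bar> \<in> C" if "i \<in> C" for i using w \<open>C \<in> D\<close> that by (auto simp: Wstr_def)
  qed
  ultimately show "v \<circ> w \<in> W"
    using comp_Wn[OF W_Wn[OF v] W_Wn[OF w]] unfolding Wstr_def by blast
next
  fix w assume w: "w \<in> W"
  note wW = W_Wn[OF w]
  have bl: "\<bar>inv w i\<bar> \<in> C \<longleftrightarrow> \<bar>i\<bar> \<in> C" if "C \<in> A \<union> B \<union> D" for C i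
    using W_block[OF w that, of "inv w i"] wW by simp
  have sg: "inv w i > 0" if "C \<in> A" "i \<in> C" for C i
    using W_sgn[OF w that(1), of "inv w i"] bl[of C i] that block_pos[of C i] wW by simp
  have ev: "even (card {i\<in>C. inv w i < 0})" if "C \<in> D" for C
  proof -
    have C: "C \<in> A \<union> B \<union> D" using that by blast
    have "bij_betw (\<lambda>i. \<bar>inv w i\<bar>) {i\<in>C. inv w i < 0} {i\<in>C. w i < 0}"
    proof (rule bij_betwI[where g = "\<lambda>i. \<bar>w i\<bar>"])
      have neg: "w (- inv w i) = - i" "inv w (- w i) = - i" for i
        using Wn_uminus[OF wW] Wn_uminus[OF inv_Wn[OF wW]] wW by auto
      show "(\<lambda>i. \<bar>inv w i\<bar>) \<in> {i \<in> C. inv w i < 0} \<rightarrow> {i \<in> C. w i < 0}"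
      proof (intro funcsetI)
        fix x assume x: "x \<in> {i \<in> C. inv w i < 0}"
        then have "\<bar>inv w x\<bar> \<in> C" "0 < x" using bl[OF C, of x] block_pos[OF C] block_abs[OF C] by auto
        then show "\<bar>inv w x\<bar> \<in> {i \<in> C. w i < 0}" using x neg by simp
      qed
      show "(\<lambda>i. \<bar>w i\<bar>) \<in> {i \<in> C. w i < 0} \<rightarrow> {i \<in> C. inv w i < 0}"
      proof (intro funcsetI)
        fix x assume x: "x \<in> {i \<in> C. w i < 0}"
        then have "\<bar>w x\<bar> \<in> C" "0 < x" using W_block[OF w C, of x] block_pos[OF C] block_abs[OF C] by auto
        then show "\<bar>w x\<bar> \<in> {i \<in> C. inv w i < 0}" using x neg by simp
      qed
      show "\<bar>w \<bar>inv w i\<bar>\<bar> = i" if "i \<in> {i \<in> C. inv w i < 0}" for i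
        using that block_pos[OF C, of i] neg by simp
      show "\<bar>inv w \<bar>w i\<bar>\<bar> = i" if "i \<in> {i \<in> C. w i < 0}" for i
        using that block_pos[OF C, of i] neg by simp
    qed
    then have "card {i\<in>C. inv w i < 0} = card {i\<in>C. w i < 0}" by (rule bij_betw_same_card)
    then show ?thesis using w that by (simp add: Wstr_def)
  qed
  have "\<bar>inv w i\<bar> \<in> C" if "C \<in> A \<union> B \<union> D" "i \<in> C" for C i
    using bl[OF that(1), of i] block_pos[OF that] that(2) by simp
  then show "inv w \<in> W" using inv_Wn[OF wW] sg ev unfolding Wstr_def by blast
qed

lemma sref_in_W:
  assumes C: "C \<in> A \<union> B \<union> D" "\<bar>i\<bar> \<in> C" "\<bar>j\<bar> \<in> C"
    and A: "C \<in> A \<Longrightarrow> i > 0 \<longleftrightarrow> j > 0"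
    and D: "C \<in> D \<Longrightarrow> \<bar>i\<bar> \<noteq> \<bar>j\<bar>"
  shows "sref i j \<in> W"
proof -
  have ij: "i \<in> spts n" "j \<in> spts n" using block_spts C by blast+
  then have nz: "i \<noteq> 0" "j \<noteq> 0" using spts_nonzero by auto
  have fixd: "sref i j p = p" if "C' \<in> A \<union> B \<union> D" "p \<in> C'" "C' \<noteq> C" for p C'
  proof -
    have "p > 0" using block_pos that by blast
    moreover have "p \<notin> C" using disj[OF C(1) that(1)] that by blast
    ultimately show ?thesis using C by (intro sref_other) auto
  qed
  have pos_same: "sref i j p > 0" if "p > 0" "i > 0 \<longleftrightarrow> j > 0" for p
    using sref_moves[of i j p] that nz by (cases "sref i j p = p") auto
  have 1: "\<bar>sref i j p\<bar> \<in> C'" if "C' \<in> A \<union> B \<union> D" "p \<in> C'" for p C'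
  proof (cases "C' = C")
    case True
    then show ?thesis using that C block_pos[OF that] by (auto simp: sref_def)
  next
    case False
    then show ?thesis using fixd[OF that False] that block_pos[OF that] by simp
  qed
  have 2: "sref i j p > 0" if "C' \<in> A" "p \<in> C'" for p C'
  proof (cases "C' = C")
    case True
    have "p > 0" using that block_pos[of C'] by blast
    then show ?thesis using A True that pos_same by blast
  next
    case False
    then show ?thesis using fixd[OF _ _ False, of p] that block_pos[of C' p] by simp
  qed
  have 3: "even (card {p\<in>C'. sref i j p < 0})" if "C' \<in> D" for C'
  proof (cases "C' = C")
    case False
    then have "{p\<in>C'. sref i j p < 0} = {}" 
      using fixd[of C'] that block_pos[of C'] by fastforce
    then show ?thesis by (simp only: card.empty even_zero)
  next
    case True
    have ne: "\<bar>i\<bar> \<noteq> \<bar>j\<bar>" using D that True by blast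
    show ?thesis
    proof (cases "i > 0 \<longleftrightarrow> j > 0")
      case T: True
      have "{p\<in>C'. sref i j p < 0} = {}" 
        using pos_same[OF block_pos[of C'] T] that by (auto simp: not_less intro: less_imp_le)
      then show ?thesis by (simp only: card.empty even_zero)
    next
      case F: False
      have "{p\<in>C'. sref i j p < 0} = {\<bar>i\<bar>, \<bar>j\<bar>}"
      proof
        show "{\<bar>i\<bar>, \<bar>j\<bar>} \<subseteq> {p\<in>C'. sref i j p < 0}"
        proof -
          have *: "sref a b \<bar>a\<bar> < 0" if "a \<noteq> 0" "b \<noteq> 0" "(a > 0) \<noteq> (b > 0)" for a b
            using that by (cases "a > 0") (auto simp: not_less)
          show ?thesis using *[of i j] *[of j i] F nz C True sref_commute[of i j] by simp
        qed
        show "{p\<in>C'. sref i j p < 0} \<subseteq> {\<bar>i\<bar>, \<bar>j\<bar>}"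
        proof
          fix p assume p: "p \<in> {p\<in>C'. sref i j p < 0}"
          then have "p > 0" using block_pos[of C'] that by blast
          then show "p \<in> {\<bar>i\<bar>, \<bar>j\<bar>}" using sref_other[of p i j] p by force
        qed
      qed
      then show ?thesis using ne by simp
    qed
  qed
  show ?thesis using sref_Wn[OF ij] 1 2 3 unfolding Wstr_def by blast
qed

lemma W_refl_subgroup: "refl_subgroup n W"
proof (rule refl_subgroupI, rule subgroup_gen_refls[OF is_subgroup_W])
  fix w i assume w: "w \<in> W" and i: "\<bar>w i\<bar> \<noteq> \<bar>i\<bar>"
  have "i \<in> spts n" using i Wn_not_in[OF W_Wn[OF w]] by metis
  then obtain C where C: "C \<in> A \<union> B \<union> D" "\<bar>i\<bar> \<in> C" using block_of by blast
  show "sref i (w i) \<in> W"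
    by (rule sref_in_W[OF C]) (use C W_block[OF w C(1)] W_sgn[OF w] i in auto)
next
  fix w i assume w: "w \<in> W" and diag: "\<And>j. \<bar>w j\<bar> = \<bar>j\<bar>" and i: "i \<in> spts n" "w i = - i"
  obtain C where C: "C \<in> A \<union> B \<union> D" "\<bar>i\<bar> \<in> C" using block_of i by blast
  have wi: "w \<bar>i\<bar> = - \<bar>i\<bar>" using i Wn_uminus[OF W_Wn[OF w]] by (simp add: abs_if)
  have pos: "\<bar>i\<bar> > 0" using block_pos C by blast
  have "C \<notin> A" using W_sgn[OF w, of C "\<bar>i\<bar>"] C wi pos by auto
  then consider "C \<in> B" | "C \<in> D" using C by blast
  then show "sref i (- i) \<in> W \<or> (\<exists>k\<in>spts n. \<bar>k\<bar> \<noteq> \<bar>i\<bar> \<and> w k = - k \<and> sref i k \<in> W \<and> sref i (- k) \<in> W)"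
  proof cases
    case 1
    then have "sref i (- i) \<in> W" using types C by (intro sref_in_W[of C]) auto
    then show ?thesis by blast
  next
    case 2
    \<comment> \<open>Parity forces a second negated line \<open>k\<close> in the block, and the
      sign changes at \<open>i\<close> and \<open>k\<close> together are the product of
      \<open>sref i k\<close> and \<open>sref i (- k)\<close>.\<close>
    have "even (card {p\<in>C. w p < 0})" using w 2 by (simp add: Wstr_def)
    moreover have "\<bar>i\<bar> \<in> {p\<in>C. w p < 0}" using C wi pos by simp
    ultimately have "{p\<in>C. w p < 0} \<noteq> {\<bar>i\<bar>}" by auto
    then obtain k where k: "k \<in> C" "w k < 0" "k \<noteq> \<bar>i\<bar>"
      using \<open>\<bar>i\<bar> \<in> {p\<in>C. w p < 0}\<close> by blast
    have kpos: "k > 0" using block_pos C k by blast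
    have "w k = - k" using diag[of k] k kpos by simp
    moreover have "sref i k \<in> W" "sref i (- k) \<in> W"
      using C k kpos types 2 by (auto intro!: sref_in_W[of C])
    moreover have "k \<in> spts n" using block_spts[OF C(1), of k] k kpos by simp
    ultimately show ?thesis using k kpos by (intro disjI2 bexI[of _ k]) auto
  qed
qed

lemma orb_W_abs:
  assumes "C \<in> A \<union> B \<union> D" "\<bar>i\<bar> \<in> C"
  shows "abs ` orb W i = C"
proof
  show "abs ` orb W i \<subseteq> C" using W_block assms by (auto simp: orb_def)
  show "C \<subseteq> abs ` orb W i"
  proof
    fix j assume j: "j \<in> C"
    then have jp: "j > 0" using block_pos assms by blast
    define j' where "j' = (if i > 0 then j else - j)"
    have "j' \<in> orb W i"
    proof (cases "\<bar>i\<bar> = j")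
      case True
      then have "j' = i" by (auto simp: j'_def)
      then show ?thesis using orb_refl[OF is_subgroup_W] by simp
    next
      case False
      have "i \<noteq> 0" using assms block_pos by fastforce
      then have "sref i j' \<in> W"
        using assms j jp False by (intro sref_in_W[OF assms]) (auto simp: j'_def)
      then show ?thesis by (rule orb_sref)
    qed
    moreover have "j = \<bar>j'\<bar>" using jp by (simp add: j'_def)
    ultimately show "j \<in> abs ` orb W i" by blast
  qed
qed

text \<open>In type B a sign change leads to \<open>- i\<close>; in type D a detour through a second
  line \<open>k\<close> does, which exists by \<open>D_card\<close>. In type A all elements preserve
  signs.\<close>

lemma uminus_in_orb_W:
  assumes "C \<in> A \<union> B \<union> D" "\<bar>i\<bar> \<in> C"
  shows "- i \<in> orb W i \<longleftrightarrow> C \<notin> A"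
proof
  have nz: "i \<noteq> 0" using assms block_pos by fastforce
  assume "- i \<in> orb W i"
  then obtain w where "w \<in> W" "w i = - i" by (auto simp: orb_def)
  then show "C \<notin> A" using W_sgn[of w C i] assms nz by auto
next
  assume nA: "C \<notin> A"
  show "- i \<in> orb W i"
  proof (cases "C \<in> B")
    case True
    then show ?thesis using assms types by (intro orb_sref sref_in_W[of C]) auto
  next
    case False
    then have D: "C \<in> D" using nA assms by blast
    then have "card C > 1" by (rule D_card)
    then obtain k where k: "k \<in> C" "k \<noteq> \<bar>i\<bar>"
      using assms by (metis card_1_singleton_iff is_singletonI' is_singleton_altdef less_numeral_extra(4) empty_iff)
    have "k > 0" using block_pos assms k by blast
    then have "sref i k \<in> W" "sref k (- i) \<in> W"
      using assms k nA by (auto intro!: sref_in_W[of C])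
    then show ?thesis using orb_sref orb_trans[OF is_subgroup_W] by blast
  qed
qed

lemma sref_half_in_W:
  assumes "C \<in> A \<union> B \<union> D" "\<bar>i\<bar> \<in> C"
  shows "sref i (- i) \<in> W \<longleftrightarrow> C \<in> B"
proof
  have pos: "\<bar>i\<bar> > 0" using assms block_pos by fastforce
  assume s: "sref i (- i) \<in> W"
  then have "- i \<in> orb W i" by (rule orb_sref)
  then have "C \<notin> A" using uminus_in_orb_W assms by blast
  moreover have "C \<notin> D"
  proof
    assume "C \<in> D"
    then have "even (card {p\<in>C. sref i (- i) p < 0})" using s by (simp add: Wstr_def)
    moreover have "{p\<in>C. sref i (- i) p < 0} = {\<bar>i\<bar>}"
      using assms block_pos[OF assms(1)] pos by (force simp: sref_def abs_if split: if_splits)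
    ultimately show False by simp
  qed
  ultimately show "C \<in> B" using assms by blast
next
  assume "C \<in> B"
  then show "sref i (- i) \<in> W" using assms types by (intro sref_in_W[of C]) auto
qed

end

text \<open>The three kinds of classes of lines, told apart by whether the orbit of \<open>i\<close>
  contains \<open>- i\<close> and whether the sign change at \<open>i\<close> belongs to the group.
  For a group \<open>Wstr n A B D\<close> they return \<open>A\<close>, \<open>B\<close> and
  \<open>D\<close> (\<open>cls_W\<close>), so the block sizes are conjugacy invariants.\<close>

definition clsA :: "nat \<Rightarrow> (int \<Rightarrow> int) set \<Rightarrow> int set set" where
  "clsA n H = {abs ` orb H i | i. i \<in> {1..int n} \<and> - i \<notin> orb H i}"

definition clsB :: "nat \<Rightarrow> (int \<Rightarrow> int) set \<Rightarrow> int set set" where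
  "clsB n H = {abs ` orb H i | i. i \<in> {1..int n} \<and> sref i (- i) \<in> H}"

definition clsD :: "nat \<Rightarrow> (int \<Rightarrow> int) set \<Rightarrow> int set set" where
  "clsD n H = {abs ` orb H i | i. i \<in> {1..int n} \<and> - i \<in> orb H i \<and> sref i (- i) \<notin> H}"

context blocks
begin

lemma cls_W: "clsA n W = A" "clsB n W = B" "clsD n W = D"
proof -
  have ex: "\<exists>i\<in>{1..int n}. \<bar>i\<bar> \<in> C" if "C \<in> A \<union> B \<union> D" for C
  proof -
    have "C \<noteq> {}" using nonempty that by metis
    then obtain i where "i \<in> C" by blast
    then show ?thesis using block_subset[OF that] block_abs[OF that] by (intro bexI[of _ i]) auto
  qed
  have *: "{abs ` orb W i | i. i \<in> {1..int n} \<and> P i} = X"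
    if X: "X \<subseteq> A \<union> B \<union> D" and P: "\<And>i C. C \<in> A \<union> B \<union> D \<Longrightarrow> \<bar>i\<bar> \<in> C \<Longrightarrow> P i \<longleftrightarrow> C \<in> X" for P X
  proof
    show "{abs ` orb W i | i. i \<in> {1..int n} \<and> P i} \<subseteq> X"
    proof clarify
      fix i assume i: "i \<in> {1..int n}" "P i"
      then obtain C where "C \<in> A \<union> B \<union> D" "\<bar>i\<bar> \<in> C" using block_of[of i] by (auto simp: spts_def)
      then show "abs ` orb W i \<in> X" using orb_W_abs P i by metis
    qed
    show "X \<subseteq> {abs ` orb W i | i. i \<in> {1..int n} \<and> P i}"
    proof
      fix C assume "C \<in> X"
      moreover obtain i where "i \<in> {1..int n}" "\<bar>i\<bar> \<in> C" using ex X \<open>C \<in> X\<close> by blast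
      ultimately have "C = abs ` orb W i" "P i" using orb_W_abs P X by blast+
      then show "C \<in> {abs ` orb W i | i. i \<in> {1..int n} \<and> P i}" using \<open>i \<in> {1..int n}\<close> by blast
    qed
  qed
  show "clsA n W = A" unfolding clsA_def 
    by (rule *) (use uminus_in_orb_W in auto)
  show "clsB n W = B" unfolding clsB_def 
    by (rule *) (use sref_half_in_W in auto)
  show "clsD n W = D" unfolding clsD_def 
    by (rule *) (use sref_half_in_W uminus_in_orb_W types in auto)
qed

end

section \<open>Conjugacy of reflection subgroups\<close>

lemma orb_eq: 
  assumes "is_subgroup n H" "j \<in> orb H i"
  shows "orb H j = orb H i"
  using assms orb_trans orb_sym by blast

lemma orb_uminus_iff: "is_subgroup n H \<Longrightarrow> - j \<in> orb H (- i) \<longleftrightarrow> j \<in> orb H i"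
  using orb_uminus[of n H j i] orb_uminus[of n H "- j" "- i"] by auto

lemma abs_orb_uminus: "is_subgroup n H \<Longrightarrow> abs ` orb H (- i) = abs ` orb H i"
proof -
  assume H: "is_subgroup n H"
  have "abs ` orb H i \<subseteq> abs ` orb H (- i)" for i
  proof
    fix x assume "x \<in> abs ` orb H i"
    then obtain y where "y \<in> orb H i" "x = \<bar>y\<bar>" by blast
    then have "- y \<in> orb H (- i)" "x = \<bar>- y\<bar>" using orb_uminus[OF H] by auto
    then show "x \<in> abs ` orb H (- i)" by blast
  qed
  from this[of i] this[of "- i"] show ?thesis by simp
qed

lemma uminus_in_orb_cong:
  assumes "is_subgroup n H" "j \<in> orb H i"
  shows "- j \<in> orb H j \<longleftrightarrow> - i \<in> orb H i"
  using orb_eq[OF assms] orb_eq[OF assms(1) orb_uminus[OF assms]] assms orb_refl orb_trans orb_sym by metis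

lemma sref_half_cong:
  assumes "is_subgroup n H" "j \<in> orb H i"
  shows "sref j (- j) \<in> H \<longleftrightarrow> sref i (- i) \<in> H"
proof -
  have *: "sref j (- j) \<in> H" if "sref i (- i) \<in> H" "j \<in> orb H i" for i j
  proof -
    obtain g where g: "g \<in> H" "j = g i" using \<open>j \<in> orb H i\<close> unfolding orb_def by blast
    have gW: "g \<in> Wn n" using g is_subgroupD(1)[OF assms(1)] by blast
    have "g \<circ> sref i (- i) \<circ> inv g \<in> H"
      using g that is_subgroupD(3,4)[OF assms(1)] by blast
    then show ?thesis using sref_conj[OF gW] g Wn_uminus[OF gW] by simp
  qed
  then show ?thesis using assms orb_sym by blast
qed

lemma abs_orb_cong:
  assumes "is_subgroup n H" "\<bar>j\<bar> \<in> abs ` orb H i" "i \<noteq> 0"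
  shows "abs ` orb H j = abs ` orb H i" "- j \<in> orb H j \<longleftrightarrow> - i \<in> orb H i"
    "sref j (- j) \<in> H \<longleftrightarrow> sref i (- i) \<in> H"
proof -
  obtain k where k: "k \<in> orb H i" "\<bar>j\<bar> = \<bar>k\<bar>" using assms by blast
  have "j = k \<or> j = - k" using k(2) by linarith
  then show "abs ` orb H j = abs ` orb H i" "- j \<in> orb H j \<longleftrightarrow> - i \<in> orb H i"
    "sref j (- j) \<in> H \<longleftrightarrow> sref i (- i) \<in> H"
    using orb_eq[OF assms(1) k(1)] abs_orb_uminus[OF assms(1), of k] orb_uminus_iff[OF assms(1), of k "- k"]
      uminus_in_orb_cong[OF assms(1) k(1)] sref_half_cong[OF assms(1) k(1)] sref_commute[of k "- k"]
    by auto
qed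

text \<open>Both distinguishing properties are constant along a class, which gives disjointness. The
  size condition for \<open>clsD\<close> comes from \<open>sref_orbit_cases\<close>: reaching
  \<open>- i\<close> without the sign change at \<open>i\<close> takes a reflection to another
  line.\<close>

lemma blocks_cls:
  assumes R: "refl_subgroup n R"
  shows "blocks n (clsA n R) (clsB n R) (clsD n R)"
proof
  note H = refl_subgroup_gen(1)[OF R]
  have union: "clsA n R \<union> clsB n R \<union> clsD n R = (\<lambda>i. abs ` orb R i) ` {1..int n}"
    unfolding clsA_def clsB_def clsD_def using orb_sref[of i "- i" R for i] by blast
  have sub: "abs ` orb R i \<subseteq> {1..int n}" if "i \<in> {1..int n}" for i
    using orb_spts[OF H, of _ i] that by (fastforce simp: spts_def)
  have self: "i \<in> abs ` orb R i" if "i \<in> {1..int n}" for i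
    using orb_refl[OF H, of i] that by force
  show "\<Union> (clsA n R \<union> clsB n R \<union> clsD n R) = {1..int n}"
    unfolding union
  proof (intro equalityI subsetI)
    fix x assume "x \<in> \<Union> ((\<lambda>i. abs ` orb R i) ` {1..int n})"
    then obtain i where "i \<in> {1..int n}" "x \<in> abs ` orb R i" by blast
    then show "x \<in> {1..int n}" using sub by blast
  next
    fix x assume "x \<in> {1..int n}"
    then show "x \<in> \<Union> ((\<lambda>i. abs ` orb R i) ` {1..int n})" using self by (intro UN_I[of x]) auto
  qed
  show "{} \<notin> clsA n R \<union> clsB n R \<union> clsD n R"
  proof
    assume "{} \<in> clsA n R \<union> clsB n R \<union> clsD n R"
    then obtain i where "i \<in> {1..int n}" "{} = abs ` orb R i" unfolding union by (rule imageE)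
    then show False using self by blast
  qed
  have cong: "\<bar>x\<bar> \<in> abs ` orb R i" if "x \<in> abs ` orb R i" for x i using that by auto
  show "C = C'" if C: "C \<in> clsA n R \<union> clsB n R \<union> clsD n R" "C' \<in> clsA n R \<union> clsB n R \<union> clsD n R"
    "x \<in> C" "x \<in> C'" for C C' x
  proof -
    obtain i where i: "C = abs ` orb R i" "i \<in> {1..int n}" using C(1) unfolding union by (rule imageE)
    obtain j where j: "C' = abs ` orb R j" "j \<in> {1..int n}" using C(2) unfolding union by (rule imageE)
    show ?thesis
      using abs_orb_cong(1)[OF H cong, of x i] abs_orb_cong(1)[OF H cong, of x j] i j C(3,4) by simp
  qed
  have same: "(- i \<in> orb R i \<longleftrightarrow> - j \<in> orb R j) \<and> (sref i (- i) \<in> R \<longleftrightarrow> sref j (- j) \<in> R)"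
    if "abs ` orb R i = abs ` orb R j" "i \<in> {1..int n}" "j \<in> {1..int n}" for i j
    using abs_orb_cong(2,3)[OF H, of i j] self[OF that(2)] that by auto
  have half: "sref i (- i) \<in> R \<Longrightarrow> - i \<in> orb R i" for i by (rule orb_sref)
  have disjI: "{abs ` orb R i | i. i \<in> {1..int n} \<and> P i} \<inter> {abs ` orb R i | i. i \<in> {1..int n} \<and> Q i} = {}"
    if "\<And>i j. abs ` orb R i = abs ` orb R j \<Longrightarrow> i \<in> {1..int n} \<Longrightarrow> j \<in> {1..int n} \<Longrightarrow> P i \<Longrightarrow> Q j \<Longrightarrow> False" for P Q
    using that by blast
  show "clsA n R \<inter> clsB n R = {}"
    unfolding clsA_def clsB_def by (rule disjI) (use same half in blast)
  show "clsA n R \<inter> clsD n R = {}"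
    unfolding clsA_def clsD_def by (rule disjI) (use same in blast)
  show "clsB n R \<inter> clsD n R = {}"
    unfolding clsB_def clsD_def by (rule disjI) (use same in blast)
  show "card C > 1" if "C \<in> clsD n R" for C
  proof -
    obtain i where i: "i \<in> {1..int n}" "- i \<in> orb R i" "sref i (- i) \<notin> R" "C = abs ` orb R i"
      using \<open>C \<in> clsD n R\<close> unfolding clsD_def by blast
    have isp: "i \<in> spts n" using i by (auto simp: spts_def)
    obtain k where k: "\<bar>k\<bar> \<noteq> \<bar>i\<bar>" "sref i k \<in> R"
      using sref_orbit_cases[OF R isp i(2)] i spts_nonzero[OF isp] by auto
    have "\<bar>k\<bar> \<in> C" "\<bar>i\<bar> \<in> C" using orb_sref[OF k(2)] orb_refl[OF H, of i] i(4) by blast+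
    moreover have "finite C" using sub[OF i(1)] i finite_subset by blast
    ultimately have "card {\<bar>k\<bar>, \<bar>i\<bar>} \<le> card C" by (intro card_mono) auto
    then show ?thesis using k by simp
  qed
qed

text \<open>A reflection subgroup is determined by the reflections it contains, so it is enough that
  \<open>g\<close> matches these.\<close>

lemma conj_subI:
  assumes R: "refl_subgroup n R" and K: "refl_subgroup n K" and g: "g \<in> Wn n"
    and iff: "\<And>i j. i \<in> spts n \<Longrightarrow> j \<in> spts n \<Longrightarrow> i \<noteq> j \<Longrightarrow> sref i j \<in> R \<longleftrightarrow> sref (g i) (g j) \<in> K"
  shows "conj_sub n R K"
proof -
  have sub: "(\<lambda>h. g \<circ> h \<circ> inv g) ` R \<subseteq> K" if R: "refl_subgroup n R" and K: "is_subgroup n K" 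
      and g: "g \<in> Wn n"
      and iff: "\<And>i j. i \<in> spts n \<Longrightarrow> j \<in> spts n \<Longrightarrow> i \<noteq> j \<Longrightarrow> sref i j \<in> R \<Longrightarrow> sref (g i) (g j) \<in> K"
    for R K g
  proof clarify
    fix h assume "h \<in> R"
    then obtain ws where ws: "h = evalw ws" "set ws \<subseteq> R \<inter> refls n"
      using gen_evalw[of "R \<inter> refls n" n] refl_subgroup_gen[OF R] by blast
    have "g \<circ> evalw ws \<circ> inv g \<in> K" using ws(2)
    proof (induction ws)
      case Nil
      then show ?case using g is_subgroupD(2)[OF K] by (simp add: id_def)
    next
      case (Cons s ws)
      obtain i j where "s = sref i j" "i \<in> spts n" "j \<in> spts n" "i \<noteq> j"
        using Cons.prems by (auto elim: reflsE)
      then have "g \<circ> s \<circ> inv g \<in> K" using iff Cons.prems sref_conj[OF g] by auto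
      moreover have "g \<circ> evalw ws \<circ> inv g \<in> K" by (rule Cons.IH) (use Cons.prems in simp)
      ultimately have "(g \<circ> s \<circ> inv g) \<circ> (g \<circ> evalw ws \<circ> inv g) \<in> K" by (rule is_subgroupD(3)[OF K])
      moreover have "(g \<circ> s \<circ> inv g) \<circ> (g \<circ> evalw ws \<circ> inv g) = g \<circ> evalw (s # ws) \<circ> inv g"
        using g by (simp add: fun_eq_iff)
      ultimately show ?case by (simp only:)
    qed
    then show "g \<circ> h \<circ> inv g \<in> K" using ws by simp
  qed
  have 1: "(\<lambda>h. g \<circ> h \<circ> inv g) ` R \<subseteq> K"
    by (rule sub[OF R refl_subgroup_gen(1)[OF K] g]) (use iff in blast)
  have 2: "(\<lambda>h. inv g \<circ> h \<circ> inv (inv g)) ` K \<subseteq> R"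
  proof (rule sub[OF K refl_subgroup_gen(1)[OF R] inv_Wn[OF g]])
    fix i j assume ij: "i \<in> spts n" "j \<in> spts n" "i \<noteq> j" "sref i j \<in> K"
    have ne: "inv g i \<noteq> inv g j" using ij Wn_eq_iff[OF inv_Wn[OF g]] by blast
    have "inv g i \<in> spts n" "inv g j \<in> spts n" using ij Wn_in_spts[OF inv_Wn[OF g]] by blast+
    from iff[OF this ne] show "sref (inv g i) (inv g j) \<in> R" using ij g by simp
  qed
  have "K \<subseteq> (\<lambda>h. g \<circ> h \<circ> inv g) ` R"
  proof
    fix h assume "h \<in> K"
    then have "inv g \<circ> h \<circ> g \<in> R" using 2 g by (auto simp: image_subset_iff)
    moreover have "h = g \<circ> (inv g \<circ> h \<circ> g) \<circ> inv g" using g by (simp add: fun_eq_iff)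
    ultimately show "h \<in> (\<lambda>h. g \<circ> h \<circ> inv g) ` R" by blast
  qed
  then show ?thesis unfolding conj_sub_def using 1 g by blast
qed

lemma image_mset_eq_imp_bij_betw:
  assumes "finite X" "finite Y" "image_mset f (mset_set X) = image_mset g (mset_set Y)"
  shows "\<exists>b. bij_betw b X Y \<and> (\<forall>x\<in>X. g (b x) = f x)"
  using assms
proof (induction X arbitrary: Y rule: finite_induct)
  case empty
  then show ?case by (auto simp: bij_betw_def mset_set_empty_iff dest: sym)
next
  case (insert x X)
  have "f x \<in># image_mset g (mset_set Y)" using insert.prems(2)[symmetric] insert.hyps by simp
  then obtain y where y: "y \<in> Y" "f x = g y" using insert.prems by auto
  have "image_mset f (mset_set X) = image_mset g (mset_set (Y - {y}))"
    using insert.prems(2) insert.hyps y mset_set.remove[OF insert.prems(1) y(1)] by simp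
  then obtain b where b: "bij_betw b X (Y - {y})" "\<forall>x\<in>X. g (b x) = f x"
    using insert.IH[of "Y - {y}"] insert.prems by auto
  have "bij_betw (b(x := y)) X (Y - {y})"
    by (rule iffD1[OF bij_betw_cong b(1)]) (use insert.hyps in auto)
  then have "bij_betw (b(x := y)) (X \<union> {x}) ((Y - {y}) \<union> {(b(x := y)) x})"
    using insert.hyps by (intro notIn_Un_bij_betw) auto
  then have "bij_betw (b(x := y)) (insert x X) Y" using y by (simp add: insert_absorb)
  moreover have "\<forall>z\<in>insert x X. g ((b(x := y)) z) = f z" using b y insert.hyps by auto
  ultimately show ?case by blast
qed

text \<open>In a class of type A an orbit contains exactly one of the two points of each line;
  \<open>orient H i\<close> records which one, relative to the least line of the class. In the other
  classes the orbit contains both points and the value is 1. A conjugating element has to respect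
  these choices.\<close>

definition orient :: "(int \<Rightarrow> int) set \<Rightarrow> int \<Rightarrow> int" where
  "orient H i = (if i \<in> orb H (Min (abs ` orb H i)) then 1 else - 1)"

lemma orient_cases: "orient H i = 1 \<or> orient H i = - 1"
  by (simp add: orient_def)

lemma orient_orb:
  assumes H: "is_subgroup n H" and i: "i \<in> {1..int n}"
  shows "orient H i * i \<in> orb H (Min (abs ` orb H i))"
proof -
  have "finite (orb H i)"
  proof (rule finite_subset[OF _ finite_spts[of n]])
    have "i \<in> spts n" using i by (simp add: spts_def)
    then show "orb H i \<subseteq> spts n" using orb_spts[OF H] by blast
  qed
  then have "Min (abs ` orb H i) \<in> abs ` orb H i"
    using orb_refl[OF H, of i] by (intro Min_in) auto
  then obtain k where k: "k \<in> orb H i" "Min (abs ` orb H i) = \<bar>k\<bar>" by blast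
  have "i \<in> orb H k" using k orb_sym[OF H] by blast
  then have "i \<in> orb H \<bar>k\<bar> \<or> - i \<in> orb H \<bar>k\<bar>" using orb_uminus[OF H, of i k] by (auto simp: abs_if)
  then show ?thesis using k by (auto simp: orient_def)
qed

text \<open>Within one class the orbit relation is decided by signs alone, which makes it comparable
  between two different groups.\<close>

lemma orient_orb_iff:
  assumes H: "is_subgroup n H" and i: "i \<in> {1..int n}" and j: "j \<in> {1..int n}"
    and cl: "j \<in> abs ` orb H i" and ab: "a = 1 \<or> a = - 1" "b = 1 \<or> b = - 1"
  shows "b * j \<in> orb H (a * i) \<longleftrightarrow> - i \<in> orb H i \<or> b * orient H j = a * orient H i"
proof -
  have eq: "abs ` orb H j = abs ` orb H i"
    using abs_orb_cong(1)[OF H, of j i] cl i j by auto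
  have 1: "orient H j * j \<in> orb H (orient H i * i)"
    using orient_orb[OF H i] orient_orb[OF H j] orb_sym[OF H] orb_trans[OF H] unfolding eq by blast
  then have 2: "- (orient H j * j) \<in> orb H (- (orient H i * i))" by (rule orb_uminus[OF H])
  have flip: "- i \<in> orb H i \<longleftrightarrow> - x \<in> orb H y" if "x \<in> orb H y" "y = i \<or> y = - i" for x y
  proof -
    have "- x \<in> orb H y \<longleftrightarrow> - x \<in> orb H x" using orb_eq[OF H that(1)] by simp
    also have "\<dots> \<longleftrightarrow> - y \<in> orb H y" by (rule uminus_in_orb_cong[OF H that(1)])
    also have "\<dots> \<longleftrightarrow> - i \<in> orb H i" using that(2) orb_uminus_iff[OF H, of i "- i"] by auto
    finally show ?thesis by simp
  qed
  show ?thesis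
    using ab orient_cases[of H i] orient_cases[of H j]
    by (elim disjE) (use 1 2 flip[OF 1] flip[OF 2] in simp_all)
qed

lemma refl_subgroup_sref_iff:
  assumes "refl_subgroup n R" "i \<in> spts n" "j \<in> spts n" "i \<noteq> j"
  shows "sref i j \<in> R \<longleftrightarrow> (if j = - i then sref i (- i) \<in> R else j \<in> orb R i)"
proof -
  have "\<bar>j\<bar> \<noteq> \<bar>i\<bar>" if "j \<noteq> - i" using that assms(4) by linarith
  then show ?thesis using sref_in_refl_subgroup[OF assms(1,2)] orb_sref by auto
qed

lemma bij_betw_blocks:
  assumes blk: "blocks n A B D" "blocks n A' B' D'"
    and F: "bij_betw F (A \<union> B \<union> D) (A' \<union> B' \<union> D')" "\<And>C. C \<in> A \<union> B \<union> D \<Longrightarrow> card (F C) = card C"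
  shows "\<exists>\<beta>. bij_betw \<beta> {1..int n} {1..int n} \<and> (\<forall>C\<in>A \<union> B \<union> D. \<forall>i\<in>C. \<beta> i \<in> F C)"
proof -
  interpret X: blocks n A B D by fact
  interpret Y: blocks n A' B' D' by fact
  have FC: "F C \<in> A' \<union> B' \<union> D'" if "C \<in> A \<union> B \<union> D" for C
    using F(1) that bij_betw_apply by fastforce
  have "\<exists>b. bij_betw b C (F C)" if "C \<in> A \<union> B \<union> D" for C
    using X.block_finite[OF that] Y.block_finite[OF FC[OF that]] F(2)[OF that] finite_same_card_bij by metis
  then obtain b where b: "\<And>C. C \<in> A \<union> B \<union> D \<Longrightarrow> bij_betw (b C) C (F C)" by metis
  define cl where "cl i = (THE C. C \<in> A \<union> B \<union> D \<and> i \<in> C)" for i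
  have cl: "cl i = C" if "C \<in> A \<union> B \<union> D" "i \<in> C" for i C
    unfolding cl_def using that X.disj by (intro the_equality) blast+
  define \<beta> where "\<beta> i = b (cl i) i" for i
  have \<beta>: "\<beta> i \<in> F C" if "C \<in> A \<union> B \<union> D" "i \<in> C" for i C
    using bij_betw_apply[OF b[OF that(1)] that(2)] cl[OF that] by (simp add: \<beta>_def)
  have ex: "\<exists>C\<in>A \<union> B \<union> D. i \<in> C" if "i \<in> {1..int n}" for i
    using X.cover that by blast
  have "inj_on \<beta> {1..int n}"
  proof (rule inj_onI)
    fix i j assume ij: "i \<in> {1..int n}" "j \<in> {1..int n}" "\<beta> i = \<beta> j"
    obtain C where C: "C \<in> A \<union> B \<union> D" "i \<in> C" using ex ij by blast
    obtain C' where C': "C' \<in> A \<union> B \<union> D" "j \<in> C'" using ex ij by blast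
    have "F C = F C'"
      using Y.disj[OF FC[OF C(1)] FC[OF C'(1)]] \<beta>[OF C] \<beta>[OF C'] ij(3) by simp
    then have "C = C'" using F(1) C(1) C'(1) inj_onD[of F "A \<union> B \<union> D" C C'] by (simp add: bij_betw_def)
    then show "i = j"
      using ij(3) b[OF C(1)] cl[OF C] cl[OF C'] C C' by (auto simp: \<beta>_def bij_betw_def inj_on_eq_iff)
  qed
  moreover have "\<beta> ` {1..int n} \<subseteq> {1..int n}"
    using ex \<beta> FC Y.block_subset by blast
  ultimately have "bij_betw \<beta> {1..int n} {1..int n}"
    by (simp add: bij_betw_def endo_inj_surj)
  then show ?thesis using \<beta> by blast
qed

text \<open>Blocks of equal kind and size are matched and the matching is spread to a bijection
  \<open>\<beta>\<close> of lines. Signs are then added so that orientations agree. The resulting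
  \<open>g\<close> preserves orbits and sign changes, and these decide which reflections lie in a
  reflection subgroup (\<open>refl_subgroup_sref_iff\<close>).\<close>

lemma conj_sub_if_same_cls:
  assumes R: "refl_subgroup n R" and K: "refl_subgroup n K"
    and eqA: "image_mset card (mset_set (clsA n R)) = image_mset card (mset_set (clsA n K))"
    and eqB: "image_mset card (mset_set (clsB n R)) = image_mset card (mset_set (clsB n K))"
    and eqD: "image_mset card (mset_set (clsD n R)) = image_mset card (mset_set (clsD n K))"
  shows "conj_sub n R K"
proof -
  interpret X: blocks n "clsA n R" "clsB n R" "clsD n R" using R by (rule blocks_cls)
  interpret Y: blocks n "clsA n K" "clsB n K" "clsD n K" using K by (rule blocks_cls)
  note HR = refl_subgroup_gen(1)[OF R] and HK = refl_subgroup_gen(1)[OF K]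
  have fin: "finite (clsA n R)" "finite (clsB n R)" "finite (clsD n R)"
    "finite (clsA n K)" "finite (clsB n K)" "finite (clsD n K)"
    using X.finite_blocks Y.finite_blocks by auto
  obtain fA where fA: "bij_betw fA (clsA n R) (clsA n K)" "\<forall>C\<in>clsA n R. card (fA C) = card C"
    using image_mset_eq_imp_bij_betw[OF fin(1,4) eqA] by blast
  obtain fB where fB: "bij_betw fB (clsB n R) (clsB n K)" "\<forall>C\<in>clsB n R. card (fB C) = card C"
    using image_mset_eq_imp_bij_betw[OF fin(2,5) eqB] by blast
  obtain fD where fD: "bij_betw fD (clsD n R) (clsD n K)" "\<forall>C\<in>clsD n R. card (fD C) = card C"
    using image_mset_eq_imp_bij_betw[OF fin(3,6) eqD] by blast
  define F where "F C = (if C \<in> clsA n R then fA C else if C \<in> clsB n R then fB C else fD C)" for C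
  have F: "bij_betw F (clsA n R) (clsA n K)" "bij_betw F (clsB n R) (clsB n K)" "bij_betw F (clsD n R) (clsD n K)"
    by (rule iffD2[OF bij_betw_cong fA(1)], simp add: F_def,
        rule iffD2[OF bij_betw_cong fB(1)], use X.types in \<open>auto simp: F_def\<close>,
        rule iffD2[OF bij_betw_cong fD(1)], use X.types in \<open>auto simp: F_def\<close>)
  have Fbij: "bij_betw F (clsA n R \<union> clsB n R \<union> clsD n R) (clsA n K \<union> clsB n K \<union> clsD n K)"
    using Y.types by (intro bij_betw_combine F) auto
  have Fcard: "card (F C) = card C" if "C \<in> clsA n R \<union> clsB n R \<union> clsD n R" for C
    using that fA fB fD X.types by (auto simp: F_def)
  obtain \<beta> where \<beta>: "bij_betw \<beta> {1..int n} {1..int n}"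
    "\<And>C i. C \<in> clsA n R \<union> clsB n R \<union> clsD n R \<Longrightarrow> i \<in> C \<Longrightarrow> \<beta> i \<in> F C"
    using bij_betw_blocks[OF X.blocks_axioms Y.blocks_axioms Fbij Fcard] by blast
  have \<beta>in: "\<beta> i \<in> {1..int n}" if "i \<in> {1..int n}" for i using \<beta>(1) that bij_betw_apply by fastforce
  have \<beta>inj: "\<beta> i = \<beta> j \<longleftrightarrow> i = j" if "i \<in> {1..int n}" "j \<in> {1..int n}" for i j 
    using \<beta>(1) that by (auto simp: bij_betw_def inj_on_eq_iff)
  have inA: "- i \<notin> orb H i \<longleftrightarrow> abs ` orb H i \<in> clsA n H" if "i \<in> {1..int n}" "refl_subgroup n H" for i H
  proof -
    have "- i \<notin> orb H i" if "abs ` orb H i = abs ` orb H k" "- k \<notin> orb H k" "k \<in> {1..int n}" for k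
    proof -
      have "\<bar>i\<bar> \<in> abs ` orb H k" using that orb_refl[OF refl_subgroup_gen(1)[OF \<open>refl_subgroup n H\<close>], of i] by auto
      then show ?thesis using abs_orb_cong(2)[OF refl_subgroup_gen(1)[OF \<open>refl_subgroup n H\<close>]] that by auto
    qed
    then show ?thesis using that by (auto simp: clsA_def)
  qed
  have inB: "sref i (- i) \<in> H \<longleftrightarrow> abs ` orb H i \<in> clsB n H" if "i \<in> {1..int n}" "refl_subgroup n H" for i H
  proof -
    have "sref i (- i) \<in> H" if "abs ` orb H i = abs ` orb H k" "sref k (- k) \<in> H" "k \<in> {1..int n}" for k
    proof -
      have "\<bar>i\<bar> \<in> abs ` orb H k" using that orb_refl[OF refl_subgroup_gen(1)[OF \<open>refl_subgroup n H\<close>], of i] by auto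
      then show ?thesis using abs_orb_cong(3)[OF refl_subgroup_gen(1)[OF \<open>refl_subgroup n H\<close>]] that by auto
    qed
    then show ?thesis using that by (auto simp: clsB_def)
  qed
  have all: "abs ` orb H i \<in> clsA n H \<union> clsB n H \<union> clsD n H" if "i \<in> {1..int n}" for i H
    using that unfolding clsA_def clsB_def clsD_def by blast
  have self: "i \<in> abs ` orb H i" if "i \<in> {1..int n}" "is_subgroup n H" for i H
    using orb_refl[OF that(2), of i] that by force
  have cls\<beta>: "abs ` orb K (\<beta> i) = F (abs ` orb R i)" if "i \<in> {1..int n}" for i
  proof -
    have "F (abs ` orb R i) \<in> clsA n K \<union> clsB n K \<union> clsD n K"
      using bij_betw_apply[OF Fbij all[OF that]] .
    moreover have "\<beta> i \<in> F (abs ` orb R i)" using \<beta>(2)[OF all self[OF _ HR]] that by blast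
    ultimately show ?thesis
      using Y.disj[OF all[of "\<beta> i" K] _ self[of "\<beta> i" K]] \<beta>in that HK by blast
  qed
  have Fmem: "F C \<in> clsA n K \<longleftrightarrow> C \<in> clsA n R" "F C \<in> clsB n K \<longleftrightarrow> C \<in> clsB n R" 
    if "C \<in> clsA n R \<union> clsB n R \<union> clsD n R" for C
  proof -
    have FC: "C \<in> clsA n R \<Longrightarrow> F C \<in> clsA n K" "C \<in> clsB n R \<Longrightarrow> F C \<in> clsB n K" "C \<in> clsD n R \<Longrightarrow> F C \<in> clsD n K"
      by (fact bij_betw_apply[OF F(1)] bij_betw_apply[OF F(2)] bij_betw_apply[OF F(3)])+
    have "x \<in> clsA n H \<Longrightarrow> x \<notin> clsB n H" "x \<in> clsA n H \<Longrightarrow> x \<notin> clsD n H" 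
      "x \<in> clsB n H \<Longrightarrow> x \<notin> clsD n H" if "H = R \<or> H = K" for x H
      using that X.types Y.types by blast+
    note excl = this[of R C] this[of K "F C"]
    show "F C \<in> clsA n K \<longleftrightarrow> C \<in> clsA n R" "F C \<in> clsB n K \<longleftrightarrow> C \<in> clsB n R"
      using \<open>C \<in> clsA n R \<union> clsB n R \<union> clsD n R\<close> FC excl by auto
  qed
  have types: "- \<beta> i \<in> orb K (\<beta> i) \<longleftrightarrow> - i \<in> orb R i" "sref (\<beta> i) (- \<beta> i) \<in> K \<longleftrightarrow> sref i (- i) \<in> R"
    if "i \<in> {1..int n}" for i
    using inA[OF that R] inA[OF \<beta>in[OF that] K] inB[OF that R] inB[OF \<beta>in[OF that] K] cls\<beta>[OF that] Fmem[OF all[OF that]]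
    by auto
  have clsiff: "\<beta> j \<in> abs ` orb K (\<beta> i) \<longleftrightarrow> j \<in> abs ` orb R i" if "i \<in> {1..int n}" "j \<in> {1..int n}" for i j
  proof -
    have *: "j \<in> abs ` orb H i \<longleftrightarrow> abs ` orb H j = abs ` orb H i" if "is_subgroup n H" "i \<in> {1..int n}" "j \<in> {1..int n}" for i j H
      using abs_orb_cong(1)[OF that(1), of j i] self[OF that(3,1)] that by auto
    have "F (abs ` orb R j) = F (abs ` orb R i) \<longleftrightarrow> abs ` orb R j = abs ` orb R i"
      by (rule inj_on_eq_iff[OF bij_betw_imp_inj_on[OF Fbij] all[OF that(2)] all[OF that(1)]])
    then show ?thesis using *[OF HR that] *[OF HK \<beta>in \<beta>in] that cls\<beta> by simp
  qed
  \<comment> \<open>The product of both orientations: multiplying \<open>\<sigma> p\<close> by the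
    orientation of the image in \<open>K\<close> leaves the sign of \<open>p\<close> times its
    orientation in \<open>R\<close>, which is exactly what \<open>orient_orb_iff\<close>
    compares.\<close>
  define \<sigma> where "\<sigma> p = sgn p * orient R \<bar>p\<bar> * orient K (\<beta> \<bar>p\<bar>)" for p
  define g where "g p = (if p \<in> spts n then \<sigma> p * \<beta> \<bar>p\<bar> else p)" for p
  have \<sigma>: "\<sigma> p = 1 \<or> \<sigma> p = - 1" if "p \<in> spts n" for p
    using spts_nonzero[OF that] orient_cases[of R "\<bar>p\<bar>"] orient_cases[of K "\<beta> \<bar>p\<bar>"]
    by (auto simp: \<sigma>_def sgn_if)
  have absg: "\<bar>g p\<bar> = \<beta> \<bar>p\<bar>" if "p \<in> spts n" for p
    using \<beta>in[of "\<bar>p\<bar>"] that \<sigma>[OF that] by (auto simp: g_def abs_mult abs_spts)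
  have godd: "g (- p) = - g p" for p by (simp add: g_def \<sigma>_def)
  have gsp: "g p \<in> spts n" if "p \<in> spts n" for p
    using absg[OF that] \<beta>in[of "\<bar>p\<bar>"] that by (simp add: abs_spts)
  have ginj: "p = q" if "p \<in> spts n" "q \<in> spts n" "g p = g q" for p q
  proof -
    have "\<bar>p\<bar> = \<bar>q\<bar>" using absg[OF that(1)] absg[OF that(2)] that \<beta>inj abs_spts by metis
    then consider "p = q" | "q = - p" by linarith
    then show ?thesis using godd[of p] that spts_nonzero[OF gsp[OF that(1)]] by cases auto
  qed
  have gW: "g \<in> Wn n"
    unfolding Wn_def
  proof (intro CollectI conjI allI impI)
    show "bij_betw g (spts n) (spts n)"
    proof -
      have "inj_on g (spts n)" using ginj by (intro inj_onI)
      moreover from this have "g ` spts n = spts n" using gsp by (intro endo_inj_surj) auto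
      ultimately show ?thesis by (simp add: bij_betw_def)
    qed
  qed (use godd in \<open>auto simp: g_def\<close>)
  have orbg: "g q \<in> orb K (g p) \<longleftrightarrow> q \<in> orb R p" if p: "p \<in> spts n" and q: "q \<in> spts n" for p q
  proof (cases "\<bar>q\<bar> \<in> abs ` orb R \<bar>p\<bar>")
    case True
    have pq: "\<bar>p\<bar> \<in> {1..int n}" "\<bar>q\<bar> \<in> {1..int n}" using p q abs_spts by auto
    have s: "sgn p = 1 \<or> sgn p = - 1" "sgn q = 1 \<or> sgn q = - 1" using p q spts_nonzero by (auto simp: sgn_if)
    have "q \<in> orb R p \<longleftrightarrow> - \<bar>p\<bar> \<in> orb R \<bar>p\<bar> \<or> sgn q * orient R \<bar>q\<bar> = sgn p * orient R \<bar>p\<bar>"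
      using orient_orb_iff[OF HR pq True s] by (simp add: sgn_abs_mult)
    moreover have "\<beta> \<bar>q\<bar> \<in> abs ` orb K (\<beta> \<bar>p\<bar>)" using True clsiff pq by blast
    from orient_orb_iff[OF HK \<beta>in[OF pq(1)] \<beta>in[OF pq(2)] this \<sigma>[OF p] \<sigma>[OF q]]
    have "g q \<in> orb K (g p) \<longleftrightarrow> - \<beta> \<bar>p\<bar> \<in> orb K (\<beta> \<bar>p\<bar>) \<or> \<sigma> q * orient K (\<beta> \<bar>q\<bar>) = \<sigma> p * orient K (\<beta> \<bar>p\<bar>)"
      using p q by (simp add: g_def)
    moreover have "\<sigma> x * orient K (\<beta> \<bar>x\<bar>) = sgn x * orient R \<bar>x\<bar>" for x
      using orient_cases[of K "\<beta> \<bar>x\<bar>"] by (auto simp: \<sigma>_def)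
    ultimately show ?thesis using types(1)[OF pq(1)] by simp
  next
    case False
    have pq: "\<bar>p\<bar> \<in> {1..int n}" "\<bar>q\<bar> \<in> {1..int n}" using p q abs_spts by auto
    have *: "abs ` orb H \<bar>x\<bar> = abs ` orb H x" if "is_subgroup n H" for H x
      using abs_orb_uminus[OF that] by (simp add: abs_if)
    have "q \<notin> orb R p" using False *[OF HR, of p] by blast
    moreover have "\<bar>g q\<bar> \<notin> abs ` orb K \<bar>g p\<bar>" 
      using False clsiff[OF pq] absg p q by simp
    then have "g q \<notin> orb K (g p)" using *[OF HK, of "g p"] by blast
    ultimately show ?thesis by blast
  qed
  show ?thesis
  proof (rule conj_subI[OF R K gW])
    fix i j assume ij: "i \<in> spts n" "j \<in> spts n" "i \<noteq> j"
    have gij: "g i \<in> spts n" "g j \<in> spts n" "g i \<noteq> g j" "g j = - g i \<longleftrightarrow> j = - i"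
      using ij gsp ginj Wn_eq_uminus_iff[OF gW, of j i] by auto
    have "sref (g i) (- g i) \<in> K \<longleftrightarrow> sref i (- i) \<in> R"
    proof -
      have *: "sref \<bar>x\<bar> (- \<bar>x\<bar>) = sref x (- x)" for x
        by (auto simp: abs_if sref_commute)
      show ?thesis using *[of i] *[of "g i"] absg[OF ij(1)] types(2)[of "\<bar>i\<bar>"] ij(1) abs_spts by simp
    qed
    then show "sref i j \<in> R \<longleftrightarrow> sref (g i) (g j) \<in> K"
      using refl_subgroup_sref_iff[OF R ij] refl_subgroup_sref_iff[OF K gij(1-3)] gij(4) orbg[OF ij(1,2)]
      by (cases "j = - i") auto
  qed
qed


text \<open>Conjugation by \<open>g\<close> permutes the lines through the absolute value of
  \<open>g\<close> and carries classes to classes of the same size. The properties \<open>P\<close>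
  and \<open>Q\<close> are kept abstract to serve all three kinds.\<close>

lemma cls_conj_image:
  assumes H: "is_subgroup n H" and K: "is_subgroup n K" and g: "g \<in> Wn n" 
    and orbK: "\<And>i. orb K (g i) = g ` orb H i"
    and P: "\<And>i. i \<in> {1..int n} \<Longrightarrow> Q \<bar>g i\<bar> \<longleftrightarrow> P i"
  shows "image_mset card (mset_set {abs ` orb K j | j. j \<in> {1..int n} \<and> Q j})
    = image_mset card (mset_set {abs ` orb H i | i. i \<in> {1..int n} \<and> P i})" (is "_ (mset_set ?Y) = _ (mset_set ?X)")
proof -
  define \<gamma> where "\<gamma> i = \<bar>g i\<bar>" for i
  have orbg: "abs ` orb K (\<gamma> i) = \<gamma> ` abs ` orb H i" for i
  proof -
    have "abs ` orb K (\<gamma> i) = abs ` orb K (g i)"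
      using abs_orb_uminus[OF K, of "g i"] by (simp add: \<gamma>_def abs_if)
    also have "\<dots> = \<gamma> ` abs ` orb H i"
      unfolding orbK image_image \<gamma>_def using Wn_abs_abs[OF g] by simp
    finally show ?thesis .
  qed
  have \<gamma>bij: "bij_betw \<gamma> {1..int n} {1..int n}"
    unfolding \<gamma>_def using Wn_in_spts[OF g] abs_spts by (intro Wn_abs_bij_betw[OF g]) auto
  have pos: "C \<subseteq> {1..int n}" if "C \<in> ?X" for C
    using that orb_spts[OF H] by (fastforce simp: spts_def)
  have X: "?X \<subseteq> Pow {1..int n}" using pos by blast
  have injX: "inj_on (image \<gamma>) ?X"
  proof (rule inj_on_subset[OF _ X])
    show "inj_on (image \<gamma>) (Pow {1..int n})"
      using \<gamma>bij by (simp add: bij_betw_def inj_on_image_Pow)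
  qed
  have "?Y = image \<gamma> ` ?X"
  proof
    show "image \<gamma> ` ?X \<subseteq> ?Y"
    proof clarify
      fix i assume i: "i \<in> {1..int n}" "P i"
      then have "\<gamma> i \<in> {1..int n}" "Q (\<gamma> i)" using \<gamma>bij bij_betw_apply P by (fastforce simp: \<gamma>_def)+
      then show "\<exists>j. \<gamma> ` abs ` orb H i = abs ` orb K j \<and> j \<in> {1..int n} \<and> Q j"
        using orbg by metis
    qed
    show "?Y \<subseteq> image \<gamma> ` ?X"
    proof clarify
      fix j assume j: "j \<in> {1..int n}" "Q j"
      then obtain i where i: "i \<in> {1..int n}" "j = \<gamma> i" using bij_betw_imp_surj_on[OF \<gamma>bij] by blast
      then have "P i" using P j by (simp add: \<gamma>_def)
      then show "abs ` orb K j \<in> image \<gamma> ` ?X" using i orbg by blast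
    qed
  qed
  then have Y: "mset_set ?Y = image_mset (image \<gamma>) (mset_set ?X)"
    using injX by (simp add: image_mset_mset_set)
  have "card (\<gamma> ` C) = card C" if "C \<in> ?X" for C
    using pos[OF that] \<gamma>bij by (meson bij_betw_def card_image inj_on_subset)
  moreover have "finite ?X" using X by (rule finite_subset) simp
  ultimately show ?thesis
    unfolding Y multiset.map_comp by (intro image_mset_cong) (simp del: mem_Collect_eq)
qed

lemma conj_sub_same_cls:
  assumes H: "is_subgroup n H" and K: "is_subgroup n K" and "conj_sub n H K"
  shows "image_mset card (mset_set (clsA n K)) = image_mset card (mset_set (clsA n H))"
    "image_mset card (mset_set (clsB n K)) = image_mset card (mset_set (clsB n H))"
    "image_mset card (mset_set (clsD n K)) = image_mset card (mset_set (clsD n H))"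
proof -
  obtain g where g: "g \<in> Wn n" and Kdef: "K = (\<lambda>h. g \<circ> h \<circ> inv g) ` H"
    using assms by (auto simp: conj_sub_def)
  have orbK: "orb K (g i) = g ` orb H i" for i
    using g by (auto simp: orb_def Kdef image_iff)
  have A: "- \<bar>g i\<bar> \<in> orb K \<bar>g i\<bar> \<longleftrightarrow> - i \<in> orb H i" for i
  proof -
    have "- \<bar>g i\<bar> \<in> orb K \<bar>g i\<bar> \<longleftrightarrow> - g i \<in> orb K (g i)"
      using orb_uminus_iff[OF K, of "g i" "- g i"] by (auto simp: abs_if)
    also have "\<dots> \<longleftrightarrow> - i \<in> orb H i"
      unfolding orbK using Wn_eq_iff[OF g] Wn_uminus[OF g, of i, symmetric] by auto
    finally show ?thesis .
  qed
  have B: "sref \<bar>g i\<bar> (- \<bar>g i\<bar>) \<in> K \<longleftrightarrow> sref i (- i) \<in> H" for i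
  proof -
    have "sref \<bar>g i\<bar> (- \<bar>g i\<bar>) = sref (g i) (g (- i))"
      using Wn_uminus[OF g] by (auto simp: abs_if sref_commute)
    also have "\<dots> = g \<circ> sref i (- i) \<circ> inv g" using sref_conj[OF g] by simp
    finally have "sref \<bar>g i\<bar> (- \<bar>g i\<bar>) \<in> K \<longleftrightarrow> g \<circ> sref i (- i) \<circ> inv g \<in> K" by simp
    also have "\<dots> \<longleftrightarrow> sref i (- i) \<in> H"
    proof
      assume "g \<circ> sref i (- i) \<circ> inv g \<in> K"
      then obtain h where h: "h \<in> H" "g \<circ> sref i (- i) \<circ> inv g = g \<circ> h \<circ> inv g" by (auto simp: Kdef)
      have "sref i (- i) x = h x" for x
        using fun_cong[OF h(2), of "g x"] g by (simp add: Wn_eq_iff)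
      then have "sref i (- i) = h" by blast
      then show "sref i (- i) \<in> H" using h by simp
    qed (auto simp: Kdef)
    finally show ?thesis .
  qed
  show "image_mset card (mset_set (clsA n K)) = image_mset card (mset_set (clsA n H))"
    unfolding clsA_def by (rule cls_conj_image[OF H K g orbK]) (simp add: A)
  show "image_mset card (mset_set (clsB n K)) = image_mset card (mset_set (clsB n H))"
    unfolding clsB_def by (rule cls_conj_image[OF H K g orbK]) (simp add: B)
  show "image_mset card (mset_set (clsD n K)) = image_mset card (mset_set (clsD n H))"
    unfolding clsD_def by (rule cls_conj_image[OF H K g orbK]) (simp add: A B)
qed

section \<open>The subgroups attached to triple partitions\<close>

lemma sum_list_take_mono: "k \<le> k' \<Longrightarrow> sum_list (take k L) \<le> sum_list (take k' (L :: nat list))"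
  by (metis le_add1 le_add_diff_inverse sum_list_append take_add)

lemma mem_blk: "i \<in> blk L k \<longleftrightarrow> int (sum_list (take k L)) < i \<and> i \<le> int (sum_list (take (Suc k) L))"
  by (auto simp: blk_def)

lemma blk_append: "k < length L \<Longrightarrow> blk (L @ L') k = blk L k"
  by (simp add: blk_def)

lemma blk_disjoint:
  assumes "i \<in> blk L k" "i \<in> blk L k'"
  shows "k = k'"
proof -
  have *: "False" if "k < k'" "i \<in> blk L k" "i \<in> blk L k'" for k k'
    using sum_list_take_mono[of "Suc k" k' L] that by (simp add: mem_blk)
  show ?thesis using *[of k k'] *[of k' k] assms by force
qed

lemma blk_cover: "(\<Union>k<length L. blk L k) = {1..int (sum_list L)}"
proof (induction L rule: rev_induct)
  case (snoc x L)
  have "(\<Union>k<length (L @ [x]). blk (L @ [x]) k) = (\<Union>k<length L. blk L k) \<union> blk (L @ [x]) (length L)"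
    by (auto simp: blk_append lessThan_Suc)
  also have "\<dots> = {1..int (sum_list (L @ [x]))}"
    unfolding snoc.IH by (auto simp: mem_blk)
  finally show ?case .
qed simp

lemma card_blk: "k < length L \<Longrightarrow> card (blk L k) = L ! k"
  by (simp add: blk_def take_Suc_conv_app_nth)

lemma inj_on_blk: "0 \<notin> set L \<Longrightarrow> inj_on (blk L) {..<length L}"
proof (rule inj_onI)
  fix k k' assume L: "0 \<notin> set L" and k: "k \<in> {..<length L}" "k' \<in> {..<length L}" "blk L k = blk L k'"
  have "card (blk L k) \<noteq> 0" using k L by (metis card_blk lessThan_iff nth_mem)
  then obtain i where "i \<in> blk L k" by fastforce
  then show "k = k'" using blk_disjoint[of i L k k'] k by simp
qed

lemma image_mset_card_blk:
  assumes "0 \<notin> set L" "L = l @ l' @ l''"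
  shows "image_mset card (mset_set (blk L ` {length l..<length l + length l'})) = mset l'"
proof -
  let ?K = "{length l..<length l + length l'}"
  have "inj_on (blk L) ?K"
    by (rule inj_on_subset[OF inj_on_blk[OF assms(1)]]) (use assms(2) in auto)
  then have "image_mset card (mset_set (blk L ` ?K)) = image_mset (\<lambda>k. card (blk L k)) (mset_set ?K)"
    by (simp add: image_mset_mset_set[symmetric] multiset.map_comp o_def)
  also have "\<dots> = image_mset (\<lambda>k. L ! k) (mset_set ?K)"
    by (rule image_mset_cong) (use assms(2) in \<open>simp add: card_blk\<close>)
  also have "\<dots> = mset (map (\<lambda>k. L ! k) [length l..<length l + length l'])"
    by (simp add: mset_set_upto_eq_mset_upto)
  also have "map (\<lambda>k. L ! k) [length l..<length l + length l'] = l'"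
    by (rule nth_equalityI) (auto simp: assms(2) nth_append)
  finally show ?thesis .
qed

text \<open>If \<open>w\<close> carried a point \<open>i\<close> of the block outside, the
  restriction would send both \<open>i\<close> and \<open>w i\<close> to \<open>w i\<close> and fail
  to be injective. Thus the factorwise conditions in \<open>Wlam\<close> already contain the
  invariance of every block.\<close>

lemma restr_Wn_iff:
  assumes w: "w \<in> Wn n" and I: "I \<subseteq> {1..int n}"
  shows "restr w I \<in> Wn n \<longleftrightarrow> (\<forall>i\<in>I. \<bar>w i\<bar> \<in> I)"
proof
  assume r: "restr w I \<in> Wn n"
  show "\<forall>i\<in>I. \<bar>w i\<bar> \<in> I"
  proof (intro ballI, rule ccontr)
    fix i assume i: "i \<in> I" "\<bar>w i\<bar> \<notin> I"
    then have "\<bar>i\<bar> = i" using I by auto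
    then have "restr w I i = restr w I (w i)" using i by (simp add: restr_def)
    then have "i = w i" using Wn_eq_iff[OF r] by blast
    then show False using i \<open>\<bar>i\<bar> = i\<close> by simp
  qed
next
  assume I': "\<forall>i\<in>I. \<bar>w i\<bar> \<in> I"
  have abs: "\<bar>w i\<bar> \<in> I" if "\<bar>i\<bar> \<in> I" for i
    using I' that Wn_abs_abs[OF w, of i] by metis
  have odd: "restr w I (- i) = - restr w I i" for i
    using Wn_uminus[OF w] by (simp add: restr_def)
  have spt: "restr w I i \<in> spts n" if "i \<in> spts n" for i
    using that Wn_in_spts[OF w] by (simp add: restr_def)
  have out: "restr w I i = i" if "i \<notin> spts n" for i
    using that I abs_spts by (auto simp: restr_def)
  have "inj_on (restr w I) (spts n)"
  proof (rule inj_onI)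
    fix i j assume "restr w I i = restr w I j"
    then show "i = j" using abs Wn_eq_iff[OF w] by (auto simp: restr_def split: if_splits)
  qed
  moreover have "restr w I ` spts n = spts n"
    using calculation spt by (intro endo_inj_surj) auto
  ultimately have "bij_betw (restr w I) (spts n) (spts n)" by (simp add: bij_betw_def)
  then show "restr w I \<in> Wn n" unfolding Wn_def using odd out by blast
qed

lemma restr_BI_iff:
  assumes w: "w \<in> Wn n" and I: "I \<subseteq> {1..int n}"
  shows "restr w I \<in> BI n I \<longleftrightarrow> (\<forall>i\<in>I. \<bar>w i\<bar> \<in> I)"
  using restr_Wn_iff[OF assms] by (auto simp: BI_def restr_def)

lemma restr_eq: "I \<subseteq> {1..int n} \<Longrightarrow> i \<in> I \<Longrightarrow> restr w I i = w i"
  by (auto simp: restr_def)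

lemma restr_SymI_iff:
  assumes w: "w \<in> Wn n" and I: "I \<subseteq> {1..int n}"
  shows "restr w I \<in> SymI n I \<longleftrightarrow> (\<forall>i\<in>I. \<bar>w i\<bar> \<in> I) \<and> (\<forall>i\<in>I. w i > 0)"
proof -
  have "restr w I \<in> SymI n I \<longleftrightarrow> restr w I \<in> Wn n \<and> (\<forall>i\<in>I. restr w I i \<in> I)"
    by (auto simp: SymI_def restr_def)
  also have "\<dots> \<longleftrightarrow> (\<forall>i\<in>I. \<bar>w i\<bar> \<in> I) \<and> (\<forall>i\<in>I. w i \<in> I)"
    using restr_Wn_iff[OF assms] restr_eq[OF I] by auto
  also have "\<dots> \<longleftrightarrow> (\<forall>i\<in>I. \<bar>w i\<bar> \<in> I) \<and> (\<forall>i\<in>I. w i > 0)"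
  proof -
    have "w i \<in> I \<longleftrightarrow> w i > 0" if "\<bar>w i\<bar> \<in> I" for i
      using that I by (cases "w i > 0") fastforce+
    then show ?thesis by blast
  qed
  finally show ?thesis .
qed

lemma restr_DI_iff:
  assumes w: "w \<in> Wn n" and I: "I \<subseteq> {1..int n}"
  shows "restr w I \<in> DI n I \<longleftrightarrow> (\<forall>i\<in>I. \<bar>w i\<bar> \<in> I) \<and> even (card {i\<in>I. w i < 0})"
proof -
  have "{i\<in>I. restr w I i < 0} = {i\<in>I. w i < 0}" using restr_eq[OF I] by auto
  then show ?thesis using restr_BI_iff[OF assms] by (simp add: DI_def)
qed

lemma blk_range: "k < length L \<Longrightarrow> blk L k \<subseteq> {1..int (sum_list L)}"
  using blk_cover[of L] by blast

definition blocksA :: "nat list \<Rightarrow> nat list \<Rightarrow> nat list \<Rightarrow> int set set" where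
  "blocksA l1 l2 l3 = blk (l1 @ l2 @ l3) ` {0..<length l1}"

definition blocksB :: "nat list \<Rightarrow> nat list \<Rightarrow> nat list \<Rightarrow> int set set" where
  "blocksB l1 l2 l3 = blk (l1 @ l2 @ l3) ` {length l1..<length l1 + length l2}"

definition blocksD :: "nat list \<Rightarrow> nat list \<Rightarrow> nat list \<Rightarrow> int set set" where
  "blocksD l1 l2 l3 = blk (l1 @ l2 @ l3) ` {length (l1 @ l2)..<length (l1 @ l2) + length l3}"

lemma Wlam_eq_Wstr:
  assumes "sum_list l1 + sum_list l2 + sum_list l3 = n"
  shows "Wlam n l1 l2 l3 = Wstr n (blocksA l1 l2 l3) (blocksB l1 l2 l3) (blocksD l1 l2 l3)"
proof -
  define L where "L = l1 @ l2 @ l3"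
  have sub: "blk L k \<subseteq> {1..int n}" if "k < length L" for k
  proof -
    have "sum_list L = n" using assms by (simp add: L_def)
    then show ?thesis using blk_range[OF that] by simp
  qed
  have img: "(\<forall>k<b. P (blk L (a + k))) \<longleftrightarrow> (\<forall>C\<in>blk L ` {a..<a + b}. P C)" for P a b
  proof
    assume *: "\<forall>k<b. P (blk L (a + k))"
    show "\<forall>C\<in>blk L ` {a..<a + b}. P C"
    proof clarify
      fix k assume "k \<in> {a..<a + b}"
      then have "k - a < b" "k = a + (k - a)" by auto
      then show "P (blk L k)" using * by metis
    qed
  qed auto
  have len: "length L = length l1 + length l2 + length l3" by (simp add: L_def)
  have A: "(\<forall>k<length l1. restr w (blk L k) \<in> SymI n (blk L k)) \<longleftrightarrow>
      (\<forall>C\<in>blocksA l1 l2 l3. (\<forall>i\<in>C. \<bar>w i\<bar> \<in> C) \<and> (\<forall>i\<in>C. w i > 0))" if w: "w \<in> Wn n" for w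
    using img[of "length l1" "\<lambda>C. (\<forall>i\<in>C. \<bar>w i\<bar> \<in> C) \<and> (\<forall>i\<in>C. w i > 0)" 0] restr_SymI_iff[OF w sub] len
    by (simp add: blocksA_def L_def)
  have B: "(\<forall>k<length l2. restr w (blk L (length l1 + k)) \<in> BI n (blk L (length l1 + k))) \<longleftrightarrow>
      (\<forall>C\<in>blocksB l1 l2 l3. \<forall>i\<in>C. \<bar>w i\<bar> \<in> C)" if w: "w \<in> Wn n" for w
    using img[of "length l2" "\<lambda>C. \<forall>i\<in>C. \<bar>w i\<bar> \<in> C" "length l1"] restr_BI_iff[OF w sub] len
    by (simp add: blocksB_def L_def)
  have D: "(\<forall>k<length l3. restr w (blk L (length l1 + length l2 + k)) \<in> DI n (blk L (length l1 + length l2 + k))) \<longleftrightarrow>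
      (\<forall>C\<in>blocksD l1 l2 l3. (\<forall>i\<in>C. \<bar>w i\<bar> \<in> C) \<and> even (card {i\<in>C. w i < 0}))" if w: "w \<in> Wn n" for w
    using img[of "length l3" "\<lambda>C. (\<forall>i\<in>C. \<bar>w i\<bar> \<in> C) \<and> even (card {i\<in>C. w i < 0})" "length l1 + length l2"] 
      restr_DI_iff[OF w sub] len
    by (simp add: blocksD_def L_def)
  have "w \<in> Wlam n l1 l2 l3 \<longleftrightarrow> w \<in> Wstr n (blocksA l1 l2 l3) (blocksB l1 l2 l3) (blocksD l1 l2 l3)" for w
  proof (cases "w \<in> Wn n")
    case True
    then show ?thesis
      unfolding Wlam_def Let_def L_def[symmetric] Wstr_def mem_Collect_eq A[OF True] B[OF True] D[OF True]
        ball_Un ball_conj_distrib by argo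
  qed (simp add: Wlam_def Wstr_def Let_def)
  then show ?thesis by blast
qed

lemma triple_part_blocks:
  assumes "triple_part n l1 l2 l3" "\<forall>x\<in>set l3. x > 1"
  shows "blocks n (blocksA l1 l2 l3) (blocksB l1 l2 l3) (blocksD l1 l2 l3)"
proof
  define L where "L = l1 @ l2 @ l3"
  have L0: "0 \<notin> set L" and sum: "sum_list L = n" 
    using assms(1) by (auto simp: triple_part_def is_part_def L_def)
  have len: "length L = length l1 + length l2 + length l3" by (simp add: L_def)
  have un: "blocksA l1 l2 l3 \<union> blocksB l1 l2 l3 \<union> blocksD l1 l2 l3 = blk L ` {..<length L}"
    unfolding blocksA_def blocksB_def blocksD_def L_def[symmetric] image_Un[symmetric]
    by (rule arg_cong[of _ _ "image _"]) (auto simp: len)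
  show "\<Union> (blocksA l1 l2 l3 \<union> blocksB l1 l2 l3 \<union> blocksD l1 l2 l3) = {1..int n}"
    unfolding un using blk_cover[of L] sum by simp
  show "C = C'" if "C \<in> blocksA l1 l2 l3 \<union> blocksB l1 l2 l3 \<union> blocksD l1 l2 l3"
    "C' \<in> blocksA l1 l2 l3 \<union> blocksB l1 l2 l3 \<union> blocksD l1 l2 l3" "i \<in> C" "i \<in> C'" for C C' i
    using that blk_disjoint[of i L] unfolding un by blast
  show "{} \<notin> blocksA l1 l2 l3 \<union> blocksB l1 l2 l3 \<union> blocksD l1 l2 l3"
  proof
    assume "{} \<in> blocksA l1 l2 l3 \<union> blocksB l1 l2 l3 \<union> blocksD l1 l2 l3"
    then obtain k where k: "k \<in> {..<length L}" "{} = blk L k" unfolding un by blast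
    then have "L ! k = 0" using card_blk[of k L] by simp
    then show False using k L0 by (metis lessThan_iff nth_mem)
  qed
  have inj: "k = k'" if "blk L k = blk L k'" "k < length L" "k' < length L" for k k'
    using inj_on_blk[OF L0] that by (simp add: inj_on_def)
  have disjI: "blk L ` {a..<b} \<inter> blk L ` {c..<d} = {}" if "b \<le> c" "d \<le> length L" for a b c d
  proof (rule ccontr)
    assume "blk L ` {a..<b} \<inter> blk L ` {c..<d} \<noteq> {}"
    then obtain k k' where "blk L k = blk L k'" "k < b" "c \<le> k'" "k' < d" by auto
    then show False using inj[of k k'] \<open>b \<le> c\<close> \<open>d \<le> length L\<close> by linarith
  qed
  show "blocksA l1 l2 l3 \<inter> blocksB l1 l2 l3 = {}"
    unfolding blocksA_def blocksB_def L_def[symmetric] by (rule disjI) (auto simp: len)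
  show "blocksA l1 l2 l3 \<inter> blocksD l1 l2 l3 = {}"
    unfolding blocksA_def blocksD_def L_def[symmetric] by (rule disjI) (auto simp: len)
  show "blocksB l1 l2 l3 \<inter> blocksD l1 l2 l3 = {}"
    unfolding blocksB_def blocksD_def L_def[symmetric] by (rule disjI) (auto simp: len)
  show "card C > 1" if C: "C \<in> blocksD l1 l2 l3" for C
  proof -
    obtain k where k: "C = blk L k" "length (l1 @ l2) \<le> k" "k < length L"
      using C unfolding blocksD_def L_def[symmetric] by (auto simp: len)
    have "L ! k = l3 ! (k - length (l1 @ l2))" using k(2) unfolding L_def append_assoc[symmetric] nth_append by simp
    then have "L ! k \<in> set l3" using k len by simp
    then show ?thesis using k card_blk[of k L] assms(2) by simp
  qed
qed

lemma Wlam_blocks: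
  assumes "triple_part n l1 l2 l3" "\<forall>x\<in>set l3. x > 1"
  shows "refl_subgroup n (Wlam n l1 l2 l3)"
    "image_mset card (mset_set (clsA n (Wlam n l1 l2 l3))) = mset l1"
    "image_mset card (mset_set (clsB n (Wlam n l1 l2 l3))) = mset l2"
    "image_mset card (mset_set (clsD n (Wlam n l1 l2 l3))) = mset l3"
proof -
  interpret blocks n "blocksA l1 l2 l3" "blocksB l1 l2 l3" "blocksD l1 l2 l3"
    using assms by (rule triple_part_blocks)
  have L0: "0 \<notin> set (l1 @ l2 @ l3)" and sum: "sum_list l1 + sum_list l2 + sum_list l3 = n"
    using assms(1) by (auto simp: triple_part_def is_part_def)
  note W = Wlam_eq_Wstr[OF sum]
  show "refl_subgroup n (Wlam n l1 l2 l3)" unfolding W by (rule W_refl_subgroup)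
  show "image_mset card (mset_set (clsA n (Wlam n l1 l2 l3))) = mset l1"
    unfolding W cls_W using image_mset_card_blk[OF L0, of "[]" l1 "l2 @ l3"] by (simp add: blocksA_def)
  show "image_mset card (mset_set (clsB n (Wlam n l1 l2 l3))) = mset l2"
    unfolding W cls_W using image_mset_card_blk[OF L0, of l1 l2 l3] by (simp add: blocksB_def)
  show "image_mset card (mset_set (clsD n (Wlam n l1 l2 l3))) = mset l3"
    unfolding W cls_W using image_mset_card_blk[OF L0, of "l1 @ l2" l3 "[]"] by (simp add: blocksD_def)
qed

lemma is_part_mset_eq:
  assumes "is_part l" "is_part m" "mset l = mset m"
  shows "l = m"
proof -
  have "sorted (rev l)" "sorted (rev m)" using assms by (auto simp: is_part_def sorted_wrt_rev)
  then have "rev l = rev m" using assms(3) by (metis mset_rev properties_for_sort)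
  then show ?thesis by simp
qed

text \<open>Conjugate groups have the same block sizes of each kind, and a weakly decreasing list is
  determined by its multiset.\<close>

lemma Wlam_conj_imp_eq:
  assumes "triple_part n l1 l2 l3" "\<forall>x\<in>set l3. x > 1" "triple_part n m1 m2 m3" "\<forall>x\<in>set m3. x > 1"
    and "conj_sub n (Wlam n l1 l2 l3) (Wlam n m1 m2 m3)"
  shows "Wlam n l1 l2 l3 = Wlam n m1 m2 m3"
proof -
  note l = Wlam_blocks[OF assms(1,2)] and m = Wlam_blocks[OF assms(3,4)]
  note c = conj_sub_same_cls[OF refl_subgroup_gen(1)[OF l(1)] refl_subgroup_gen(1)[OF m(1)] assms(5)]
  have "l1 = m1" "l2 = m2" "l3 = m3"
    using assms(1,3) c l m unfolding triple_part_def by (auto intro: is_part_mset_eq)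
  then show ?thesis by simp
qed

lemma mset_part:
  assumes "0 \<notin># M"
  shows "is_part (rev (sorted_list_of_multiset M))" "mset (rev (sorted_list_of_multiset M)) = M"
  using assms by (auto simp: is_part_def sorted_wrt_rev)

text \<open>The partitions are the sorted sizes of the three kinds of classes; the comparison of
  class sizes then supplies the conjugation.\<close>

lemma refl_subgroup_conj_Wlam:
  assumes R: "refl_subgroup n R"
  shows "\<exists>l1 l2 l3. triple_part n l1 l2 l3 \<and> (\<forall>x\<in>set l3. x > 1) \<and> conj_sub n (Wlam n l1 l2 l3) R"
proof -
  interpret blocks n "clsA n R" "clsB n R" "clsD n R" using R by (rule blocks_cls)
  define mc :: "int set set \<Rightarrow> nat multiset" where "mc X = image_mset card (mset_set X)" for X
  define li where "li X = rev (sorted_list_of_multiset (mc X))" for X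
  have fin: "finite (clsA n R)" "finite (clsB n R)" "finite (clsD n R)"
    using finite_blocks by auto
  have pos: "card C \<noteq> 0" if "C \<in> clsA n R \<union> clsB n R \<union> clsD n R" for C
    using block_finite[OF that] nonempty that by auto
  have mc0: "0 \<notin># mc (clsA n R)" "0 \<notin># mc (clsB n R)" "0 \<notin># mc (clsD n R)"
  proof -
    have *: "0 \<notin># mc X" if "finite X" "\<And>C. C \<in> X \<Longrightarrow> card C \<noteq> 0" for X
    proof
      assume "0 \<in># mc X"
      then obtain C where "C \<in> X" "card C = 0" using \<open>finite X\<close> unfolding mc_def by fastforce
      then show False using that(2) by blast
    qed
    show "0 \<notin># mc (clsA n R)" "0 \<notin># mc (clsB n R)" "0 \<notin># mc (clsD n R)"
      by (rule *, rule fin, rule pos, blast)+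
  qed
  note li = mset_part[OF mc0(1), folded li_def] mset_part[OF mc0(2), folded li_def] mset_part[OF mc0(3), folded li_def]
  have sum: "sum_list (li X) = sum card X" for X
  proof -
    have "sum_list (li X) = sum_mset (mc X)"
      by (metis li_def mset_rev mset_sorted_list_of_multiset sum_mset_sum_list)
    then show ?thesis by (simp add: mc_def sum_unfold_sum_mset)
  qed
  have "sum card (clsA n R) + sum card (clsB n R) + sum card (clsD n R) = sum card (clsA n R \<union> clsB n R \<union> clsD n R)"
    using fin types by (subst sum.union_disjoint; (subst sum.union_disjoint)?) auto
  also have "\<dots> = card (\<Union> (clsA n R \<union> clsB n R \<union> clsD n R))"
    using disj block_finite by (intro card_Union_disjoint[symmetric]) (auto simp: pairwise_def disjnt_def)
  also have "\<dots> = n" unfolding cover by simp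
  finally have tp: "triple_part n (li (clsA n R)) (li (clsB n R)) (li (clsD n R))"
    using li by (simp add: triple_part_def sum)
  have "set (li (clsD n R)) = card ` clsD n R" using li(6) fin(3)
    by (metis finite_set_mset_mset_set mc_def set_image_mset set_mset_mset)
  then have gt: "\<forall>x\<in>set (li (clsD n R)). x > 1" using D_card by auto
  note W = Wlam_blocks[OF tp gt]
  have "conj_sub n (Wlam n (li (clsA n R)) (li (clsB n R)) (li (clsD n R))) R"
    by (rule conj_sub_if_same_cls[OF W(1) R]) (simp_all add: W(2-4) li mc_def)
  then show ?thesis using tp gt by blast
qed

section \<open>Parabolic closures\<close>

context blocks
begin

text \<open>A vector fixed by \<open>W\<close> is constant on each block of \<open>A\<close> and
  zero on all other lines, because there some element maps \<open>j\<close> to \<open>- j\<close>.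
  The indicator vectors of the blocks of \<open>A\<close> are therefore the only constraints on the
  stabilizer.\<close>

lemma pclos_W: "pclos n W = {w \<in> Wn n. \<forall>C\<in>A. \<forall>i\<in>C. w i \<in> C}"
proof (intro equalityI subsetI)
  fix w assume w: "w \<in> pclos n W"
  then have wW: "w \<in> Wn n" and fixd: "\<And>x. x \<in> fixspace n W \<Longrightarrow> fixes_vec n w x"
    by (auto simp: pclos_def)
  have "w i \<in> C" if C: "C \<in> A" and i: "i \<in> C" for C i
  proof -
    have CU: "C \<in> A \<union> B \<union> D" using C by blast
    define x where "x j = (if int j \<in> C then 1 else 0 :: real)" for j
    have ext: "extv x j = (if j \<in> C then 1 else if - j \<in> C then - 1 else 0)" for j
      using block_pos[OF CU, of j] block_pos[OF CU, of "- j"] by (auto simp: extv_def x_def)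
    have "x \<in> fixspace n W"
      unfolding fixspace_def
    proof (intro CollectI conjI allI impI ballI)
      show "x j = 0" if "j \<notin> {1..n}" for j
        using that block_subset[OF CU] by (auto simp: x_def)
      show "fixes_vec n v x" if v: "v \<in> W" for v
        unfolding fixes_vec_def
      proof
        fix j assume j: "j \<in> {1..n}"
        show "extv x (v (int j)) = x j"
        proof (cases "int j \<in> C")
          case True
          then have "\<bar>v (int j)\<bar> \<in> C" "v (int j) > 0"
            using W_block[OF v CU, of "int j"] W_sgn[OF v C, of "int j"] j by auto
          then show ?thesis using True by (simp add: ext x_def)
        next
          case False
          then have *: "\<bar>v (int j)\<bar> \<notin> C" using W_block[OF v CU, of "int j"] by simp
          then have "v (int j) \<notin> C" "- v (int j) \<notin> C"
            using block_abs[OF CU] by (metis, metis abs_minus_cancel)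
          then show ?thesis using False by (simp add: ext x_def)
        qed
      qed
    qed
    from fixd[OF this] have "\<forall>j\<in>{1..n}. extv x (w (int j)) = x j" by (simp add: fixes_vec_def)
    moreover have "nat i \<in> {1..n}" "int (nat i) = i" using subsetD[OF block_subset[OF CU] i] by auto
    ultimately have "extv x (w i) = 1" using i by (metis x_def)
    then show ?thesis unfolding ext by (metis one_neq_neg_one zero_neq_one)
  qed
  then show "w \<in> {w \<in> Wn n. \<forall>C\<in>A. \<forall>i\<in>C. w i \<in> C}" using wW by blast
next
  fix w assume "w \<in> {w \<in> Wn n. \<forall>C\<in>A. \<forall>i\<in>C. w i \<in> C}"
  then have wW: "w \<in> Wn n" and wC: "\<And>C i. C \<in> A \<Longrightarrow> i \<in> C \<Longrightarrow> w i \<in> C" by auto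
  have "fixes_vec n w x" if x: "x \<in> fixspace n W" for x
    unfolding fixes_vec_def
  proof
    fix i assume i: "i \<in> {1..n}"
    have fixd: "extv x (v (int j)) = x j" if "v \<in> W" "j \<in> {1..n}" for v j
      using x that by (auto simp: fixspace_def fixes_vec_def)
    have zero: "extv x j = 0" if "j \<in> spts n" "C \<in> A \<union> B \<union> D" "\<bar>j\<bar> \<in> C" "C \<notin> A" for j C
    proof -
      have "- \<bar>j\<bar> \<in> orb W \<bar>j\<bar>" using uminus_in_orb_W[of C "\<bar>j\<bar>"] that by simp
      then obtain v where v: "v \<in> W" "v \<bar>j\<bar> = - \<bar>j\<bar>" unfolding orb_def by (metis imageE)
      define k where "k = nat \<bar>j\<bar>"
      have k: "k \<in> {1..n}" "int k = \<bar>j\<bar>" using that(1) by (auto simp: k_def spts_def)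
      have "extv x (- int k) = x k" using fixd[OF v(1) k(1)] v(2) k(2) by simp
      moreover have "extv x (- int k) = - x k" using k(1) by (simp add: extv_def)
      ultimately have "x k = 0" by simp
      moreover have "j > 0 \<Longrightarrow> nat j = k" "j < 0 \<Longrightarrow> nat (- j) = k" by (auto simp: k_def)
      ultimately show ?thesis unfolding extv_def by simp
    qed
    obtain C where C: "C \<in> A \<union> B \<union> D" "int i \<in> C" 
      using block_of[of "int i"] i by (auto simp: spts_def)
    show "extv x (w (int i)) = x i"
    proof (cases "C \<in> A")
      case True
      then have wi: "w (int i) \<in> C" using wC C by blast
      have "sref (int i) (w (int i)) \<in> W"
        using wi C block_pos[OF C(1) wi] block_pos[OF C] True types
        by (intro sref_in_W[of C]) auto
      then show ?thesis using fixd[OF _ i] by fastforce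
    next
      case False
      have isp: "int i \<in> spts n" using i by (auto simp: spts_def)
      have x0: "x i = 0" using zero[OF isp C(1) _ False] C i by (simp add: extv_def)
      have wi: "w (int i) \<in> spts n" using isp Wn_in_spts[OF wW] by simp
      \<comment> \<open>The coordinate of \<open>x\<close> at the image of \<open>i\<close> must
        vanish too: \<open>w\<close> permutes the lines of each block of \<open>A\<close>, so it
        cannot bring the line \<open>i\<close> into one.\<close>
      obtain C' where C': "C' \<in> A \<union> B \<union> D" "\<bar>w (int i)\<bar> \<in> C'" using block_of[OF wi] by blast
      have "C' \<notin> A"
      proof
        assume A: "C' \<in> A"
        have "bij_betw (\<lambda>i. \<bar>w i\<bar>) C' C'"
          using wC[OF A] block_abs[OF C'(1)] block_pos[OF C'(1)] block_finite[OF C'(1)]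
          by (intro Wn_abs_bij_betw[OF wW]) auto
        then obtain j where j: "j \<in> C'" "\<bar>w j\<bar> = \<bar>w (int i)\<bar>"
          using C'(2) by (metis bij_betw_imp_surj_on imageE)
        then have "\<bar>j\<bar> = \<bar>int i\<bar>" using Wn_abs_eq_iff[OF wW, of j "int i"] by blast
        then have "j = int i" using block_abs[OF C'(1) j(1)] by simp
        then show False using j disj[OF C(1) C'(1) C(2)] A False by simp
      qed
      then show ?thesis using zero[OF wi C'] x0 by simp
    qed
  qed
  then show "w \<in> pclos n W" using wW by (simp add: pclos_def)
qed

end

text \<open>Preserving every block of \<open>A\<close> forces the remaining lines to be preserved as
  a whole, so all other blocks fuse into one block of type B. As the blocks of \<open>l1\<close>
  come first in both groups, the closure is equal to the standard subgroup and not merely conjugate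
  to it.\<close>

lemma pclos_Wlam:
  assumes "triple_part n l1 l2 l3" "\<forall>x\<in>set l3. x > 1"
  shows "pclos n (Wlam n l1 l2 l3) = Wlam n l1 (if sum_list l1 = n then [] else [n - sum_list l1]) []"
proof -
  define l where "l = (if sum_list l1 = n then [] else [n - sum_list l1])"
  interpret X: blocks n "blocksA l1 l2 l3" "blocksB l1 l2 l3" "blocksD l1 l2 l3"
    using assms by (rule triple_part_blocks)
  have sum: "sum_list l1 + sum_list l2 + sum_list l3 = n" using assms by (simp add: triple_part_def)
  have tp: "triple_part n l1 l []"
    using assms(1) by (auto simp: triple_part_def l_def is_part_def)
  have sum': "sum_list l1 + sum_list l + sum_list [] = n" using tp by (simp add: triple_part_def)
  interpret Y: blocks n "blocksA l1 l []" "blocksB l1 l []" "blocksD l1 l []"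
    using tp by (rule triple_part_blocks) simp
  have A: "blocksA l1 l [] = blocksA l1 l2 l3"
    unfolding blocksA_def by (rule image_cong) (simp_all add: blk_append)
  have D: "blocksD l1 l [] = {}" by (simp add: blocksD_def)
  have B: "blocksB l1 l [] = {} \<or> (\<exists>C. blocksB l1 l [] = {C})"
    by (simp add: blocksB_def l_def)
  have "Wstr n (blocksA l1 l []) (blocksB l1 l []) (blocksD l1 l []) = {w \<in> Wn n. \<forall>C\<in>blocksA l1 l []. \<forall>i\<in>C. w i \<in> C}"
  proof (intro equalityI subsetI)
    fix w assume "w \<in> Wstr n (blocksA l1 l []) (blocksB l1 l []) (blocksD l1 l [])"
    then have w: "w \<in> Wn n" "\<And>C i. C \<in> blocksA l1 l [] \<Longrightarrow> i \<in> C \<Longrightarrow> \<bar>w i\<bar> \<in> C \<and> w i > 0"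
      unfolding Wstr_def by blast+
    have "w i \<in> C" if "C \<in> blocksA l1 l []" "i \<in> C" for C i
      using w(2)[OF that] by (metis abs_of_pos)
    then show "w \<in> {w \<in> Wn n. \<forall>C\<in>blocksA l1 l []. \<forall>i\<in>C. w i \<in> C}" using w(1) by blast
  next
    fix w assume "w \<in> {w \<in> Wn n. \<forall>C\<in>blocksA l1 l []. \<forall>i\<in>C. w i \<in> C}"
    then have wW: "w \<in> Wn n" and wC: "\<And>C i. C \<in> blocksA l1 l [] \<Longrightarrow> i \<in> C \<Longrightarrow> w i \<in> C" by auto
    have wA: "w i > 0" "\<bar>w i\<bar> \<in> C" if "C \<in> blocksA l1 l []" "i \<in> C" for C i
      using wC[OF that] Y.block_pos[of C "w i"] that(1) by auto
    have wB: "\<bar>w i\<bar> \<in> C" if C: "C \<in> blocksB l1 l []" "i \<in> C" for C i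
    proof -
      have isp: "i \<in> spts n" using C Y.block_spts[of C i] Y.block_abs[of C i] by auto
      then have "w i \<in> spts n" using Wn_in_spts[OF wW] by simp
      then obtain C' where C': "C' \<in> blocksA l1 l [] \<union> blocksB l1 l [] \<union> blocksD l1 l []" "\<bar>w i\<bar> \<in> C'" 
        using Y.block_of by blast
      have "C' \<notin> blocksA l1 l []"
      proof
        assume A: "C' \<in> blocksA l1 l []"
        have "bij_betw (\<lambda>i. \<bar>w i\<bar>) C' C'"
          using wA[OF A] Y.block_pos[OF C'(1)] Y.block_finite[OF C'(1)]
          by (intro Wn_abs_bij_betw[OF wW]) auto
        then obtain j where j: "j \<in> C'" "\<bar>w j\<bar> = \<bar>w i\<bar>"
          using C'(2) by (metis bij_betw_imp_surj_on imageE)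
        then have "\<bar>j\<bar> = \<bar>i\<bar>" using Wn_abs_eq_iff[OF wW, of j i] by blast
        then have "j = i" using Y.block_abs[OF C'(1) j(1)] Y.block_abs[of C i] C by simp
        then show False using j Y.disj[of C C' i] C C' A Y.types by blast
      qed
      then have "C' \<in> blocksB l1 l []" using C' D by blast
      then show ?thesis using B C C'(2) by auto
    qed
    show "w \<in> Wstr n (blocksA l1 l []) (blocksB l1 l []) (blocksD l1 l [])"
      unfolding Wstr_def D using wW wA wB by blast
  qed
  then show ?thesis
    unfolding l_def[symmetric] Wlam_eq_Wstr[OF sum] Wlam_eq_Wstr[OF sum'] X.pclos_W by (simp add: A)
qed

lemma conj_sub_refl: "H \<subseteq> Wn n \<Longrightarrow> conj_sub n H H"
  unfolding conj_sub_def by (intro bexI[of _ id]) (auto simp: inv_id)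

section \<open>Coxeter generators and affine reflections\<close>

definition hom_eval :: "('a \<Rightarrow> 'b \<Rightarrow> 'b) \<Rightarrow> 'a list \<Rightarrow> 'b \<Rightarrow> 'b" where
  "hom_eval \<phi> ws = foldr (\<lambda>s f. \<phi> s \<circ> f) ws id"

lemma hom_eval_simps [simp]:
  "hom_eval \<phi> [] = id" "hom_eval \<phi> (s # ws) = \<phi> s \<circ> hom_eval \<phi> ws"
  by (simp_all add: hom_eval_def)

lemma hom_eval_append [simp]: "hom_eval \<phi> (u @ v) = hom_eval \<phi> u \<circ> hom_eval \<phi> v"
  by (induction u) (auto simp: fun_eq_iff)

lemma hom_eval_concat_replicate: "hom_eval \<phi> (concat (replicate m ws)) = hom_eval \<phi> ws ^^ m"
  by (induction m) auto

lemma evalw_concat_replicate: "evalw (concat (replicate m ws)) = evalw ws ^^ m"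
  by (induction m) auto

text \<open>The universal property of the presentation: any assignment \<open>\<phi>\<close> of maps
  satisfying the relations between two generators is constant on equivalence classes of
  words.\<close>

lemma coxeq_hom:
  assumes "coxeq S u v" 
    and sq: "\<And>s. s \<in> S \<Longrightarrow> \<phi> s \<circ> \<phi> s = id"
    and braid: "\<And>s t. s \<in> S \<Longrightarrow> t \<in> S \<Longrightarrow> (\<phi> s \<circ> \<phi> t) ^^ elt_order (s \<circ> t) = id"
  shows "hom_eval \<phi> u = hom_eval \<phi> v"
  using assms(1)
proof induction
  case (sq s u v)
  have "hom_eval \<phi> [s, s] = id" using assms(2)[OF sq] by simp
  then show ?case by (simp only: hom_eval_append) simp
next
  case (braid s t u v)
  have "hom_eval \<phi> (concat (replicate (elt_order (s \<circ> t)) [s, t])) = id"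
    using assms(3)[OF braid] by (simp add: hom_eval_concat_replicate)
  then show ?case by (simp only: hom_eval_append) simp
qed auto

text \<open>A translation by \<open>k\<close> iterated \<open>N\<close> times translates by
  \<open>N\<close> times \<open>k\<close>, which a word of finite order cannot do unless
  \<open>k\<close> is zero.\<close>

lemma no_level_change:
  fixes \<phi> :: "'a \<Rightarrow> int \<times> int \<Rightarrow> int \<times> int"
  assumes "hom_eval \<phi> ws ^^ N = id" "N > 0" 
    and "\<And>z. hom_eval \<phi> ws (p, z) = (p, z + k)"
  shows "k = 0"
proof -
  have "((hom_eval \<phi> ws) ^^ N) (p, 0) = (p, int N * k)"
    by (induction N) (auto simp: assms(3) algebra_simps)
  then show ?thesis using assms(1,2) by simp
qed

locale coxeter_generators =
  fixes n :: nat and R S :: "(int \<Rightarrow> int) set"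
  assumes coxeter_gen: "coxeter_gen n R S"
begin

lemma S_refls: "S \<subseteq> refls n"
  and gen_S: "gen n S = R"
  and relations: "set ws \<subseteq> S \<Longrightarrow> evalw ws = id \<Longrightarrow> coxeq S ws []"
  using coxeter_gen by (auto simp: coxeter_gen_def coxeter_system_def)

lemma S_Wn: "s \<in> S \<Longrightarrow> s \<in> Wn n"
  using S_refls refls_Wn by blast

lemma evalw_S_Wn: "set ws \<subseteq> S \<Longrightarrow> evalw ws \<in> Wn n"
  using S_Wn by (intro evalw_in_subgroup[OF is_subgroup_Wn]) auto

text \<open>This is where the presentation is exploited. Some power of the word is trivial in the
  finite group; by completeness of the relations that power is equivalent to the empty word, so it
  is trivial in every action satisfying the pairwise relations.\<close>

lemma hom_eval_finite_order:
  assumes "\<And>s. s \<in> S \<Longrightarrow> \<phi> s \<circ> \<phi> s = id"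
    and "\<And>s t. s \<in> S \<Longrightarrow> t \<in> S \<Longrightarrow> (\<phi> s \<circ> \<phi> t) ^^ elt_order (s \<circ> t) = id"
    and ws: "set ws \<subseteq> S"
  shows "\<exists>N>0. hom_eval \<phi> ws ^^ N = id"
proof -
  obtain N where N: "N > 0" "evalw ws ^^ N = id" using Wn_finite_order[OF evalw_S_Wn[OF ws]] by blast
  have "coxeq S (concat (replicate N ws)) []"
    by (rule relations) (use ws N in \<open>auto simp: evalw_concat_replicate\<close>)
  from coxeq_hom[OF this assms(1,2)] show ?thesis
    using N by (auto simp: hom_eval_concat_replicate)
qed

end

lemma funpow_conj:
  assumes "h \<circ> g = id"
  shows "(g \<circ> f \<circ> h) ^^ m = (if m = 0 then id else g \<circ> f ^^ m \<circ> h)"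
proof (induction m)
  case (Suc m)
  have "h (g x) = x" for x using assms by (simp add: fun_eq_iff)
  then show ?case using Suc by (auto simp: fun_eq_iff)
qed simp

lemma refls_fixes_iff:
  assumes "t \<in> refls n" "t = sref k l" "k \<in> spts n" "l \<in> spts n" "k \<noteq> l" "x \<noteq> 0"
  shows "t x = x \<longleftrightarrow> \<bar>x\<bar> \<noteq> \<bar>k\<bar> \<and> \<bar>x\<bar> \<noteq> \<bar>l\<bar>"
proof -
  have "k \<noteq> 0" "l \<noteq> 0" using assms spts_nonzero by auto
  then show ?thesis using assms unfolding sref_def by (auto simp: abs_eq_iff)
qed

lemma refls_commute_half:
  assumes "t \<in> refls n" "t x = x" "x \<in> spts n"
  shows "sref x (- x) \<circ> t \<circ> sref x (- x) = t"
proof -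
  obtain k l where t: "t = sref k l" "k \<in> spts n" "l \<in> spts n" "k \<noteq> l" using assms(1) by (rule reflsE)
  have x: "x \<noteq> 0" using assms(3) spts_nonzero by auto
  have "\<bar>k\<bar> \<noteq> \<bar>x\<bar>" "\<bar>l\<bar> \<noteq> \<bar>x\<bar>" using refls_fixes_iff[OF assms(1) t x] assms(2) by auto
  then have "sref x (- x) k = k" "sref x (- x) l = l" by (simp_all add: sref_other)
  then show ?thesis unfolding t(1) using x by (simp add: sref_conj_sref)
qed

lemma sref_uminus_right_conj:
  assumes "i \<in> spts n" "j \<in> spts n" "\<bar>i\<bar> \<noteq> \<bar>j\<bar>"
  shows "sref i (- i) \<circ> sref i j \<circ> sref i (- i) = sref i (- j)"
    "sref j (- j) \<circ> sref i j \<circ> sref j (- j) = sref i (- j)"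
proof -
  have nz: "i \<noteq> 0" "j \<noteq> 0" using assms spts_nonzero by auto
  have "sref (- i) j = sref i (- j)" using nz sref_uminus[of i "- j"] by simp
  moreover have "sref i (- i) j = j" "sref j (- j) i = i" using assms by (simp_all add: sref_other)
  ultimately show "sref i (- i) \<circ> sref i j \<circ> sref i (- i) = sref i (- j)"
    "sref j (- j) \<circ> sref i j \<circ> sref j (- j) = sref i (- j)"
    using nz by (simp_all add: sref_conj_sref)
qed

lemma refls_fixes_cases:
  assumes t: "t \<in> refls n" and ij: "i \<in> spts n" "j \<in> spts n" "\<bar>i\<bar> \<noteq> \<bar>j\<bar>" and ne: "t \<noteq> sref i j" "t \<noteq> sref i (- j)"
  shows "t i = i \<or> t j = j"
proof (rule ccontr)
  assume *: "\<not> (t i = i \<or> t j = j)"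
  have ti: "t = sref i (t i)" using refls_moved[OF t] * by blast
  obtain k l where kl: "t = sref k l" "k \<in> spts n" "l \<in> spts n" "k \<noteq> l" using t by (rule reflsE)
  have nz: "i \<noteq> 0" "j \<noteq> 0" using ij spts_nonzero by auto
  have "\<bar>i\<bar> = \<bar>k\<bar> \<or> \<bar>i\<bar> = \<bar>l\<bar>" "\<bar>j\<bar> = \<bar>k\<bar> \<or> \<bar>j\<bar> = \<bar>l\<bar>"
    using refls_fixes_iff[OF t kl] nz * by auto
  then have "\<bar>t i\<bar> = \<bar>j\<bar>" using ij(3) unfolding kl(1) sref_def by (auto simp: abs_eq_iff)
  then have "t i = j \<or> t i = - j" by linarith
  then show False using ti ne by metis
qed

text \<open>A reflection different from \<open>sref i j\<close> and its partner fixes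
  \<open>i\<close> or \<open>j\<close>. The sign change at this fixed point commutes with
  \<open>t\<close> and conjugates \<open>sref i j\<close> to \<open>sref i (- j)\<close>, so
  replacing one by the other does not alter the order of the product with \<open>t\<close>.\<close>

lemma funpow_flip:
  assumes t: "t \<in> refls n" and ij: "i \<in> spts n" "j \<in> spts n" "\<bar>i\<bar> \<noteq> \<bar>j\<bar>" and ne: "t \<noteq> sref i j" "t \<noteq> sref i (- j)"
  shows "(sref i j \<circ> t) ^^ m = id \<Longrightarrow> (sref i (- j) \<circ> t) ^^ m = id"
    "(t \<circ> sref i j) ^^ m = id \<Longrightarrow> (t \<circ> sref i (- j)) ^^ m = id"
proof -
  obtain x where x: "x \<in> spts n" "t x = x" "sref x (- x) \<circ> sref i j \<circ> sref x (- x) = sref i (- j)"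
    using refls_fixes_cases[OF assms] sref_uminus_right_conj[OF ij] ij by metis
  let ?g = "sref x (- x)"
  have nz: "x \<noteq> 0" using x spts_nonzero by auto
  have gg: "?g \<circ> ?g = id" using nz by simp
  have g: "?g (?g y) = y" for y using nz by simp
  have tg: "t y = ?g (t (?g y))" for y using refls_commute_half[OF t x(2,1)] by (metis comp_apply)
  have gt: "?g (t y) = t (?g y)" for y using tg[of "?g y"] g by simp
  have ig: "sref i (- j) y = ?g (sref i j (?g y))" for y using x(3) by (metis comp_apply)
  have 1: "sref i (- j) \<circ> t = ?g \<circ> (sref i j \<circ> t) \<circ> ?g"
    by (rule ext) (simp add: ig gt)
  have 2: "t \<circ> sref i (- j) = ?g \<circ> (t \<circ> sref i j) \<circ> ?g"
    by (rule ext) (simp add: ig gt[symmetric])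
  show "(sref i j \<circ> t) ^^ m = id \<Longrightarrow> (sref i (- j) \<circ> t) ^^ m = id"
    unfolding 1 funpow_conj[OF gg] by (simp add: gg)
  show "(t \<circ> sref i j) ^^ m = id \<Longrightarrow> (t \<circ> sref i (- j)) ^^ m = id"
    unfolding 2 funpow_conj[OF gg] by (simp add: gg)
qed

text \<open>The change of level when a point crosses the shifted mirror, an odd function of
  \<open>p\<close>. The value is 2 and not 1 in order that the potential \<open>u\<close> of
  \<open>shift_coboundary\<close> can be integral: for sign changes, and when \<open>t\<close> is
  the partner \<open>sref i (- j)\<close>, it takes half of the shift.\<close>

definition shift :: "int \<Rightarrow> int \<Rightarrow> int \<Rightarrow> int" where
  "shift i j p = (if p = i then - 2 else if p = j then 2 else if p = - i then 2 else if p = - j then - 2 else 0)"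

text \<open>Two affine reflections with distinct linear parts have a common fixed point. Here \<open>u\<close> plays
  the role of that point: translating by it turns the shifted reflection back into a linear one.\<close>

lemma shift_coboundary:
  assumes t: "t \<in> refls n" and ij: "i \<in> spts n" "j \<in> spts n" "i \<noteq> j" and ne: "t \<noteq> sref i j"
  shows "\<exists>u :: int \<Rightarrow> int. (\<forall>p. u (t p) = u p) \<and> (\<forall>p. u (sref i j p) = u p + shift i j p)"
proof -
  have nz: "i \<noteq> 0" "j \<noteq> 0" using ij spts_nonzero by auto
  have tW: "t \<in> Wn n" using t refls_Wn by blast
  note tinj = Wn_eq_iff[OF tW] and todd = Wn_uminus[OF tW]
  have tt: "t (t p) = p" for p using refls_involution[OF t] .
  have teq: "t p = a \<longleftrightarrow> p = t a" for p a using tt by metis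
  \<comment> \<open>In every case \<open>u\<close> has to be constant on the orbits of
    \<open>t\<close> and to jump by the shift across \<open>sref i j\<close>. The cases record which
    ends \<open>t\<close> moves; if it moves both, it is the partner and swaps \<open>i\<close> with
    \<open>- j\<close>.\<close>
  consider (half1) "j = - i" "t i = i" | (half2) "j = - i" "t i \<noteq> i" 
    | (i) "\<bar>i\<bar> \<noteq> \<bar>j\<bar>" "t i = i" | (j) "\<bar>i\<bar> \<noteq> \<bar>j\<bar>" "t j = j" | (both) "\<bar>i\<bar> \<noteq> \<bar>j\<bar>" "t i \<noteq> i" "t j \<noteq> j"
    using ij(3) by (metis abs_eq_iff minus_minus)
  then show ?thesis
  proof cases
    case half1
    have "t (- i) = - i" using half1 todd by simp
    then have "t p = i \<longleftrightarrow> p = i" "t p = - i \<longleftrightarrow> p = - i" for p using half1 teq by auto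
    then show ?thesis using half1 nz
      by (intro exI[of _ "\<lambda>p. if p = i then 1 else if p = - i then - 1 else 0"]) (auto simp: sref_def shift_def)
  next
    case half2
    define q where "q = t i"
    have q: "t i = q" "t q = i" "t (- i) = - q" "t (- q) = - i" using todd tt by (auto simp: q_def)
    have t': "t = sref i q" using refls_moved(1)[OF t half2(2)] q by simp
    have "q \<noteq> i" "q \<noteq> - i" using half2 ne t' q by auto
    have "t p = i \<longleftrightarrow> p = q" "t p = - i \<longleftrightarrow> p = - q" "t p = q \<longleftrightarrow> p = i" "t p = - q \<longleftrightarrow> p = - i" for p 
      using q teq by auto
    then show ?thesis using half2(1) nz \<open>q \<noteq> i\<close> \<open>q \<noteq> - i\<close>
      by (intro exI[of _ "\<lambda>p. if p = i \<or> p = q then 1 else if p = - i \<or> p = - q then - 1 else 0"]) 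
        (auto simp: sref_def shift_def)
  next
    case i
    have "t (- i) = - i" using i todd by simp
    then have "t p = i \<longleftrightarrow> p = i" "t p = - i \<longleftrightarrow> p = - i" for p using i teq by auto
    then show ?thesis using i(1) nz
      by (intro exI[of _ "\<lambda>p. if p = i then 2 else if p = - i then - 2 else 0"]) (auto simp: sref_def shift_def)
  next
    case j
    have "t (- j) = - j" using j todd by simp
    then have "t p = j \<longleftrightarrow> p = j" "t p = - j \<longleftrightarrow> p = - j" for p using j teq by auto
    then show ?thesis using j(1) nz
      by (intro exI[of _ "\<lambda>p. if p = j then - 2 else if p = - j then 2 else 0"]) (auto simp: sref_def shift_def)
  next
    case both
    then have "t = sref i (- j)" using refls_fixes_cases[OF t ij(1,2) both(1)] ne by blast
    then have q: "t i = - j" "t (- j) = i" "t j = - i" "t (- i) = j" using nz todd by (auto, metis minus_minus sref_simps(2) todd)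
    then have "t p = i \<longleftrightarrow> p = - j" "t p = - i \<longleftrightarrow> p = j" "t p = j \<longleftrightarrow> p = - i" "t p = - j \<longleftrightarrow> p = i" for p 
      using teq by auto
    then show ?thesis using both(1) nz
      by (intro exI[of _ "\<lambda>p. if p = i \<or> p = - j then 1 else if p = - i \<or> p = j then - 1 else 0"]) 
        (auto simp: sref_def shift_def)
  qed
qed

section \<open>Connectivity in the signed graph of the generators\<close>

text \<open>Orbits are described by steps along single generators because they are mostly needed for
  \<open>S\<close> with one or two edges removed.\<close>

definition reach :: "(int \<Rightarrow> int) set \<Rightarrow> (int \<times> int) set" where
  "reach S = {(x, s x) | x s. s \<in> S}\<^sup>*"

lemma reach_refl [simp]: "(x, x) \<in> reach S"
  by (simp add: reach_def)

lemma reach_step: "s \<in> S \<Longrightarrow> (x, s x) \<in> reach S"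
  unfolding reach_def by (rule r_into_rtrancl) blast

lemma reach_trans: "(x, y) \<in> reach S \<Longrightarrow> (y, z) \<in> reach S \<Longrightarrow> (x, z) \<in> reach S"
  unfolding reach_def by (rule rtrancl_trans)

lemma reach_mono: "S \<subseteq> T \<Longrightarrow> reach S \<subseteq> reach T"
  unfolding reach_def by (intro rtrancl_mono) blast

lemma reach_evalw: "set ws \<subseteq> S \<Longrightarrow> (x, evalw ws x) \<in> reach S"
proof (induction ws)
  case (Cons s ws)
  then show ?case using reach_trans reach_step[of s S "evalw ws x"] by simp
qed simp

lemma reach_imp_evalw: "(x, y) \<in> reach S \<Longrightarrow> \<exists>ws. set ws \<subseteq> S \<and> evalw ws x = y"
  unfolding reach_def
proof (induction rule: rtrancl_induct)
  case base
  show ?case by (intro exI[of _ "[]"]) simp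
next
  case (step y z)
  then obtain ws s where "set ws \<subseteq> S" "evalw ws x = y" "s \<in> S" "z = s y" by blast
  then show ?case by (intro exI[of _ "s # ws"]) simp
qed

lemma reach_sym:
  assumes "S \<subseteq> refls n" "(x, y) \<in> reach S"
  shows "(y, x) \<in> reach S"
  using assms(2) unfolding reach_def
proof (induction rule: rtrancl_induct)
  case (step y z)
  then obtain s where s: "s \<in> S" "z = s y" by blast
  then have "y = s z" using refls_involution[of s n y] assms(1) by auto
  then have "(z, y) \<in> {(x, s x) | x s. s \<in> S}" using s by blast
  then show ?case using step by (meson converse_rtrancl_into_rtrancl)
qed simp

lemma reach_uminus:
  assumes "S \<subseteq> refls n" "(x, y) \<in> reach S"
  shows "(- x, - y) \<in> reach S"
  using assms(2) unfolding reach_def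
proof (induction rule: rtrancl_induct)
  case (step y z)
  then obtain s where s: "s \<in> S" "z = s y" by blast
  then have "s \<in> Wn n" using assms(1) refls_Wn by blast
  then have "- z = s (- y)" using Wn_uminus[of s n y] s by simp
  then have "(- y, - z) \<in> {(x, s x) | x s. s \<in> S}" using s by blast
  then show ?case using step by (meson rtrancl_into_rtrancl)
qed simp

lemma reach_uminus_iff:
  assumes "S \<subseteq> refls n"
  shows "(- x, - y) \<in> reach S \<longleftrightarrow> (x, y) \<in> reach S" "(- x, y) \<in> reach S \<longleftrightarrow> (x, - y) \<in> reach S"
  using reach_uminus[OF assms, of x y] reach_uminus[OF assms, of "- x" "- y"] 
    reach_uminus[OF assms, of "- x" y] reach_uminus[OF assms, of x "- y"] by auto

context coxeter_generators
begin

text \<open>The points \<open>(p, z)\<close> are copies of \<open>p\<close> on level \<open>z\<close>. One generator, possibly after changing the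
  sign of one of its ends, is made to change levels; the other generators keep them. As in the
  affine reflection representation, all relations between two generators persist, so the finite
  group \<open>R\<close> acts and no word can shift a point to another copy of itself.\<close>

lemma level_action:
  assumes e: "sref i j \<in> S" "i \<in> spts n" "j \<in> spts n" "i \<noteq> j"
    and j': "j' = j \<or> (j' = - j \<and> \<bar>i\<bar> \<noteq> \<bar>j\<bar> \<and> sref i (- j) \<notin> S)"
    and \<phi>: "\<phi> = (\<lambda>s (p, z). if s = sref i j then (sref i j' p, z + shift i j' p) else (s p, z))"
    and ws: "set ws \<subseteq> S"
  shows "\<exists>N>0. hom_eval \<phi> ws ^^ N = id"
proof (rule hom_eval_finite_order[OF _ _ ws])
  let ?e = "sref i j" and ?e' = "sref i j'"
  have nz: "i \<noteq> 0" "j \<noteq> 0" using e spts_nonzero by auto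
  have j'sp: "j' \<in> spts n" "i \<noteq> j'" "j' \<noteq> 0" using j' e nz by auto
  have ee: "\<phi> ?e \<circ> \<phi> ?e = id"
    unfolding \<phi> using nz j'sp by (auto simp: fun_eq_iff shift_def sref_def)
  have ss: "\<phi> s \<circ> \<phi> s = id" if "s \<in> S" "s \<noteq> ?e" for s
    unfolding \<phi> using that S_refls refls_involution[of s n] by (auto simp: fun_eq_iff)
  show "\<phi> s \<circ> \<phi> s = id" if "s \<in> S" for s
    using ee ss that by (cases "s = ?e") simp_all
  fix s t assume st: "s \<in> S" "t \<in> S"
  have stW: "s \<in> Wn n" "t \<in> Wn n" using st S_Wn by auto
  let ?m = "elt_order (s \<circ> t)"
  have m: "(s \<circ> t) ^^ ?m = id" using funpow_elt_order[OF comp_Wn[OF stW]] by simp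
  have mixed: "\<exists>u. (\<forall>p. u (t p) = u p) \<and> (\<forall>p. u (?e' p) = u p + shift i j' p)"
    "(?e \<circ> t) ^^ k = id \<Longrightarrow> (?e' \<circ> t) ^^ k = id" "(t \<circ> ?e) ^^ k = id \<Longrightarrow> (t \<circ> ?e') ^^ k = id"
    if "t \<in> S" "t \<noteq> ?e" for t k
  proof -
    have t: "t \<in> refls n" using that S_refls by blast
    have ne: "t \<noteq> ?e'" using that j' by auto
    show "\<exists>u. (\<forall>p. u (t p) = u p) \<and> (\<forall>p. u (?e' p) = u p + shift i j' p)"
      by (rule shift_coboundary[OF t e(2) j'sp(1,2) ne])
    show "(?e \<circ> t) ^^ k = id \<Longrightarrow> (?e' \<circ> t) ^^ k = id" "(t \<circ> ?e) ^^ k = id \<Longrightarrow> (t \<circ> ?e') ^^ k = id"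
      using j' funpow_flip[OF t e(2,3), of k] that ne by auto
  qed
  consider "s = ?e" "t = ?e" | "s = ?e" "t \<noteq> ?e" | "s \<noteq> ?e" "t = ?e" | "s \<noteq> ?e" "t \<noteq> ?e" by blast
  then show "(\<phi> s \<circ> \<phi> t) ^^ ?m = id"
  proof cases
    case 1
    then show ?thesis using ee by simp
  next
    case 2
    obtain u where u: "\<And>p. u (t p) = u p" "\<And>p. u (?e' p) = u p + shift i j' p"
      using mixed(1)[OF st(2) 2(2)] by blast
    \<comment> \<open>With the potential \<open>u\<close> the level along any trajectory changes
      exactly by the change of \<open>u\<close>, so it returns as soon as the point does.\<close>
    have "((\<phi> s \<circ> \<phi> t) ^^ k) (p, z) = (((?e' \<circ> t) ^^ k) p, z + u (((?e' \<circ> t) ^^ k) p) - u p)" for k p z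
      by (induction k) (use 2 u in \<open>auto simp: \<phi>\<close>)
    moreover have "(?e' \<circ> t) ^^ ?m = id" using mixed(2)[OF st(2) 2(2)] m 2 by simp
    ultimately show ?thesis by (auto simp: fun_eq_iff)
  next
    case 3
    obtain u where u: "\<And>p. u (s p) = u p" "\<And>p. u (?e' p) = u p + shift i j' p"
      using mixed(1)[OF st(1) 3(1)] by blast
    have "((\<phi> s \<circ> \<phi> t) ^^ k) (p, z) = (((s \<circ> ?e') ^^ k) p, z + u (((s \<circ> ?e') ^^ k) p) - u p)" for k p z
      by (induction k) (use 3 u in \<open>auto simp: \<phi>\<close>)
    moreover have "(s \<circ> ?e') ^^ ?m = id" using mixed(3)[OF st(1) 3(1)] m 3 by simp
    ultimately show ?thesis by (auto simp: fun_eq_iff)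
  next
    case 4
    have "((\<phi> s \<circ> \<phi> t) ^^ k) (p, z) = (((s \<circ> t) ^^ k) p, z)" for k p z
      by (induction k) (use 4 in \<open>auto simp: \<phi>\<close>)
    then show ?thesis using m by (auto simp: fun_eq_iff)
  qed
qed

lemma level_word:
  assumes "set ws \<subseteq> S - {sref i j}" 
    and \<phi>: "\<phi> = (\<lambda>s (p, z). if s = sref i j then (sref i j' p, z + shift i j' p) else (s p, z))"
  shows "hom_eval \<phi> ws (p, z) = (evalw ws p, z)"
  using assms(1) by (induction ws) (auto simp: \<phi>)

text \<open>A path from \<open>i\<close> to \<open>j'\<close> that avoids the edge, closed up by the
  edge itself, would return \<open>i\<close> to itself two levels higher. The version
  \<open>j' = - j\<close> flips the sign of the edge, which respects the pairwise relations as long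
  as the partner is not a generator.\<close>

lemma not_reach_flip:
  assumes e: "sref i j \<in> S" "i \<in> spts n" "j \<in> spts n" "i \<noteq> j"
    and j': "j' = j \<or> (j' = - j \<and> \<bar>i\<bar> \<noteq> \<bar>j\<bar> \<and> sref i (- j) \<notin> S)"
  shows "(i, j') \<notin> reach (S - {sref i j})"
proof
  assume "(i, j') \<in> reach (S - {sref i j})"
  then obtain ws where ws: "set ws \<subseteq> S - {sref i j}" "evalw ws i = j'" using reach_imp_evalw by blast
  define \<phi> where "\<phi> = (\<lambda>s (p, z). if s = sref i j then (sref i j' p, z + shift i j' p) else (s p, z))"
  have sub: "set (sref i j # ws) \<subseteq> S" using ws e by auto
  obtain N where "N > 0" "hom_eval \<phi> (sref i j # ws) ^^ N = id"
    using level_action[OF e j' \<phi>_def sub] by blast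
  moreover have "hom_eval \<phi> (sref i j # ws) (i, z) = (i, z + 2)" for z
    using level_word[OF ws(1) \<phi>_def, of i z] ws(2) j' e by (auto simp: \<phi>_def shift_def)
  ultimately show False using no_level_change[of N \<phi> "sref i j # ws" i 2] by simp
qed

lemma not_reach:
  assumes e: "sref i j \<in> S" "i \<in> spts n" "j \<in> spts n" "i \<noteq> j"
  shows "(i, j) \<notin> reach (S - {sref i j})"
  using not_reach_flip[OF e, of j] by simp

text \<open>If the partner \<open>sref i (- j)\<close> is a generator, it is itself an edge that
  admits no bypass; otherwise the sign of the edge may be flipped.\<close>

lemma not_reach_uminus:
  assumes e: "sref i j \<in> S" "i \<in> spts n" "j \<in> spts n" "\<bar>i\<bar> \<noteq> \<bar>j\<bar>" and T: "T \<subseteq> S - {sref i j, sref i (- j)}"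
  shows "(i, - j) \<notin> reach T"
proof (cases "sref i (- j) \<in> S")
  case True
  have "i \<noteq> - j" using e by auto
  then have "(i, - j) \<notin> reach (S - {sref i (- j)})" using not_reach[OF True] e by simp
  then show ?thesis using reach_mono[of T "S - {sref i (- j)}"] T by blast
next
  case False
  have "i \<noteq> j" using e by auto
  then have "(i, - j) \<notin> reach (S - {sref i j})" using not_reach_flip[OF e(1-3), of "- j"] e False by simp
  then show ?thesis using reach_mono[of T "S - {sref i j}"] T by blast
qed

text \<open>The loop from \<open>i\<close> over \<open>j\<close>, \<open>- j\<close> and
  \<open>- i\<close> back to \<open>i\<close> crosses the edge twice. Since the shift is odd, the
  two crossings do not cancel but add up to a change of -4.\<close>

lemma not_reach_both_flips:
  assumes e: "sref i j \<in> S" "i \<in> spts n" "j \<in> spts n" "\<bar>i\<bar> \<noteq> \<bar>j\<bar>"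
    and "(i, - i) \<in> reach (S - {sref i j})" "(j, - j) \<in> reach (S - {sref i j})"
  shows False
proof -
  have nz: "i \<noteq> 0" "j \<noteq> 0" "i \<noteq> j" using e spts_nonzero by auto
  have sub: "S - {sref i j} \<subseteq> refls n" using S_refls by blast
  have "(- i, i) \<in> reach (S - {sref i j})" using reach_sym[OF sub assms(5)] .
  then obtain g where g: "set g \<subseteq> S - {sref i j}" "evalw g (- i) = i" using reach_imp_evalw by blast
  obtain h where h: "set h \<subseteq> S - {sref i j}" "evalw h j = - j" using reach_imp_evalw assms(6) by blast
  define \<phi> where "\<phi> = (\<lambda>s (p, z). if s = sref i j then (sref i j p, z + shift i j p) else (s p, z))"
  let ?ws = "g @ sref i j # h @ [sref i j]"
  have ws: "set ?ws \<subseteq> S" using g h e by auto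
  obtain N where "N > 0" "hom_eval \<phi> ?ws ^^ N = id"
    using level_action[OF e(1-3) nz(3) _ \<phi>_def ws] by blast
  moreover have "hom_eval \<phi> ?ws (i, z) = (i, z + (- 4))" for z
  proof -
    have "\<phi> (sref i j) (i, z) = (j, z - 2)" by (simp add: \<phi>_def shift_def)
    moreover have "\<phi> (sref i j) (- j, z - 2) = (- i, z - 4)" 
      using nz e by (auto simp: \<phi>_def shift_def sref_def)
    ultimately show ?thesis
      using level_word[OF g(1) \<phi>_def] level_word[OF h(1) \<phi>_def] g(2) h(2) by simp
  qed
  ultimately show False using no_level_change[of N \<phi> ?ws i "- 4"] by simp
qed

end

section \<open>Coxeter diagrams and the numbers game\<close>

lemma finite_refls: "finite (refls n)"
proof (rule finite_subset)
  show "refls n \<subseteq> {p. p permutes spts n}" using refls_Wn Wn_permutes by blast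
qed (simp add: finite_permutations)

definition is_edge :: "(int \<Rightarrow> int) \<Rightarrow> bool" where
  "is_edge s \<longleftrightarrow> (\<exists>x. \<bar>s x\<bar> \<noteq> \<bar>x\<bar>)"

text \<open>Only the simply laced part of the Coxeter diagram: sign changes are left out, so that
  two adjacent generators always satisfy the braid relation of length 3.\<close>

definition adj :: "(int \<Rightarrow> int) \<Rightarrow> (int \<Rightarrow> int) \<Rightarrow> bool" where
  "adj s t \<longleftrightarrow> is_edge s \<and> is_edge t \<and> s \<circ> t \<noteq> t \<circ> s"

lemma adj_sym: "adj s t \<longleftrightarrow> adj t s"
  by (auto simp: adj_def)

lemma not_adj_refl [simp]: "\<not> adj s s"
  by (simp add: adj_def)

lemma is_edge_sref: "i \<noteq> 0 \<Longrightarrow> j \<noteq> 0 \<Longrightarrow> is_edge (sref i j) \<longleftrightarrow> \<bar>i\<bar> \<noteq> \<bar>j\<bar>"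
proof -
  assume nz: "i \<noteq> 0" "j \<noteq> 0"
  show ?thesis
  proof
    assume "\<bar>i\<bar> \<noteq> \<bar>j\<bar>"
    then show "is_edge (sref i j)" unfolding is_edge_def by (intro exI[of _ i]) simp
  next
    assume "is_edge (sref i j)"
    then obtain x where "\<bar>sref i j x\<bar> \<noteq> \<bar>x\<bar>" by (auto simp: is_edge_def)
    then show "\<bar>i\<bar> \<noteq> \<bar>j\<bar>" by (auto simp: sref_def split: if_splits)
  qed
qed

lemma edgeE:
  assumes "s \<in> refls n" "is_edge s"
  obtains a b where "s = sref a b" "a \<in> spts n" "b \<in> spts n" "\<bar>a\<bar> \<noteq> \<bar>b\<bar>"
proof -
  obtain a b where *: "s = sref a b" "a \<in> spts n" "b \<in> spts n" "a \<noteq> b" using assms(1) by (rule reflsE)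
  then have "\<bar>a\<bar> \<noteq> \<bar>b\<bar>" using assms(2) is_edge_sref spts_nonzero by auto
  with * show ?thesis using that by blast
qed

lemma sref_disjoint_commute:
  assumes "a \<noteq> 0" "b \<noteq> 0" "\<bar>c\<bar> \<noteq> \<bar>a\<bar>" "\<bar>c\<bar> \<noteq> \<bar>b\<bar>" "\<bar>d\<bar> \<noteq> \<bar>a\<bar>" "\<bar>d\<bar> \<noteq> \<bar>b\<bar>"
  shows "sref a b \<circ> sref c d = sref c d \<circ> sref a b"
proof -
  have "sref a b \<circ> sref c d \<circ> sref a b = sref c d"
    using assms by (simp add: sref_conj_sref sref_other)
  then have "sref a b \<circ> sref c d \<circ> (sref a b \<circ> sref a b) = sref c d \<circ> sref a b"
    by (simp only: o_assoc)
  then show ?thesis using assms by simp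
qed

lemma sref_parallel_commute:
  assumes "a \<noteq> 0" "b \<noteq> 0" "\<bar>a\<bar> \<noteq> \<bar>b\<bar>"
  shows "sref a b \<circ> sref a (- b) = sref a (- b) \<circ> sref a b"
proof -
  have "sref a b (- b) = - a" using assms by (auto simp: sref_def)
  then have "sref a b \<circ> sref a (- b) \<circ> sref a b = sref a (- b)"
    using assms sref_uminus[of a "- b"] sref_commute[of b "- a"] by (simp add: sref_conj_sref)
  then have "sref a b \<circ> sref a (- b) \<circ> (sref a b \<circ> sref a b) = sref a (- b) \<circ> sref a b"
    by (simp only: o_assoc)
  then show ?thesis using assms by simp
qed

lemma adj_common:
  assumes "s \<in> refls n" "t \<in> refls n" "adj s t"
  shows "\<exists>a b c. s = sref a b \<and> t = sref b c \<and> a \<in> spts n \<and> b \<in> spts n \<and> c \<in> spts n \<and>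
    \<bar>a\<bar> \<noteq> \<bar>b\<bar> \<and> \<bar>b\<bar> \<noteq> \<bar>c\<bar> \<and> \<bar>a\<bar> \<noteq> \<bar>c\<bar>"
proof -
  obtain a b where s: "s = sref a b" "a \<in> spts n" "b \<in> spts n" "\<bar>a\<bar> \<noteq> \<bar>b\<bar>"
    using assms by (auto simp: adj_def elim: edgeE)
  have t: "t \<in> refls n" "is_edge t" and comm: "s \<circ> t \<noteq> t \<circ> s" using assms by (auto simp: adj_def)
  have nz: "a \<noteq> 0" "b \<noteq> 0" using s spts_nonzero by auto
  have "t \<noteq> sref a b" "t \<noteq> sref a (- b)" 
    using comm sref_parallel_commute[OF nz s(4)] s(1) by auto
  then have fixd: "t a = a \<or> t b = b" by (rule refls_fixes_cases[OF t(1) s(2-4)])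
  have moved: "t a \<noteq> a \<or> t b \<noteq> b"
  proof (rule ccontr)
    assume "\<not> (t a \<noteq> a \<or> t b \<noteq> b)"
    moreover obtain c d where cd: "t = sref c d" "c \<in> spts n" "d \<in> spts n" "c \<noteq> d" using t(1) by (rule reflsE)
    ultimately have "\<bar>c\<bar> \<noteq> \<bar>a\<bar>" "\<bar>c\<bar> \<noteq> \<bar>b\<bar>" "\<bar>d\<bar> \<noteq> \<bar>a\<bar>" "\<bar>d\<bar> \<noteq> \<bar>b\<bar>"
      using refls_fixes_iff[OF t(1) cd nz(1)] refls_fixes_iff[OF t(1) cd nz(2)] by auto
    then show False using comm sref_disjoint_commute[OF nz] s(1) cd(1) by blast
  qed
  have main: ?thesis if "s = sref x y" "x \<in> spts n" "y \<in> spts n" "\<bar>x\<bar> \<noteq> \<bar>y\<bar>" "t x = x" "t y \<noteq> y" for x y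
  proof -
    have ty: "t = sref y (t y)" "t y \<in> spts n" using refls_moved[OF t(1) that(6)] by blast+
    have nzy: "y \<noteq> 0" "t y \<noteq> 0" "x \<noteq> 0" using that ty spts_nonzero by auto
    have 1: "\<bar>y\<bar> \<noteq> \<bar>t y\<bar>" using t(2) ty is_edge_sref[of y "t y"] nzy by simp
    have "t y \<noteq> y" using that by simp
    then have "\<bar>x\<bar> \<noteq> \<bar>t y\<bar>" 
      using refls_fixes_iff[OF t(1) ty(1) that(3) ty(2) _ nzy(3)] that(5) by auto
    with 1 that ty show ?thesis by blast
  qed
  show ?thesis
  proof (cases "t a = a")
    case True
    then show ?thesis using main[of a b] s moved by blast
  next
    case False
    have "s = sref b a" using s(1) sref_commute by metis
    then show ?thesis using main[of b a] s(2-4) fixd False by simp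
  qed
qed

lemma adj_braid:
  assumes "s \<in> refls n" "t \<in> refls n" "adj s t"
  shows "s \<circ> t \<circ> s = t \<circ> s \<circ> t"
proof -
  obtain a b c where *: "s = sref a b" "t = sref b c" "a \<in> spts n" "b \<in> spts n" "c \<in> spts n"
    "\<bar>a\<bar> \<noteq> \<bar>b\<bar>" "\<bar>b\<bar> \<noteq> \<bar>c\<bar>" "\<bar>a\<bar> \<noteq> \<bar>c\<bar>"
    using adj_common[OF assms] by blast
  then have "a \<noteq> 0" "b \<noteq> 0" "c \<noteq> 0" using spts_nonzero by auto
  then show ?thesis using * by (simp add: sref_conj_sref sref_other)
qed

lemma braid_funpow_3:
  assumes "s \<circ> s = id" "t \<circ> t = id" "s \<circ> t \<circ> s = t \<circ> s \<circ> t"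
  shows "(s \<circ> t) ^^ 3 = id"
proof -
  have "(s \<circ> t) ^^ 3 = (s \<circ> t \<circ> s) \<circ> (t \<circ> s \<circ> t)" by (simp add: numeral_3_eq_3 o_assoc)
  also have "\<dots> = (t \<circ> s \<circ> t) \<circ> (t \<circ> s \<circ> t)" using assms(3) by simp
  also have "\<dots> = t \<circ> (s \<circ> (t \<circ> t) \<circ> s) \<circ> t" by (simp only: o_assoc)
  also have "\<dots> = id" using assms by simp
  finally show ?thesis .
qed

lemma funpow_mod:
  assumes "f ^^ k = id"
  shows "f ^^ m = f ^^ (m mod k)"
proof -
  have "f ^^ m = f ^^ (m mod k) \<circ> (f ^^ k) ^^ (m div k)"
    by (metis funpow_add funpow_mult mod_mult_div_eq)
  then show ?thesis using assms by simp
qed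

text \<open>Since the cube of the product is trivial, an exponent not divisible by 3 would make the
  product or its square trivial, and the two involutions would commute.\<close>

lemma adj_order_dvd:
  assumes "s \<in> refls n" "t \<in> refls n" "adj s t" "(s \<circ> t) ^^ m = id"
  shows "3 dvd m"
proof (rule ccontr)
  assume "\<not> 3 dvd m"
  then have "m mod 3 = 1 \<or> m mod 3 = 2" by arith
  moreover have ss: "s \<circ> s = id" "t \<circ> t = id" using assms refls_comp_self by auto
  have "(s \<circ> t) ^^ (m mod 3) = id"
    using funpow_mod[OF braid_funpow_3[OF ss adj_braid[OF assms(1-3)]], of m] assms(4) by simp
  ultimately have "s \<circ> t = id \<or> (s \<circ> t) \<circ> (s \<circ> t) = id"
    by (auto simp: numeral_2_eq_2)
  then have "s \<circ> t = t \<circ> s"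
  proof
    assume "s \<circ> t = id"
    then have "s \<circ> (s \<circ> t) \<circ> s = id" using ss by simp
    then have "t \<circ> s = id" using ss by (simp add: o_assoc)
    then show ?thesis using \<open>s \<circ> t = id\<close> by simp
  next
    assume "(s \<circ> t) \<circ> (s \<circ> t) = id"
    then have "s \<circ> ((s \<circ> t) \<circ> (s \<circ> t)) \<circ> t = s \<circ> t" by simp
    moreover have "s \<circ> ((s \<circ> t) \<circ> (s \<circ> t)) \<circ> t = (s \<circ> s) \<circ> (t \<circ> s) \<circ> (t \<circ> t)" by (simp only: o_assoc)
    ultimately show ?thesis using ss by simp
  qed
  then show False using assms(3) by (simp add: adj_def)
qed

text \<open>In a dihedral group of odd order parameter the two generating involutions are conjugate,
  by a power of their product.\<close>

lemma odd_order_imp_conj: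
  assumes "s \<in> refls n" "t \<in> refls n" "(s \<circ> t) ^^ m = id" "odd m"
  shows "\<exists>k. (s \<circ> t) ^^ k \<circ> s = t \<circ> (s \<circ> t) ^^ k"
proof -
  obtain k where m: "m = k + Suc k" using assms(4) by (metis oddE mult_2 add.assoc Suc_eq_plus1)
  have ss: "s \<circ> s = id" "t \<circ> t = id" using assms refls_comp_self by auto
  define g where "g = s \<circ> t"
  have sst: "s (s x) = x" "t (t x) = x" for x using ss by (simp_all add: fun_eq_iff)
  have g: "g x = s (t x)" for x by (simp add: g_def)
  have tf: "t ((g ^^ j) (t ((g ^^ j) x))) = x" for j x
  proof (induction j)
    case (Suc j)
    have "(g ^^ Suc j) (t ((g ^^ Suc j) x)) = (g ^^ j) (g (t (g ((g ^^ j) x))))"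
      by (simp add: funpow_swap1)
    also have "g (t (g ((g ^^ j) x))) = t ((g ^^ j) x)" by (simp add: sst g)
    finally show ?case using Suc by simp
  qed (use sst in simp)
  have gg: "(g ^^ k) (g ((g ^^ k) y)) = y" for y
  proof -
    have "(g ^^ (k + Suc k)) y = (g ^^ k) (g ((g ^^ k) y))"
      by (simp only: funpow_add comp_apply funpow.simps)
    moreover have "g ^^ (k + Suc k) = id" using assms(3) unfolding m g_def .
    ultimately show ?thesis by (simp only: id_apply)
  qed
  have "(g ^^ k) (s x) = t ((g ^^ k) x)" for x
    using gg[of "t ((g ^^ k) x)"] tf[of k x] by (simp add: g)
  then have "(s \<circ> t) ^^ k \<circ> s = t \<circ> (s \<circ> t) ^^ k" by (simp add: fun_eq_iff g_def)
  then show ?thesis by blast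
qed

text \<open>For odd \<open>m\<close> the power \<open>(s \<circ> t) ^^ k\<close> would conjugate
  \<open>s\<close> to \<open>t\<close>. Commuting generators would then coincide, and an edge is
  never conjugate to a sign change.\<close>

lemma not_adj_order_even:
  assumes st: "s \<in> refls n" "t \<in> refls n" "(s \<circ> t) ^^ m = id" "s \<noteq> t"
    and "s \<circ> t = t \<circ> s \<or> is_edge s \<noteq> is_edge t"
  shows "even m"
proof (rule ccontr)
  assume "odd m"
  then obtain k where k: "(s \<circ> t) ^^ k \<circ> s = t \<circ> (s \<circ> t) ^^ k"
    using odd_order_imp_conj[OF st(1-3)] by blast
  let ?f = "(s \<circ> t) ^^ k"
  have fW: "?f \<in> Wn n" using st refls_Wn by (intro funpow_Wn comp_Wn) auto
  have fx: "?f (s x) = t (?f x)" for x using k by (metis comp_apply)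
  show False using assms(5)
  proof
    assume comm: "s \<circ> t = t \<circ> s"
    have "?f \<circ> t = t \<circ> ?f"
    proof (rule ext, induction k)
      case (Suc k)
      have "s (t y) = t (s y)" for y using comm by (metis comp_apply)
      then show ?case using Suc by simp
    qed simp
    then have "?f (s x) = ?f (t x)" for x using fx by (metis comp_apply)
    then have "s = t" using Wn_eq_iff[OF fW] by blast
    then show False using st by simp
  next
    assume "is_edge s \<noteq> is_edge t"
    moreover have "is_edge s \<longleftrightarrow> is_edge t"
    proof
      assume "is_edge s"
      then obtain x where "\<bar>s x\<bar> \<noteq> \<bar>x\<bar>" by (auto simp: is_edge_def)
      then have "\<bar>t (?f x)\<bar> \<noteq> \<bar>?f x\<bar>" using Wn_abs_eq_iff[OF fW, of "s x" x] fx by simp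
      then show "is_edge t" by (auto simp: is_edge_def)
    next
      assume "is_edge t"
      then obtain x where x: "\<bar>t x\<bar> \<noteq> \<bar>x\<bar>" by (auto simp: is_edge_def)
      define y where "y = inv ?f x"
      have "x = ?f y" using fW by (simp add: y_def)
      then have "\<bar>?f (s y)\<bar> \<noteq> \<bar>?f y\<bar>" using x fx[of y] by simp
      then have "\<bar>s y\<bar> \<noteq> \<bar>y\<bar>" using Wn_abs_eq_iff[OF fW, of "s y" y] by simp
      then show "is_edge s" by (auto simp: is_edge_def)
    qed
    ultimately show False by simp
  qed
qed

text \<open>A move of the numbers game, that is, a reflection in the geometric representation.\<close>

definition fire :: "'a set \<Rightarrow> ('a \<Rightarrow> 'a \<Rightarrow> bool) \<Rightarrow> 'a \<Rightarrow> ('a \<Rightarrow> int) \<Rightarrow> 'a \<Rightarrow> int" where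
  "fire S E s v = v(s := (\<Sum>t\<in>{t\<in>S. E s t}. v t) - v s)"

lemma sum_neighbours_upd:
  fixes v :: "'a \<Rightarrow> int"
  assumes "finite S" "t \<in> S"
  shows "(\<Sum>x\<in>{x\<in>S. E s x}. (v(t := a)) x) = (\<Sum>x\<in>{x\<in>S. E s x}. v x) + (if E s t then a - v t else 0)"
proof (cases "E s t")
  case True
  have fin: "finite {x\<in>S. E s x}" using assms by simp
  have mem: "t \<in> {x\<in>S. E s x}" using True assms by simp
  have "(\<Sum>x\<in>{x\<in>S. E s x} - {t}. (v(t := a)) x) = (\<Sum>x\<in>{x\<in>S. E s x} - {t}. v x)"
    by (rule sum.cong) auto
  then show ?thesis using sum.remove[OF fin mem, of "v(t := a)"] sum.remove[OF fin mem, of v] True by simp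
next
  case False
  then have "(\<Sum>x\<in>{x\<in>S. E s x}. (v(t := a)) x) = (\<Sum>x\<in>{x\<in>S. E s x}. v x)"
    by (intro sum.cong) auto
  then show ?thesis using False by simp
qed

lemma fire_fire:
  assumes "finite S" "s \<in> S" "\<not> E s s"
  shows "fire S E s \<circ> fire S E s = id"
proof
  fix v show "(fire S E s \<circ> fire S E s) v = id v"
    unfolding fire_def comp_apply using assms by (simp only: sum_neighbours_upd) simp
qed

lemma fire_commute:
  assumes "finite S" "s \<in> S" "t \<in> S" "\<not> E s t" "\<not> E t s"
  shows "fire S E s \<circ> fire S E t = fire S E t \<circ> fire S E s"
proof
  fix v show "(fire S E s \<circ> fire S E t) v = (fire S E t \<circ> fire S E s) v"
    unfolding fire_def comp_apply using assms
    by (cases "s = t") (simp_all only: sum_neighbours_upd, simp_all add: fun_upd_twist)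
qed

lemma fire_braid:
  assumes "finite S" "s \<in> S" "t \<in> S" "E s t" "E t s" "\<not> E s s" "\<not> E t t"
  shows "fire S E s \<circ> fire S E t \<circ> fire S E s = fire S E t \<circ> fire S E s \<circ> fire S E t"
proof
  fix v
  have "s \<noteq> t" using assms by auto
  then show "(fire S E s \<circ> fire S E t \<circ> fire S E s) v = (fire S E t \<circ> fire S E s \<circ> fire S E t) v"
    unfolding fire_def comp_apply using assms
    by (simp only: sum_neighbours_upd) (auto simp: fun_eq_iff)
qed

context coxeter_generators
begin

lemma finite_S: "finite S"
  using S_refls finite_refls finite_subset by blast

text \<open>Sign changes act trivially. This does not disturb the relations, since the order of the
  product of a sign change and an edge is even.\<close>

definition gen_fire :: "(int \<Rightarrow> int) \<Rightarrow> ((int \<Rightarrow> int) \<Rightarrow> int) \<Rightarrow> (int \<Rightarrow> int) \<Rightarrow> int" where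
  "gen_fire s = (if is_edge s then fire S adj s else id)"

lemma gen_fire_fire: "s \<in> S \<Longrightarrow> gen_fire s \<circ> gen_fire s = id"
  using fire_fire[OF finite_S, of s adj] by (simp add: gen_fire_def)

text \<open>Only divisibility of the order matters: it is a multiple of 3 for adjacent generators,
  and even for distinct non-adjacent ones unless both are sign changes and act trivially.\<close>

lemma fire_relation:
  assumes "s \<in> S" "t \<in> S"
  shows "(gen_fire s \<circ> gen_fire t) ^^ elt_order (s \<circ> t) = id"
proof -
  let ?m = "elt_order (s \<circ> t)" and ?f = "gen_fire s \<circ> gen_fire t"
  have st: "s \<in> refls n" "t \<in> refls n" using assms S_refls by auto
  have m: "(s \<circ> t) ^^ ?m = id" using funpow_elt_order comp_Wn S_Wn assms by blast
  note ff = gen_fire_fire[OF assms(1)] gen_fire_fire[OF assms(2)]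
  show ?thesis
  proof (cases "adj s t")
    case True
    have gen_fire_braid: "gen_fire s \<circ> gen_fire t \<circ> gen_fire s = gen_fire t \<circ> gen_fire s \<circ> gen_fire t"
      using True adj_sym[of s t] assms finite_S fire_braid[of S s t adj] by (auto simp: gen_fire_def adj_def)
    have "?f ^^ 3 = id" by (rule braid_funpow_3[OF ff gen_fire_braid])
    moreover have "3 dvd ?m" by (rule adj_order_dvd[OF st True m])
    ultimately show ?thesis using funpow_mod[of 3 ?f ?m] by simp
  next
    case False
    have comm: "gen_fire s \<circ> gen_fire t = gen_fire t \<circ> gen_fire s" 
      using False adj_sym[of s t] assms finite_S fire_commute[of S s t adj] by (simp add: gen_fire_def)
    have "?f ^^ 2 = gen_fire s \<circ> (gen_fire t \<circ> gen_fire s) \<circ> gen_fire t" by (simp add: numeral_2_eq_2 o_assoc)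
    also have "\<dots> = gen_fire s \<circ> (gen_fire s \<circ> gen_fire t) \<circ> gen_fire t" using comm by simp
    also have "\<dots> = (gen_fire s \<circ> gen_fire s) \<circ> (gen_fire t \<circ> gen_fire t)" by (simp only: o_assoc)
    also have "\<dots> = id" using ff by simp
    finally have 2: "?f ^^ 2 = id" .
    consider "s = t" | "\<not> is_edge s" "\<not> is_edge t" | "s \<noteq> t" "s \<circ> t = t \<circ> s \<or> is_edge s \<noteq> is_edge t"
      using False by (auto simp: adj_def)
    then show ?thesis
    proof cases
      case 1
      then show ?thesis using ff by simp
    next
      case 2
      then have "?f = id" by (simp add: gen_fire_def)
      then show ?thesis by simp
    next
      case 3
      have "even ?m" by (rule not_adj_order_even[OF st m 3])
      then show ?thesis using funpow_mod[OF 2, of ?m] by (simp add: even_iff_mod_2_eq_zero)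
    qed
  qed
qed

text \<open>The diagram of the four generators contains a cycle, so their numbers game never returns
  to its starting position, although the group is finite.\<close>

lemma no_diagram_cycle:
  assumes C: "e \<in> S" "d \<in> S" "t \<in> S" "t' \<in> S" "e \<noteq> d" "t \<noteq> t'"
    and adj: "adj e t" "adj e t'" "adj d t" "adj d t'" "\<not> adj e d"
  shows False
proof -
  have ne: "e \<noteq> t" "e \<noteq> t'" "d \<noteq> t" "d \<noteq> t'" using adj by auto
  have edge: "is_edge e" "is_edge d" "is_edge t" "is_edge t'" using adj by (auto simp: adj_def)
  \<comment> \<open>Positions supported on the four generators. The rest of \<open>S\<close> has
    value 0 and is never fired, so it contributes nothing to the sums over neighbours.\<close>
  define V' where "V' a b x y s = (if s = e then a else if s = d then b else if s = t then x else if s = t' then y else (0::int))" for a b x y s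
  \<comment> \<open>The remaining pair \<open>t\<close>, \<open>t'\<close> may or may not be
    adjacent; both diagrams are treated together.\<close>
  define \<delta> :: int where "\<delta> = (if adj t t' then 1 else 0)"
  have adj': "adj t e" "adj t' e" "adj t d" "adj t' d" "\<not> adj d e" "adj t' t \<longleftrightarrow> adj t t'" using adj adj_sym by auto
  have sum: "(\<Sum>z\<in>{z\<in>S. adj s z}. V' a b x y z) = (\<Sum>z\<in>{z\<in>{e, d, t, t'}. adj s z}. V' a b x y z)" for s a b x y
    by (rule sum.mono_neutral_right) (use finite_S C in \<open>auto simp: V'_def\<close>)
  have set: "{z\<in>{e, d, t, t'}. adj e z} = {t, t'}" "{z\<in>{e, d, t, t'}. adj d z} = {t, t'}"
     "{z\<in>{e, d, t, t'}. adj t z} = (if adj t t' then {e, d, t'} else {e, d})"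
     "{z\<in>{e, d, t, t'}. adj t' z} = (if adj t t' then {e, d, t} else {e, d})"
    using adj adj' by auto
  have sums: "(\<Sum>z\<in>{z\<in>S. adj e z}. V' a b x y z) = x + y" "(\<Sum>z\<in>{z\<in>S. adj d z}. V' a b x y z) = x + y"
    "(\<Sum>z\<in>{z\<in>S. adj t z}. V' a b x y z) = a + b + \<delta> * y" "(\<Sum>z\<in>{z\<in>S. adj t' z}. V' a b x y z) = a + b + \<delta> * x" for a b x y
    unfolding sum set using C ne by (simp_all add: V'_def \<delta>_def)
  have val: "V' a b x y e = a" "V' a b x y d = b" "V' a b x y t = x" "V' a b x y t' = y" for a b x y
    using ne C(5,6) by (auto simp: V'_def)
  have upd: "(V' a b x y)(e := c) = V' c b x y" "(V' a b x y)(d := c) = V' a c x y"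
    "(V' a b x y)(t := c) = V' a b c y" "(V' a b x y)(t' := c) = V' a b x c" for a b x y c
    by (rule ext, use ne C(5,6) in \<open>simp add: V'_def\<close>)+
  have fires: "gen_fire e (V' a b x y) = V' (x + y - a) b x y" "gen_fire d (V' a b x y) = V' a (x + y - b) x y"
    "gen_fire t (V' a b x y) = V' a b (a + b + \<delta> * y - x) y" "gen_fire t' (V' a b x y) = V' a b x (a + b + \<delta> * x - y)" for a b x y
    using edge by (simp_all only: gen_fire_def fire_def sums val upd if_True)
  let ?ws = "[e, d, t, t']"
  have "set ?ws \<subseteq> S" using C by auto
  then obtain N where N: "N > 0" "hom_eval gen_fire ?ws ^^ N = id"
    using hom_eval_finite_order[of gen_fire ?ws] gen_fire_fire fire_relation by blast
  \<comment> \<open>Invariant that makes the common value \<open>a\<close> at \<open>e\<close> and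
    \<open>d\<close> grow in each round. Without the diagonal, \<open>t\<close> and
    \<open>t'\<close> both hold \<open>a - 1\<close> and \<open>a\<close> increases by 2; with it,
    the inequalities make the new value at least \<open>3 * a\<close>.\<close>
  define good where "good a x y \<longleftrightarrow> (if adj t t' then 0 \<le> y \<and> y \<le> x \<and> x \<le> 2 * a else x = a - 1 \<and> y = a - 1)" for a x y :: int
  have step: "\<exists>a' x' y'. hom_eval gen_fire ?ws (V' a a x y) = V' a' a' x' y' \<and> a' > a \<and> good a' x' y'" 
    if "a \<ge> 1" "good a x y" for a x y
  proof -
    define y' where "y' = a + a + \<delta> * x - y"
    define x' where "x' = a + a + \<delta> * y' - x"
    define a' where "a' = x' + y' - a"
    have "hom_eval gen_fire ?ws (V' a a x y) = V' a' a' x' y'"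
      by (simp add: fires y'_def x'_def a'_def)
    moreover have "a' > a \<and> good a' x' y'"
      using that unfolding a'_def x'_def y'_def good_def \<delta>_def by (auto split: if_splits)
    ultimately show ?thesis by blast
  qed
  define G where "G = hom_eval gen_fire ?ws"
  have "\<exists>a x y. (G ^^ k) (V' 1 1 0 0) = V' a a x y \<and> a \<ge> 1 \<and> (k > 0 \<longrightarrow> a > 1) \<and> good a x y" for k
  proof (induction k)
    case 0
    show ?case by (rule exI[of _ 1], rule exI[of _ 0], rule exI[of _ 0]) (simp add: good_def)
  next
    case (Suc k)
    then obtain a x y where IH: "(G ^^ k) (V' 1 1 0 0) = V' a a x y" "a \<ge> 1" "good a x y" by blast
    obtain a' x' y' where "G (V' a a x y) = V' a' a' x' y'" "a' > a" "good a' x' y'"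
      using step[OF IH(2,3)] unfolding G_def by blast
    then show ?case using IH by (intro exI[of _ a'] exI[of _ x'] exI[of _ y']) simp
  qed
  then obtain a x y where "V' 1 1 0 0 = V' a a x y" "a > 1" using N unfolding G_def by (metis id_apply)
  then have "V' 1 1 0 0 e = V' a a x y e" by simp
  then show False using \<open>a > 1\<close> by (simp add: V'_def)
qed

text \<open>An edge meeting a doubled pair shares exactly one line with it and hence is adjacent to
  both members of the pair, which commute with each other. Two such edges \<open>t\<close> and
  \<open>t'\<close> would form the forbidden cycle.\<close>

lemma double_edge_neighbours:
  assumes pq: "p \<in> spts n" "q \<in> spts n" "\<bar>p\<bar> \<noteq> \<bar>q\<bar>" and e: "sref p q \<in> S" and d: "sref p (- q) \<in> S"
    and t: "t \<in> S" "t' \<in> S" "is_edge t" "is_edge t'" "t \<notin> {sref p q, sref p (- q)}" "t' \<notin> {sref p q, sref p (- q)}"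
    and moved: "t p \<noteq> p \<or> t q \<noteq> q" "t' p \<noteq> p \<or> t' q \<noteq> q"
  shows "t = t'"
proof (rule ccontr)
  assume ne: "t \<noteq> t'"
  have nz: "p \<noteq> 0" "q \<noteq> 0" using pq spts_nonzero by auto
  have edges: "is_edge (sref p q)" "is_edge (sref p (- q))" using pq nz by (simp_all add: is_edge_sref)
  have adj: "adj (sref p r) u" if u: "u \<in> S" "is_edge u" "u \<notin> {sref p q, sref p (- q)}" "u p \<noteq> p \<or> u q \<noteq> q" and r: "r = q \<or> r = - q" for u r
  proof -
    have uW: "u \<in> Wn n" using S_Wn u by blast
    have "u p = p \<or> u q = q" using refls_fixes_cases[of u n p q] S_refls u pq by blast
    then have "u p = p \<and> u r \<noteq> r \<or> u p \<noteq> p \<and> u r = r" using u(4) r Wn_uminus[OF uW, of q] by auto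
    moreover have "sref p r (u p) \<noteq> u (sref p r p)" if "u p = p" "u r \<noteq> r" using that by simp
    moreover have "sref p r (u r) \<noteq> u (sref p r r)" if "u p \<noteq> p" "u r = r" using that by simp
    ultimately have "sref p r \<circ> u \<noteq> u \<circ> sref p r" by (metis comp_apply)
    then show ?thesis using edges u r by (auto simp: adj_def)
  qed
  have "\<not> adj (sref p q) (sref p (- q))" using sref_parallel_commute[OF nz pq(3)] by (simp add: adj_def)
  moreover have "sref p q \<noteq> sref p (- q)" using sref_uminus_right_ne[OF nz(2)] by metis
  ultimately show False
    using no_diagram_cycle[OF e d t(1,2) _ ne] adj[of t q] adj[of t "- q"] adj[of t' q] adj[of t' "- q"] t moved by blast
qed

end

section \<open>Orbits of products of reflections\<close>

definition opow :: "('a \<Rightarrow> 'a) \<Rightarrow> ('a \<times> 'a) set" where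
  "opow f = {(x, y). \<exists>k. (f ^^ k) x = y}"

lemma opowI: "(f ^^ k) x = y \<Longrightarrow> (x, y) \<in> opow f"
  by (auto simp: opow_def)

lemma opow_refl [simp]: "(x, x) \<in> opow f"
  by (rule opowI[of 0]) simp

lemma opow_trans: "(x, y) \<in> opow f \<Longrightarrow> (y, z) \<in> opow f \<Longrightarrow> (x, z) \<in> opow f"
  unfolding opow_def by clarsimp (metis comp_apply funpow_add)

lemma opow_step: "(x, f x) \<in> opow f"
  by (rule opowI[of 1]) simp

lemma opow_subset:
  assumes "\<And>x. (x, f x) \<in> opow g"
  shows "opow f \<subseteq> opow g"
proof -
  have "(x, (f ^^ k) x) \<in> opow g" for x k
  proof (induction k)
    case (Suc k)
    then show ?case using opow_trans[OF _ assms[of "(f ^^ k) x"]] by simp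
  qed simp
  then show ?thesis by (auto simp: opow_def)
qed

lemma opow_sym:
  assumes "f permutes A" "finite A" "(x, y) \<in> opow f"
  shows "(y, x) \<in> opow f"
proof -
  obtain k where k: "(f ^^ k) x = y" using assms(3) by (auto simp: opow_def)
  obtain N where N: "N > 0" "f ^^ N = id" using permutes_finite_order[OF assms(1,2)] by blast
  have "(f ^^ (k * (N - 1))) y = (f ^^ (k * (N - 1) + k)) x" using k by (simp add: funpow_add)
  also have "k * (N - 1) + k = N * k" using N(1) by (cases N) auto
  also have "(f ^^ (N * k)) x = x" using N(2) by (simp flip: funpow_mult)
  finally show ?thesis by (rule opowI)
qed

text \<open>Follow \<open>f\<close> from \<open>a\<close>. Until the first return to
  \<open>a\<close> neither \<open>a\<close> nor \<open>b\<close> is hit, so the transposition is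
  invisible; at the return it redirects the path to \<open>b\<close>.\<close>

lemma transpose_orbit:
  assumes f: "f permutes A" "finite A" and ab: "(a, b) \<notin> opow f"
  shows "(a, b) \<in> opow (transpose a b \<circ> f)"
proof -
  define m where "m = (LEAST m. m > 0 \<and> (f ^^ m) a = a)"
  obtain N where "N > 0" "f ^^ N = id" using permutes_finite_order[OF f] by blast
  then have "N > 0 \<and> (f ^^ N) a = a" by simp
  then have m: "m > 0 \<and> (f ^^ m) a = a" unfolding m_def by (rule LeastI)
  have least: "(f ^^ r) a \<noteq> a" if "0 < r" "r < m" for r
    using not_less_Least[of r "\<lambda>m. m > 0 \<and> (f ^^ m) a = a"] that by (simp add: m_def)
  have nb: "(f ^^ r) a \<noteq> b" for r using ab by (auto simp: opow_def)
  have "((transpose a b \<circ> f) ^^ r) a = (f ^^ r) a" if "r < m" for r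
    using that
  proof (induction r)
    case (Suc r)
    then show ?case using least[of "Suc r"] nb[of "Suc r"] by simp
  qed simp
  moreover obtain m' where "m = Suc m'" using m by (cases m) auto
  ultimately have "((transpose a b \<circ> f) ^^ m) a = transpose a b ((f ^^ m) a)" by simp
  then show ?thesis using m by (intro opowI[of m]) simp
qed

lemma transpose_opow:
  assumes f: "f permutes A" "finite A" and ab: "(a, b) \<notin> opow f" and A: "a \<in> A" "b \<in> A"
  shows "opow f \<subseteq> opow (transpose a b \<circ> f)"
proof (rule opow_subset)
  fix x
  let ?g = "transpose a b \<circ> f"
  have g: "?g permutes A" using f(1) permutes_swap_id[OF A] by (intro permutes_compose) auto
  have 1: "(a, b) \<in> opow ?g" by (rule transpose_orbit[OF f ab])
  then have 2: "(b, a) \<in> opow ?g" by (rule opow_sym[OF g f(2)])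
  have "(x, ?g x) \<in> opow ?g" by (rule opow_step)
  moreover have "f x = a \<Longrightarrow> ?g x = b" "f x = b \<Longrightarrow> ?g x = a" "f x \<noteq> a \<Longrightarrow> f x \<noteq> b \<Longrightarrow> ?g x = f x"
    by auto
  ultimately show "(x, f x) \<in> opow ?g" using 1 2 opow_trans by metis
qed

lemma opow_uminus:
  assumes "f \<in> Wn n" "(x, y) \<in> opow f"
  shows "(- x, - y) \<in> opow f"
proof -
  obtain k where "(f ^^ k) x = y" using assms by (auto simp: opow_def)
  then have "(f ^^ k) (- x) = - y" using Wn_uminus[OF funpow_Wn[OF assms(1)]] by simp
  then show ?thesis by (rule opowI)
qed

text \<open>Off the diagonal case, \<open>sref i j\<close> is the product of the transpositions of
  \<open>- i\<close>, \<open>- j\<close> and of \<open>i\<close>, \<open>j\<close>. The hypotheses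
  ensure that each of them joins two different cycles at the moment when it is applied.\<close>

lemma sref_opow_merge:
  assumes f: "f \<in> Wn n" and ij: "i \<in> spts n" "j \<in> spts n" "i \<noteq> j"
    and h1: "(i, j) \<notin> opow f"
    and h2: "j \<noteq> - i \<Longrightarrow> (i, - j) \<notin> opow f"
    and h3: "j \<noteq> - i \<Longrightarrow> (i, - i) \<in> opow f \<Longrightarrow> (j, - j) \<notin> opow f"
  shows "opow f \<subseteq> opow (sref i j \<circ> f)" "(i, j) \<in> opow (sref i j \<circ> f)"
proof -
  have fp: "f permutes spts n" using f by (rule Wn_permutes)
  have "opow f \<subseteq> opow (sref i j \<circ> f) \<and> (i, j) \<in> opow (sref i j \<circ> f)"
  proof (cases "j = - i")
    case True
    have "sref i j = transpose i j" using sref_half_eq_transpose True by simp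
    then show ?thesis
      using transpose_opow[OF fp _ h1 ij(1,2)] transpose_orbit[OF fp _ h1] by simp
  next
    case False
    have nz: "i \<noteq> 0" "j \<noteq> 0" using ij spts_nonzero by auto
    let ?g = "transpose (- i) (- j) \<circ> f"
    have neg: "(- i, - j) \<notin> opow f" using h1 opow_uminus[OF f, of "- i" "- j"] by auto
    have g1: "opow f \<subseteq> opow ?g" by (rule transpose_opow[OF fp _ neg]) (use ij in auto)
    have gp: "?g permutes spts n" using ij by (intro permutes_compose[OF fp] permutes_swap_id) auto
    \<comment> \<open>An invariant set that contains the cycle of \<open>i\<close> after
      \<open>- i\<close> and \<open>- j\<close> have been joined: this cycle grows only if it passes
      through \<open>- i\<close>, and then it absorbs the cycle of \<open>- j\<close>. The
      hypotheses \<open>h1\<close> and \<open>h3\<close> keep \<open>j\<close> outside, so the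
      second transposition joins cycles as well.\<close>
    define T where "T = (if (i, - i) \<in> opow f then {x. (i, x) \<in> opow f \<or> (- j, x) \<in> opow f} else {x. (i, x) \<in> opow f})"
    have closed: "?g x \<in> T" if "x \<in> T" for x
    proof -
      have fx: "f x \<in> T" using that opow_trans[OF _ opow_step[of _ f]] by (auto simp: T_def split: if_splits)
      show ?thesis
      proof (cases "(i, - i) \<in> opow f")
        case True
        have "- i \<in> T" "- j \<in> T" using True by (auto simp: T_def)
        then show ?thesis using fx by (auto simp: transpose_def)
      next
        case F: False
        then have "f x \<noteq> - i" "f x \<noteq> - j" using fx h2[OF False] by (auto simp: T_def)
        then show ?thesis using fx by (simp add: transpose_def)
      qed
    qed
    have "(?g ^^ k) i \<in> T" for k
    proof (induction k)
      case (Suc k)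
      then show ?case using closed by simp
    qed (simp add: T_def)
    moreover have "j \<notin> T"
      using h1 h3[OF False] opow_uminus[OF f, of "- j" j] by (auto simp: T_def)
    ultimately have "(?g ^^ k) i \<noteq> j" for k by metis
    then have h1': "(i, j) \<notin> opow ?g" by (simp add: opow_def)
    have "sref i j \<circ> f = transpose i j \<circ> ?g"
      using sref_eq_transpose[OF nz] ij(3) False by (simp add: o_assoc abs_eq_iff)
    then show ?thesis
      using g1 transpose_opow[OF gp _ h1' ij(1,2)] transpose_orbit[OF gp _ h1'] by auto
  qed
  then show "opow f \<subseteq> opow (sref i j \<circ> f)" "(i, j) \<in> opow (sref i j \<circ> f)" by auto
qed

text \<open>If the reflections are multiplied one after the other, each new one merges orbits.\<close>

definition merging :: "nat \<Rightarrow> (int \<Rightarrow> int) set \<Rightarrow> bool" where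
  "merging n S \<longleftrightarrow> (\<forall>i\<in>spts n. \<forall>j\<in>spts n. i \<noteq> j \<longrightarrow> sref i j \<in> S \<longrightarrow>
     (i, j) \<notin> reach (S - {sref i j}) \<and>
     (j \<noteq> - i \<longrightarrow> (i, - j) \<notin> reach (S - {sref i j}) \<and>
       \<not> ((i, - i) \<in> reach (S - {sref i j}) \<and> (j, - j) \<in> reach (S - {sref i j}))))"

lemma merging_mono:
  assumes "merging n S" "T \<subseteq> S"
  shows "merging n T"
proof -
  have "reach (T - {s}) \<subseteq> reach (S - {s})" for s using assms(2) by (intro reach_mono) blast
  then show ?thesis using assms unfolding merging_def by blast
qed

lemma opow_evalw_subset_reach: "set ws \<subseteq> S \<Longrightarrow> opow (evalw ws) \<subseteq> reach S"
proof clarify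
  fix x y assume ws: "set ws \<subseteq> S" and "(x, y) \<in> opow (evalw ws)"
  then obtain k where "(evalw ws ^^ k) x = y" by (auto simp: opow_def)
  moreover have "(x, (evalw ws ^^ k) x) \<in> reach S"
  proof (induction k)
    case (Suc k)
    then show ?case using reach_trans[OF _ reach_evalw[OF ws, of "(evalw ws ^^ k) x"]] by simp
  qed simp
  ultimately show "(x, y) \<in> reach S" by simp
qed

text \<open>The orbits of the partial product stay inside the components of the letters already
  used, so \<open>merging\<close> provides the hypotheses of \<open>sref_opow_merge\<close> for each
  new letter. The order of the letters is irrelevant to this.\<close>

lemma reach_subset_opow_evalw:
  assumes "distinct ws" "set ws \<subseteq> refls n" "merging n (set ws)"
  shows "reach (set ws) \<subseteq> opow (evalw ws)"
  using assms
proof (induction ws)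
  case Nil
  then show ?case by (auto simp: reach_def)
next
  case (Cons s ws)
  let ?f = "evalw ws" and ?g = "evalw (s # ws)"
  have sub: "set ws \<subseteq> refls n" using Cons.prems by simp
  have IH: "reach (set ws) \<subseteq> opow ?f"
    using Cons merging_mono[OF Cons.prems(3), of "set ws"] by auto
  have fr: "opow ?f \<subseteq> reach (set ws)" by (rule opow_evalw_subset_reach) simp
  have fW: "?f \<in> Wn n" using sub refls_Wn by (intro evalw_in_subgroup[OF is_subgroup_Wn]) auto
  obtain i j where s: "s = sref i j" "i \<in> spts n" "j \<in> spts n" "i \<noteq> j"
    using Cons.prems(2) by (auto elim: reflsE)
  have diff: "set (s # ws) - {s} = set ws" using Cons.prems(1) by auto
  have "s \<in> set (s # ws)" by simp
  note M = Cons.prems(3)[unfolded merging_def, THEN bspec, OF s(2), THEN bspec, OF s(3), THEN mp, OF s(4),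
      THEN mp, folded s(1), OF this, unfolded diff]
  have q: "(i, j) \<notin> opow ?f" "j \<noteq> - i \<Longrightarrow> (i, - j) \<notin> opow ?f"
    "j \<noteq> - i \<Longrightarrow> (i, - i) \<in> opow ?f \<Longrightarrow> (j, - j) \<notin> opow ?f"
    using M fr by blast+
  have g: "?g = sref i j \<circ> ?f" using s by simp
  have gW: "?g \<in> Wn n" unfolding g by (rule comp_Wn[OF sref_Wn[OF s(2,3)] fW])
  note gsym = opow_sym[OF Wn_permutes[OF gW] finite_spts]
  have merge: "opow ?f \<subseteq> opow ?g" "(i, j) \<in> opow ?g"
    unfolding g by (rule sref_opow_merge[OF fW s(2-4) q], assumption+)+
  have m: "(i, j) \<in> opow ?g" "(j, i) \<in> opow ?g" "(- i, - j) \<in> opow ?g" "(- j, - i) \<in> opow ?g"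
    using merge(2) gsym opow_uminus[OF gW] by blast+
  have step: "(y, t y) \<in> opow ?g" if "t \<in> set (s # ws)" for t y
  proof (cases "t = s")
    case True
    show ?thesis
    proof (cases "s y = y")
      case False
      then show ?thesis using sref_moves[of i j y] m unfolding True s(1) by metis
    qed (use True in simp)
  next
    case False
    then have "(y, t y) \<in> reach (set ws)" using that by (intro reach_step) simp
    then show ?thesis using IH merge(1) by blast
  qed
  show ?case
  proof clarify
    fix x y assume "(x, y) \<in> reach (set (s # ws))"
    then show "(x, y) \<in> opow ?g"
      unfolding reach_def
    proof (induction rule: rtrancl_induct)
      case (step y z)
      then obtain t where "t \<in> set (s # ws)" "z = t y" by blast
      then show ?case using step.IH opow_trans \<open>\<And>y t. t \<in> set (s # ws) \<Longrightarrow> (y, t y) \<in> opow ?g\<close> by metis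
    qed simp
  qed
qed

lemma line_cycle_opow: "line_cycle w i = abs ` {y. (i, y) \<in> opow w}"
  by (auto simp: line_cycle_def opow_def)

lemma line_cycle_uminus:
  assumes "w \<in> Wn n"
  shows "line_cycle w (- i) = line_cycle w i"
  unfolding line_cycle_def using Wn_uminus[OF funpow_Wn[OF assms]] by simp

lemma line_cycle_abs:
  assumes "w \<in> Wn n"
  shows "line_cycle w \<bar>i\<bar> = line_cycle w i"
  using line_cycle_uminus[OF assms] by (simp add: abs_if)

lemma line_cycle_cong:
  assumes w: "w \<in> Wn n" and j: "j \<in> line_cycle w i"
  shows "line_cycle w j = line_cycle w i"
proof -
  obtain y where y: "(i, y) \<in> opow w" "j = \<bar>y\<bar>" using j by (auto simp: line_cycle_opow)
  have yi: "(y, i) \<in> opow w" by (rule opow_sym[OF Wn_permutes[OF w] finite_spts y(1)])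
  have "{z. (y, z) \<in> opow w} = {z. (i, z) \<in> opow w}"
    using opow_trans[OF y(1)] opow_trans[OF yi] by blast
  then show ?thesis using line_cycle_abs[OF w] y(2) by (simp add: line_cycle_opow)
qed

text \<open>The product of the signs of \<open>w\<close> along a line cycle is the sign of the point
  in which the path from \<open>i\<close> first returns to the line of \<open>i\<close>. That point
  is \<open>- i\<close>, hence the number of sign changes is odd.\<close>

lemma neg_line_cycle:
  assumes w: "w \<in> Wn n" and i: "i > 0" and neg: "(i, - i) \<in> opow w"
  shows "neg_cycle w (line_cycle w i)"
proof -
  define a where "a r = (w ^^ r) i" for r
  have aSuc: "a (Suc r) = w (a r)" for r by (simp add: a_def)
  have a0: "a 0 = i" by (simp add: a_def)
  define m where "m = (LEAST m. m > 0 \<and> \<bar>a m\<bar> = i)"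
  obtain N where "N > 0" "w ^^ N = id" using Wn_finite_order[OF w] by blast
  then have "N > 0 \<and> \<bar>a N\<bar> = i" using i by (simp add: a_def)
  then have m: "m > 0 \<and> \<bar>a m\<bar> = i" unfolding m_def by (rule LeastI)
  have least: "\<bar>a r\<bar> \<noteq> i" if "0 < r" "r < m" for r
    using not_less_Least[of r "\<lambda>m. m > 0 \<and> \<bar>a m\<bar> = i"] that by (simp add: m_def)
  have shift: "\<bar>a (r + k)\<bar> = \<bar>a (s + k)\<bar> \<longleftrightarrow> \<bar>a r\<bar> = \<bar>a s\<bar>" for r s k
    using Wn_abs_eq_iff[OF funpow_Wn[OF w, of k], of "a r" "a s"]
    by (simp add: a_def add.commute[of _ k] funpow_add)
  have inj: "inj_on (\<lambda>r. \<bar>a r\<bar>) {..<m}"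
  proof (rule linorder_inj_onI)
    fix r s assume "r < s" "r \<in> {..<m}" "s \<in> {..<m}"
    moreover from this have "\<bar>a (s - r)\<bar> \<noteq> i" by (intro least) auto
    ultimately show "\<bar>a r\<bar> \<noteq> \<bar>a s\<bar>" using shift[of 0 r "s - r"] a0 i by simp
  qed auto
  have period: "\<bar>a (r + m * q)\<bar> = \<bar>a r\<bar>" for r q
  proof (induction q)
    case (Suc q)
    have "\<bar>a (m + (r + m * q))\<bar> = \<bar>a (0 + (r + m * q))\<bar>" unfolding shift using m a0 i by simp
    then show ?case using Suc by (simp add: algebra_simps)
  qed simp
  have cyc: "line_cycle w i = (\<lambda>r. \<bar>a r\<bar>) ` {..<m}"
  proof
    show "line_cycle w i \<subseteq> (\<lambda>r. \<bar>a r\<bar>) ` {..<m}"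
    proof
      fix x assume "x \<in> line_cycle w i"
      then obtain k where "x = \<bar>a k\<bar>" by (auto simp: line_cycle_def a_def)
      then have "x = \<bar>a (k mod m)\<bar>" using period[of "k mod m" "k div m"] by simp
      then show "x \<in> (\<lambda>r. \<bar>a r\<bar>) ` {..<m}" using m by auto
    qed
  qed (auto simp: line_cycle_def a_def)
  have sgn: "sgn (a r) = (\<Prod>s<r. sgn (w \<bar>a s\<bar>))" for r
  proof (induction r)
    case (Suc r)
    have "sgn (w y) = sgn y * sgn (w \<bar>y\<bar>)" for y
      using Wn_uminus[OF w, of y] Wn_zero_iff[OF w, of 0] by (auto simp: abs_if sgn_if)
    from this[of "a r"] show ?case using Suc by (simp only: aSuc prod.lessThan_Suc)
  qed (use a0 i in simp)
  have P: "(\<Prod>j\<in>line_cycle w i. sgn (w j)) = sgn (a m)"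
    unfolding cyc sgn by (simp add: prod.reindex[OF inj])
  \<comment> \<open>A first return to \<open>i\<close> itself would make the sequence periodic
    without ever meeting \<open>- i\<close>.\<close>
  have am: "a m \<noteq> i"
  proof
    assume am: "a m = i"
    have period': "a (r + m * q) = a r" for r q
    proof (induction q)
      case (Suc q)
      have "a (r + m * q + m) = (w ^^ (r + m * q)) (a m)" by (simp add: a_def funpow_add)
      then have "a (r + m * q + m) = a (r + m * q)" using am by (simp add: a_def)
      then show ?case using Suc by (simp add: algebra_simps)
    qed simp
    obtain k where k: "a k = - i" using neg by (auto simp: opow_def a_def)
    then have "a (k mod m) = - i" using period'[of "k mod m" "k div m"] by simp
    moreover have "k mod m < m" using m by simp
    ultimately show False using least[of "k mod m"] a0 i by (cases "k mod m = 0") auto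
  qed
  then have "sgn (a m) \<noteq> 1" using m i by (auto simp: sgn_if split: if_splits)
  moreover have "finite (line_cycle w i)" unfolding cyc by simp
  moreover have "w j \<noteq> 0" if "j \<in> line_cycle w i" for j
  proof -
    have "a r \<noteq> 0" for r using Wn_zero_iff[OF funpow_Wn[OF w, of r], of i] i by (simp add: a_def)
    then have "j \<noteq> 0" using that unfolding cyc by auto
    then show ?thesis using Wn_zero_iff[OF w] by simp
  qed
  ultimately show ?thesis
    unfolding neg_cycle_def using even_neg_iff[of "line_cycle w i" w] P by simp
qed

section \<open>Cycle types of Coxeter elements\<close>

text \<open>Generators may be removed or replaced as long as each step can be imitated up to sign;
  connectivity of lines then persists, while signs are lost.\<close>

lemma reach_modify:
  assumes "T \<subseteq> refls n" and "\<And>s x. s \<in> S \<Longrightarrow> (x, s x) \<in> reach T \<or> (x, - s x) \<in> reach T"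
    and "(x, y) \<in> reach S"
  shows "(x, y) \<in> reach T \<or> (x, - y) \<in> reach T"
  using assms(3) unfolding reach_def[of S]
proof (induction rule: rtrancl_induct)
  case (step y z)
  then obtain s where s: "s \<in> S" "z = s y" by blast
  have "(y, z) \<in> reach T \<or> (y, - z) \<in> reach T" using assms(2) s by blast
  then have "(- y, - z) \<in> reach T \<or> (- y, z) \<in> reach T"
    using reach_uminus_iff[OF assms(1)] by blast
  then show ?case using step.IH reach_trans \<open>(y, z) \<in> reach T \<or> (y, - z) \<in> reach T\<close> by metis
qed simp

text \<open>A sign reversal available at one point of a component can be transported to every other
  point: go there, reverse, and return along the negated path.\<close>

lemma reach_flip:
  assumes T: "T \<subseteq> refls n" and "(z, - z) \<in> reach T" "(x, z) \<in> reach T \<or> (x, - z) \<in> reach T"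
  shows "(x, - x) \<in> reach T"
proof -
  have *: "(x, - x) \<in> reach T" if "(x, z) \<in> reach T" "(z, - z) \<in> reach T" for z
  proof -
    have "(- z, - x) \<in> reach T" using that reach_sym[OF T] reach_uminus[OF T] by blast
    then show ?thesis using that reach_trans by blast
  qed
  have "(- z, - (- z)) \<in> reach T" using reach_uminus[OF T assms(2)] .
  then show ?thesis using * assms(2,3) by blast
qed

locale coxeter_blocks = blocks n A B D + coxeter_generators n "Wstr n A B D" S
  for n :: nat and A B D :: "int set set" and S :: "(int \<Rightarrow> int) set"
begin

lemma S_W: "s \<in> S \<Longrightarrow> s \<in> W"
  using gen_superset[of S n] gen_S by blast

lemma reach_S_iff: "(x, y) \<in> reach S \<longleftrightarrow> y \<in> orb W x"
proof
  assume "(x, y) \<in> reach S"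
  then obtain vs where "set vs \<subseteq> S" "evalw vs x = y" using reach_imp_evalw by blast
  then show "y \<in> orb W x" using gen_evalw[OF S_refls] gen_S unfolding orb_def by blast
next
  assume "y \<in> orb W x"
  then have "y \<in> orb {evalw vs | vs. set vs \<subseteq> S} x" using gen_evalw[OF S_refls] gen_S by simp
  then obtain vs where "set vs \<subseteq> S" "y = evalw vs x" unfolding orb_def by blast
  then show "(x, y) \<in> reach S" using reach_evalw by blast
qed

lemma reach_in_block:
  assumes "C \<in> A \<union> B \<union> D" "\<bar>x\<bar> \<in> C" "\<bar>y\<bar> \<in> C"
  shows "(x, y) \<in> reach S \<or> (x, - y) \<in> reach S"
proof -
  have "\<bar>y\<bar> \<in> abs ` orb W x" using orb_W_abs[OF assms(1,2)] assms(3) by simp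
  then obtain z where "z \<in> orb W x" "\<bar>y\<bar> = \<bar>z\<bar>" by blast
  then have "y \<in> orb W x \<or> - y \<in> orb W x" by (metis abs_eq_iff minus_minus)
  then show ?thesis by (simp add: reach_S_iff)
qed

lemma reach_uminus_self_iff:
  assumes "C \<in> A \<union> B \<union> D" "\<bar>x\<bar> \<in> C"
  shows "(x, - x) \<in> reach S \<longleftrightarrow> C \<notin> A"
  unfolding reach_S_iff by (rule uminus_in_orb_W[OF assms])

lemma reach_in_block':
  assumes "C \<in> B \<union> D" "\<bar>x\<bar> \<in> C" "\<bar>y\<bar> \<in> C"
  shows "(x, y) \<in> reach S"
proof -
  have C: "C \<in> A \<union> B \<union> D" "C \<notin> A" using assms(1) types by auto
  have "(- x, x) \<in> reach S" 
    using reach_uminus_self_iff[OF C(1), of "- x"] assms C by simp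
  then show ?thesis using reach_in_block[OF C(1) assms(2,3)] reach_trans reach_uminus_iff(2)[OF S_refls] by blast
qed

definition restrict :: "int set \<Rightarrow> (int \<Rightarrow> int) set" where
  "restrict C = {s \<in> S. \<exists>x. \<bar>x\<bar> \<in> C \<and> s x \<noteq> x}"

lemma restrict_ends:
  assumes "C \<in> A \<union> B \<union> D" "sref i j \<in> restrict C"
  shows "\<bar>i\<bar> \<in> C" "\<bar>j\<bar> \<in> C"
proof -
  obtain x where x: "\<bar>x\<bar> \<in> C" "sref i j x \<noteq> x" using assms(2) by (auto simp: restrict_def)
  have "\<bar>sref i j x\<bar> \<in> C" using W_block[OF S_W assms(1)] assms(2) x by (simp add: restrict_def)
  then show "\<bar>i\<bar> \<in> C" "\<bar>j\<bar> \<in> C" using sref_moves[OF x(2)] x(1) by auto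
qed

lemma evalw_restrict:
  assumes "C \<in> A \<union> B \<union> D" "set vs \<subseteq> S" "\<bar>x\<bar> \<in> C"
  shows "evalw (filter (\<lambda>s. s \<in> restrict C) vs) x = evalw vs x \<and> \<bar>evalw vs x\<bar> \<in> C"
  using assms(2)
proof (induction vs)
  case (Cons s vs)
  then have "\<bar>evalw vs x\<bar> \<in> C" "s \<in> S" by auto
  moreover from this have "s \<notin> restrict C \<Longrightarrow> s (evalw vs x) = evalw vs x" by (auto simp: restrict_def)
  moreover have "\<bar>s (evalw vs x)\<bar> \<in> C" using W_block[OF S_W assms(1)] calculation by blast
  ultimately show ?case using Cons by simp
qed (use assms in simp)

lemma opow_restrict:
  assumes C: "C \<in> A \<union> B \<union> D" "set vs \<subseteq> S" "\<bar>x\<bar> \<in> C"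
    and "(x, y) \<in> opow (evalw (filter (\<lambda>s. s \<in> restrict C) vs))"
  shows "(x, y) \<in> opow (evalw vs)"
proof -
  obtain k where k: "(evalw (filter (\<lambda>s. s \<in> restrict C) vs) ^^ k) x = y" using assms(4) by (auto simp: opow_def)
  have "(evalw (filter (\<lambda>s. s \<in> restrict C) vs) ^^ k) x = (evalw vs ^^ k) x \<and> \<bar>(evalw vs ^^ k) x\<bar> \<in> C" for k
    by (induction k) (use C evalw_restrict[OF C(1,2)] in auto)
  then show ?thesis using k by (intro opowI[of k]) simp
qed

lemma reach_restrict:
  assumes C: "C \<in> A \<union> B \<union> D" "\<bar>x\<bar> \<in> C" and T: "T \<subseteq> S" and "(x, y) \<in> reach T"
  shows "(x, y) \<in> reach (T \<inter> restrict C)"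
proof -
  have "(x, y) \<in> reach (T \<inter> restrict C) \<and> \<bar>y\<bar> \<in> C"
    using assms(4) unfolding reach_def[of T]
  proof (induction rule: rtrancl_induct)
    case (step y z)
    then obtain s where s: "s \<in> T" "z = s y" by blast
    have y: "\<bar>y\<bar> \<in> C" "(x, y) \<in> reach (T \<inter> restrict C)" using step.IH by auto
    have sS: "s \<in> S" using s T by blast
    have "\<bar>z\<bar> \<in> C" using W_block[OF S_W[OF sS] C(1)] y s by simp
    moreover have "(y, z) \<in> reach (T \<inter> restrict C)"
    proof (cases "s y = y")
      case False
      then have "s \<in> T \<inter> restrict C" using s sS y by (auto simp: restrict_def)
      then show ?thesis using reach_step s by blast
    qed (use s in simp)
    ultimately show ?case using y reach_trans by blast
  qed (use C in simp)
  then show ?thesis by simp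
qed

text \<open>The three parts of \<open>merging\<close> are the cycles excluded by the affine action.
  The second one, a bypass with reversed sign, is excluded only when the partner edge is absent,
  whence the hypothesis on doubled edges.\<close>

lemma mergingI:
  assumes T: "T \<subseteq> S"
    and no_double: "\<And>i j. i \<in> spts n \<Longrightarrow> j \<in> spts n \<Longrightarrow> \<bar>i\<bar> \<noteq> \<bar>j\<bar> \<Longrightarrow> sref i j \<in> T \<Longrightarrow> sref i (- j) \<in> T \<Longrightarrow> False"
  shows "merging n T"
  unfolding merging_def
proof (intro ballI impI conjI)
  fix i j assume ij: "i \<in> spts n" "j \<in> spts n" "i \<noteq> j" "sref i j \<in> T"
  have s: "sref i j \<in> S" using ij T by blast
  have mono: "reach (T - {sref i j}) \<subseteq> reach (S - {sref i j})" using T by (intro reach_mono) blast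
  show "(i, j) \<notin> reach (T - {sref i j})" using not_reach[OF s ij(1-3)] mono by blast
  assume "j \<noteq> - i"
  then have abs: "\<bar>i\<bar> \<noteq> \<bar>j\<bar>" using ij(3) by linarith
  have "sref i (- j) \<notin> T" using no_double ij abs by blast
  then have "T - {sref i j} \<subseteq> S - {sref i j, sref i (- j)}" using T by blast
  then show "(i, - j) \<notin> reach (T - {sref i j})" by (rule not_reach_uminus[OF s ij(1,2) abs])
  show "\<not> ((i, - i) \<in> reach (T - {sref i j}) \<and> (j, - j) \<in> reach (T - {sref i j}))"
    using not_reach_both_flips[OF s ij(1,2) abs] mono by blast
qed

text \<open>Letters belonging to other blocks fix the lines of \<open>C\<close>, so only the subword
  of letters acting on \<open>C\<close> must be merging; doubled edges in other blocks do no
  harm.\<close>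

lemma opow_of_reach:
  assumes C: "C \<in> A \<union> B \<union> D" and vs: "distinct vs" "set vs \<subseteq> S"
    and no_double: "\<And>i j. i \<in> spts n \<Longrightarrow> j \<in> spts n \<Longrightarrow> \<bar>i\<bar> \<noteq> \<bar>j\<bar> \<Longrightarrow> \<bar>i\<bar> \<in> C \<Longrightarrow>
        sref i j \<in> set vs \<Longrightarrow> sref i (- j) \<in> set vs \<Longrightarrow> False"
    and x: "\<bar>x\<bar> \<in> C" "(x, y) \<in> reach (set vs)"
  shows "(x, y) \<in> opow (evalw vs)"
proof -
  let ?vs = "filter (\<lambda>s. s \<in> restrict C) vs"
  have set: "set ?vs = set vs \<inter> restrict C" by auto
  have "merging n (set ?vs)"
  proof (rule mergingI)
    show "False" if "i \<in> spts n" "j \<in> spts n" "\<bar>i\<bar> \<noteq> \<bar>j\<bar>" "sref i j \<in> set ?vs" "sref i (- j) \<in> set ?vs" for i j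
      using that no_double[of i j] restrict_ends[OF C, of i j] unfolding set by blast
  qed (use vs set in auto)
  then have "reach (set ?vs) \<subseteq> opow (evalw ?vs)"
    using vs S_refls by (intro reach_subset_opow_evalw) auto
  moreover have "(x, y) \<in> reach (set ?vs)" unfolding set by (rule reach_restrict[OF C x(1) vs(2) x(2)])
  ultimately show ?thesis using opow_restrict[OF C vs(2) x(1)] by blast
qed

lemma double_reach_uminus:
  assumes "i \<noteq> 0" "j \<noteq> 0" "sref i j \<in> T" "sref i (- j) \<in> T"
  shows "(i, - i) \<in> reach T"
proof -
  have "(i, j) \<in> reach T" using reach_step[OF assms(3), of i] by simp
  moreover have "sref i (- j) j = - i" using assms(1,2) by (auto simp: sref_def)
  then have "(j, - i) \<in> reach T" using reach_step[OF assms(4), of j] by simp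
  ultimately show ?thesis by (rule reach_trans)
qed

lemma two_lines_card:
  assumes "C \<in> A \<union> B \<union> D" "\<bar>i\<bar> \<in> C" "\<bar>j\<bar> \<in> C" "\<bar>i\<bar> \<noteq> \<bar>j\<bar>"
  shows "card C > 1"
proof -
  have "card {\<bar>i\<bar>, \<bar>j\<bar>} \<le> card C" using assms block_finite by (intro card_mono) auto
  then show ?thesis using assms by simp
qed

lemma S_end_block:
  assumes "C \<in> A \<union> B \<union> D" "\<bar>i\<bar> \<in> C" "sref i j \<in> S"
  shows "\<bar>j\<bar> \<in> C"
  using W_block[OF S_W[OF assms(3)] assms(1), of i] assms(2) by simp

lemma no_double_A:
  assumes "C \<in> A" "\<bar>i\<bar> \<in> C" "sref i j \<in> S" "sref i (- j) \<in> S"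
  shows False
proof -
  have "\<bar>j\<bar> \<in> C" using S_end_block[of C i j] assms by blast
  then have "i \<noteq> 0" "j \<noteq> 0" using assms block_pos[of C "\<bar>i\<bar>"] block_pos[of C "\<bar>j\<bar>"] by auto
  then show False using double_reach_uminus[OF _ _ assms(3,4)] reach_uminus_self_iff[of C i] assms by blast
qed

text \<open>Without a sign change on \<open>C\<close> all generators would lie in the smaller group
  in which \<open>C\<close> has type D, but \<open>W\<close> contains the sign changes of
  \<open>C\<close>.\<close>

lemma half_edge_B:
  assumes C: "C \<in> B" "card C > 1"
  shows "\<exists>r. \<bar>r\<bar> \<in> C \<and> sref r (- r) \<in> S"
proof (rule ccontr)
  assume no: "\<not> (\<exists>r. \<bar>r\<bar> \<in> C \<and> sref r (- r) \<in> S)"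
  have CU: "C \<in> A \<union> B \<union> D" using C by blast
  have un: "A \<union> (B - {C}) \<union> (insert C D) = A \<union> B \<union> D" using C by blast
  interpret X: blocks n A "B - {C}" "insert C D"
  proof
    show "\<Union> (A \<union> (B - {C}) \<union> insert C D) = {1..int n}" unfolding un by (rule cover)
    show "{} \<notin> A \<union> (B - {C}) \<union> insert C D" unfolding un by (rule nonempty)
    show "C1 = C2" if "C1 \<in> A \<union> (B - {C}) \<union> insert C D" "C2 \<in> A \<union> (B - {C}) \<union> insert C D" "i \<in> C1" "i \<in> C2" for C1 C2 i
      using disj that unfolding un by blast
    show "A \<inter> (B - {C}) = {}" "A \<inter> insert C D = {}" "(B - {C}) \<inter> insert C D = {}" using types C by auto
    show "card C' > 1" if "C' \<in> insert C D" for C' using that D_card C by auto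
  qed
  have "S \<subseteq> X.W"
  proof
    fix s assume s: "s \<in> S"
    then obtain a b where ab: "s = sref a b" "a \<in> spts n" "b \<in> spts n" "a \<noteq> b" using S_refls by (blast elim: reflsE)
    obtain C' where C': "C' \<in> A \<union> B \<union> D" "\<bar>a\<bar> \<in> C'" using block_of[OF ab(2)] by blast
    have sW: "sref a b \<in> W" using S_W s ab by simp
    have b: "\<bar>b\<bar> \<in> C'" using W_block[OF sW C'(1), of a] C'(2) by simp
    have "sref a b \<in> X.W"
    proof (rule X.sref_in_W[OF _ C'(2) b])
      show "C' \<in> A \<union> (B - {C}) \<union> insert C D" unfolding un by (rule C'(1))
      show "a > 0 \<longleftrightarrow> b > 0" if "C' \<in> A" using W_sgn[OF sW that, of a] C'(2) by simp
      show "\<bar>a\<bar> \<noteq> \<bar>b\<bar>" if C'D: "C' \<in> insert C D"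
      proof
        assume "\<bar>a\<bar> = \<bar>b\<bar>"
        then have b: "b = - a" using ab(4) by linarith
        have "C' \<in> B" using sW sref_half_in_W[OF C'] b by simp
        then have "C' = C" using C'D types by blast
        then show False using no C'(2) s ab b by blast
      qed
    qed
    then show "s \<in> X.W" using ab by simp
  qed
  then have "W \<subseteq> X.W" using gen_least[OF X.is_subgroup_W, of S] gen_S by simp
  moreover obtain i where i: "i \<in> C" using C by fastforce
  then have "\<bar>i\<bar> \<in> C" using block_abs[OF CU] by simp
  then have "sref i (- i) \<in> W" using sref_half_in_W[OF CU] C by simp
  ultimately have "sref i (- i) \<in> X.W" by blast
  then show False using X.sref_half_in_W[of C i] \<open>\<bar>i\<bar> \<in> C\<close> C by simp
qed

text \<open>A doubled edge reverses signs without using the sign change at \<open>r\<close>.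
  Transported to \<open>r\<close>, this reversal is a path from \<open>r\<close> to
  \<open>- r\<close> bypassing that sign change.\<close>

lemma no_double_B:
  assumes C: "C \<in> B" "\<bar>i\<bar> \<in> C" and ij: "i \<in> spts n" "j \<in> spts n" "\<bar>i\<bar> \<noteq> \<bar>j\<bar>" and e: "sref i j \<in> S" "sref i (- j) \<in> S"
  shows False
proof -
  have CU: "C \<in> A \<union> B \<union> D" using C by blast
  have nz: "i \<noteq> 0" "j \<noteq> 0" using ij spts_nonzero by auto
  have jC: "\<bar>j\<bar> \<in> C" by (rule S_end_block[OF CU C(2) e(1)])
  obtain r where r: "\<bar>r\<bar> \<in> C" "sref r (- r) \<in> S" using half_edge_B[OF C(1) two_lines_card[OF CU C(2) jC ij(3)]] by blast
  have rsp: "r \<in> spts n" "r \<noteq> 0" using block_spts[OF CU r(1)] spts_nonzero by auto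
  define T where "T = S - {sref r (- r)}"
  have Tr: "T \<subseteq> refls n" using S_refls by (auto simp: T_def)
  have "is_edge (sref i j)" "is_edge (sref i (- j))" "\<not> is_edge (sref r (- r))" 
    using nz ij rsp by (simp_all add: is_edge_sref)
  then have "sref i j \<in> T" "sref i (- j) \<in> T" using e by (auto simp: T_def)
  then have "(i, - i) \<in> reach T" by (rule double_reach_uminus[OF nz])
  moreover have "(r, i) \<in> reach T \<or> (r, - i) \<in> reach T"
  proof (rule reach_modify[OF Tr])
    show "(r, i) \<in> reach S" by (rule reach_in_block'[OF _ r(1) C(2)]) (use C in blast)
    show "(x, s x) \<in> reach T \<or> (x, - s x) \<in> reach T" if "s \<in> S" for s x
    proof (cases "s = sref r (- r)")
      case True
      then have "s x = x \<or> s x = - x" by (auto simp: sref_def)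
      then show ?thesis by auto
    next
      case False
      then show ?thesis using reach_step[of s T x] that by (simp add: T_def)
    qed
  qed
  ultimately have "(r, - r) \<in> reach T" by (rule reach_flip[OF Tr])
  then show False using not_reach[OF r(2)] rsp by (simp add: T_def)
qed

lemma no_half_D:
  assumes C: "C \<in> D" "\<bar>i\<bar> \<in> C"
  shows "sref i (- i) \<notin> S"
  using sref_half_in_W[of C i] assms types S_W by blast

text \<open>The partner of the removed edge connects the same lines with opposite sign.\<close>

lemma reach_without_double_edge:
  assumes pq: "p \<in> spts n" "q \<in> spts n" "\<bar>p\<bar> \<noteq> \<bar>q\<bar>" and e: "sref p q \<in> S" "sref p (- q) \<in> S"
    and "(x, y) \<in> reach S"
  shows "(x, y) \<in> reach (S - {sref p q}) \<or> (x, - y) \<in> reach (S - {sref p q})"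
proof (rule reach_modify[OF _ _ assms(6)])
  have nz: "p \<noteq> 0" "q \<noteq> 0" using pq spts_nonzero by auto
  have d: "sref p (- q) \<in> S - {sref p q}" using e sref_uminus_right_ne[OF nz(2)] by simp
  show "S - {sref p q} \<subseteq> refls n" using S_refls by blast
  show "(x, s x) \<in> reach (S - {sref p q}) \<or> (x, - s x) \<in> reach (S - {sref p q})" if "s \<in> S" for s x
  proof (cases "s = sref p q")
    case True
    show ?thesis
    proof (cases "s x = x")
      case False
      have "sref p (- q) x = - s x"
        using sref_moves[of p q x] False nz pq(3) unfolding True by (auto simp: sref_def)
      then show ?thesis using reach_step[OF d, of x] by simp
    qed simp
  next
    case False
    then show ?thesis using reach_step[of s _ x] that by simp
  qed
qed

text \<open>A second doubled pair in the block reverses the sign at \<open>p\<close> without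
  \<open>sref p q\<close>; continuing from \<open>- p\<close> along the partner
  \<open>sref p (- q)\<close> reaches \<open>q\<close>, a bypass of \<open>sref p q\<close>.\<close>

lemma double_edge_unique:
  assumes C: "C \<in> D" "\<bar>p\<bar> \<in> C" "\<bar>i\<bar> \<in> C" and pq: "p \<in> spts n" "q \<in> spts n" "\<bar>p\<bar> \<noteq> \<bar>q\<bar>"
    and e: "sref p q \<in> S" "sref p (- q) \<in> S" 
    and f: "sref i j \<in> S - {sref p q}" "sref i (- j) \<in> S - {sref p q}"
  shows False
proof -
  let ?T = "S - {sref p q}"
  have CU: "C \<in> A \<union> B \<union> D" using C by blast
  have Tr: "?T \<subseteq> refls n" using S_refls by blast
  have jC: "\<bar>j\<bar> \<in> C" using S_end_block[OF CU C(3)] f by blast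
  have nz: "i \<noteq> 0" "p \<noteq> 0" "q \<noteq> 0" "j \<noteq> 0" using block_spts[OF CU C(3)] block_spts[OF CU jC] pq spts_nonzero by auto
  have "(p, i) \<in> reach S" by (rule reach_in_block'[OF _ C(2,3)]) (use C in blast)
  then have "(p, i) \<in> reach ?T \<or> (p, - i) \<in> reach ?T" by (rule reach_without_double_edge[OF pq e])
  then have "(p, - p) \<in> reach ?T"
    by (rule reach_flip[OF Tr double_reach_uminus[OF nz(1,4) f]])
  moreover have "(- p, q) \<in> reach ?T"
  proof -
    have "sref p (- q) \<noteq> sref p q" by (rule sref_uminus_right_ne) (use nz in simp)
    then show ?thesis using reach_step[of "sref p (- q)" ?T "- p"] e nz by simp
  qed
  ultimately have "(p, q) \<in> reach ?T" by (rule reach_trans)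
  moreover have "p \<noteq> q" using pq by auto
  ultimately show False using not_reach[OF e(1)] pq by blast
qed

lemma double_edge_unique':
  assumes C: "C \<in> D" "\<bar>p\<bar> \<in> C" "\<bar>i\<bar> \<in> C" and pq: "p \<in> spts n" "q \<in> spts n" "\<bar>p\<bar> \<noteq> \<bar>q\<bar>"
    and e: "sref p q \<in> S" "sref p (- q) \<in> S" and f: "sref i j \<in> S" "sref i (- j) \<in> S"
  shows "sref i j \<in> {sref p q, sref p (- q)}"
proof (rule ccontr)
  assume no: "\<not> ?thesis"
  show False
  proof (cases "sref i (- j) = sref p q")
    case False
    then show False using double_edge_unique[OF C pq e, of j] f no by blast
  next
    \<comment> \<open>Here \<open>sref i j\<close> avoids the partner instead, and the two members
      of the first pair exchange roles.\<close>
    case True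
    have nz: "p \<noteq> 0" "q \<noteq> 0" using pq spts_nonzero by auto
    have "sref p (- q) \<noteq> sref p q" by (rule sref_uminus_right_ne) (use nz in simp)
    then have "sref i j \<in> S - {sref p (- q)}" "sref i (- j) \<in> S - {sref p (- q)}" using f no True by auto
    from double_edge_unique[OF C pq(1) _ _ e(2) _ this] show False using pq e by simp
  qed
qed

lemma block_edge_D:
  assumes C: "C \<in> D" "\<bar>x\<bar> \<in> C" and s: "s \<in> S" "s x \<noteq> x"
  shows "is_edge s"
proof -
  have s': "s = sref x (s x)" "x \<in> spts n" "s x \<in> spts n" using refls_moved[of s n x] s S_refls by blast+
  have "s x \<noteq> - x" using no_half_D[OF C] s s'(1) by metis
  then have "\<bar>x\<bar> \<noteq> \<bar>s x\<bar>" using s(2) by linarith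
  then have "is_edge (sref x (s x))" using is_edge_sref s'(2,3) spts_nonzero by blast
  then show ?thesis using s'(1) by simp
qed

end

lemma line_cycle_subset_block:
  assumes "\<And>x. \<bar>x\<bar> \<in> C \<Longrightarrow> \<bar>c x\<bar> \<in> C" "\<bar>i\<bar> \<in> C"
  shows "line_cycle c i \<subseteq> C"
proof -
  have "\<bar>(c ^^ k) i\<bar> \<in> C" for k by (induction k) (use assms in auto)
  then show ?thesis by (auto simp: line_cycle_def)
qed

text \<open>Multiplying a positive cycle by the second reflection of a pair \<open>e\<^sub>p - e\<^sub>q\<close>, \<open>e\<^sub>p + e\<^sub>q\<close>, where
  \<open>p\<close> follows \<open>q\<close> on the cycle, splits off \<open>q\<close> as a negative fixed line.\<close>

lemma sref_split_cycle:
  assumes f: "f \<in> Wn n" "f y = x" and xy: "x \<in> spts n" "y \<in> spts n" "\<bar>x\<bar> \<noteq> \<bar>y\<bar>"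
    and no: "(x, - x) \<notin> opow f" "(x, - y) \<notin> opow f"
    and i: "(x, i) \<in> opow f \<or> (x, - i) \<in> opow f" "\<bar>i\<bar> \<noteq> \<bar>y\<bar>"
  shows "\<bar>i\<bar> \<in> line_cycle (sref x (- y) \<circ> f) x"
proof -
  define c where "c = sref x (- y) \<circ> f"
  have cW: "c \<in> Wn n" unfolding c_def using f xy by (intro comp_Wn sref_Wn) auto
  have closed: "\<bar>c z\<bar> \<in> line_cycle c x" if z: "\<bar>z\<bar> \<in> line_cycle c x" for z
  proof -
    obtain k where "\<bar>z\<bar> = \<bar>(c ^^ k) x\<bar>" using z unfolding line_cycle_def by blast
    then have "\<bar>c z\<bar> = \<bar>(c ^^ Suc k) x\<bar>" using Wn_abs_eq_iff[OF cW, of z "(c ^^ k) x"] by simp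
    then show ?thesis unfolding line_cycle_def by blast
  qed
  have self: "\<bar>x\<bar> \<in> line_cycle c x" unfolding line_cycle_def by (intro CollectI exI[of _ 0]) simp
  \<comment> \<open>The maps \<open>c\<close> and \<open>f\<close> differ only where
    \<open>f\<close> takes a value on the line of \<open>x\<close> or \<open>y\<close>. By
    \<open>no\<close> the values \<open>- x\<close> and \<open>- y\<close> never occur on this path;
    the value \<open>x\<close> lies in the line cycle anyway and \<open>y\<close> is the point being
    split off.\<close>
  have "\<bar>(f ^^ r) x\<bar> \<in> line_cycle c x \<or> (f ^^ r) x = y" for r
  proof (induction r)
    case (Suc r)
    define z where "z = (f ^^ r) x"
    have fz: "(f ^^ Suc r) x = f z" by (simp add: z_def)
    then have "(x, f z) \<in> opow f" by (intro opowI[of "Suc r"])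
    then have ne: "f z \<noteq> - x" "f z \<noteq> - y" using no by auto
    show ?case
    proof (cases "z = y \<or> f z = x \<or> f z = y")
      case True
      then have "f z = x \<or> f z = y" using f(2) by auto
      then show ?thesis using self fz by auto
    next
      case False
      then have "c z = f z" using ne by (auto simp: sref_def c_def)
      moreover have "\<bar>z\<bar> \<in> line_cycle c x" using Suc.IH False by (simp add: z_def)
      ultimately show ?thesis using closed[of z] fz by simp
    qed
  qed (use self in simp)
  moreover obtain j where "(x, j) \<in> opow f" "\<bar>j\<bar> = \<bar>i\<bar>" using i(1) by (metis abs_minus_cancel)
  moreover from this obtain r where "(f ^^ r) x = j" by (auto simp: opow_def)
  ultimately show ?thesis using i(2) unfolding c_def by metis
qed

locale coxeter_word = coxeter_blocks +
  fixes ws :: "(int \<Rightarrow> int) list"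
  assumes distinct_ws: "distinct ws" and set_ws: "set ws = S"
begin

abbreviation "c \<equiv> evalw ws"

lemma evalw_W: "set vs \<subseteq> S \<Longrightarrow> evalw vs \<in> W"
  by (rule evalw_in_subgroup[OF is_subgroup_W]) (use S_W in auto)

lemma c_W: "c \<in> W"
  by (rule evalw_W) (simp add: set_ws)

lemma c_Wn: "c \<in> Wn n"
  using c_W W_Wn by blast

lemma line_cycle_subset: "C \<in> A \<union> B \<union> D \<Longrightarrow> \<bar>i\<bar> \<in> C \<Longrightarrow> line_cycle c i \<subseteq> C"
  using W_block[OF c_W] by (intro line_cycle_subset_block) auto

lemma opow_c_no_double:
  assumes C: "C \<in> A \<union> B \<union> D" and x: "\<bar>x\<bar> \<in> C" "(x, y) \<in> reach S"
    and no_double: "\<And>i j. i \<in> spts n \<Longrightarrow> j \<in> spts n \<Longrightarrow> \<bar>i\<bar> \<noteq> \<bar>j\<bar> \<Longrightarrow> \<bar>i\<bar> \<in> C \<Longrightarrow>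
        sref i j \<in> S \<Longrightarrow> sref i (- j) \<in> S \<Longrightarrow> False"
  shows "(x, y) \<in> opow c"
  by (rule opow_of_reach[OF C distinct_ws]) (use x no_double in \<open>auto simp: set_ws\<close>)

text \<open>In the absence of doubled edges the product merges all lines of the block into a single
  cycle, which is negative as soon as the group connects \<open>i\<close> with
  \<open>- i\<close>.\<close>

lemma line_cycle_no_double:
  assumes C: "C \<in> A \<union> B \<union> D" and i: "i \<in> C"
    and no_double: "\<And>i j. i \<in> spts n \<Longrightarrow> j \<in> spts n \<Longrightarrow> \<bar>i\<bar> \<noteq> \<bar>j\<bar> \<Longrightarrow> \<bar>i\<bar> \<in> C \<Longrightarrow>
        sref i j \<in> S \<Longrightarrow> sref i (- j) \<in> S \<Longrightarrow> False"
  shows "line_cycle c i = C" and "C \<notin> A \<Longrightarrow> neg_cycle c C"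
proof -
  have ii: "\<bar>i\<bar> \<in> C" "i > 0" using block_abs[OF C i] block_pos[OF C i] i by auto
  have opow: "(i, y) \<in> opow c" if "(i, y) \<in> reach S" for y
    by (rule opow_c_no_double[OF C ii(1) that no_double])
  show *: "line_cycle c i = C"
  proof
    show "line_cycle c i \<subseteq> C" by (rule line_cycle_subset[OF C ii(1)])
    show "C \<subseteq> line_cycle c i"
    proof
      fix j assume j: "j \<in> C"
      then have jj: "\<bar>j\<bar> \<in> C" "\<bar>j\<bar> = j" using block_abs[OF C] by auto
      obtain z where z: "(i, z) \<in> reach S" "\<bar>z\<bar> = j" using reach_in_block[OF C ii(1) jj(1)] jj(2)
        by (metis abs_minus_cancel)
      then have "(i, z) \<in> opow c" using opow by blast
      then show "j \<in> line_cycle c i" using z(2) unfolding line_cycle_opow by blast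
    qed
  qed
  assume "C \<notin> A"
  then have "(i, - i) \<in> reach S" using reach_uminus_self_iff[OF C ii(1)] by simp
  then have "(i, - i) \<in> opow c" using opow by blast
  then show "neg_cycle c C" using neg_line_cycle[OF c_Wn ii(2)] * by simp
qed

lemma block_A:
  assumes C: "C \<in> A" and i: "i \<in> C"
  shows "line_cycle c i = C" "\<not> neg_cycle c C"
proof -
  have CU: "C \<in> A \<union> B \<union> D" using C by blast
  show "line_cycle c i = C"
    by (rule line_cycle_no_double(1)[OF CU i]) (use no_double_A[OF C] in blast)
  have "{j\<in>C. c j < 0} = {}"
  proof -
    have "c j > 0" if "j \<in> C" for j
      using W_sgn[OF c_W C, of j] block_abs[OF CU that] block_pos[OF CU that] that by simp
    then show ?thesis by force
  qed
  then show "\<not> neg_cycle c C" unfolding neg_cycle_def by (simp only: card.empty even_zero not_not)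
qed

lemma block_B:
  assumes C: "C \<in> B" and i: "i \<in> C"
  shows "line_cycle c i = C" "neg_cycle c C"
proof -
  have CU: "C \<in> A \<union> B \<union> D" "C \<notin> A" using C types by auto
  show "line_cycle c i = C"
    by (rule line_cycle_no_double(1)[OF CU(1) i]) (use no_double_B[OF C] in blast)
  show "neg_cycle c C"
    by (rule line_cycle_no_double(2)[OF CU(1) i _ CU(2)]) (use no_double_B[OF C] in blast)
qed

text \<open>Otherwise the Coxeter element would act on the block as one negative cycle and change an
  odd number of signs, which type D forbids.\<close>

lemma double_edge_D:
  assumes C: "C \<in> D"
  shows "\<exists>p q. p \<in> spts n \<and> q \<in> spts n \<and> \<bar>p\<bar> \<noteq> \<bar>q\<bar> \<and> \<bar>p\<bar> \<in> C \<and> sref p q \<in> S \<and> sref p (- q) \<in> S"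
proof (rule ccontr)
  assume no: "\<not> ?thesis"
  have CU: "C \<in> A \<union> B \<union> D" "C \<notin> A" using C types by auto
  obtain i where i: "i \<in> C" using D_card[OF C] by fastforce
  have "neg_cycle c C"
    by (rule line_cycle_no_double(2)[OF CU(1) i _ CU(2)]) (use no in blast)
  moreover have "even (card {j\<in>C. c j < 0})" using c_W C by (simp add: Wstr_def)
  ultimately show False by (simp add: neg_cycle_def)
qed

text \<open>Without \<open>sref p (- q)\<close> the remaining letters act on the block through a
  tree, so their product \<open>f\<close> has one positive cycle there. Because \<open>q\<close> is
  a leaf and at most one further edge meets \<open>p\<close>, the points \<open>p\<close> and
  \<open>q\<close> are consecutive on it, and the missing reflection splits off one of them.\<close>

lemma split_D:
  assumes C: "C \<in> D" "\<bar>p\<bar> \<in> C" and pq: "p \<in> spts n" "q \<in> spts n" "\<bar>p\<bar> \<noteq> \<bar>q\<bar>"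
    and e: "sref p q \<in> S" "sref p (- q) \<in> S"
    and q_leaf: "\<And>s. s \<in> S \<Longrightarrow> s \<notin> {sref p q, sref p (- q)} \<Longrightarrow> s q = q"
    and p_next: "\<And>s t. s \<in> S \<Longrightarrow> t \<in> S \<Longrightarrow> s \<notin> {sref p q, sref p (- q)} \<Longrightarrow> t \<notin> {sref p q, sref p (- q)} \<Longrightarrow>
      s p \<noteq> p \<Longrightarrow> t p \<noteq> p \<Longrightarrow> s = t"
  shows "\<exists>x y. x \<in> spts n \<and> y \<in> spts n \<and> \<bar>x\<bar> \<in> C \<and> \<bar>y\<bar> \<in> C \<and> \<bar>x\<bar> \<noteq> \<bar>y\<bar> \<and> c y = - y \<and>
    (\<forall>i\<in>C. i \<noteq> \<bar>y\<bar> \<longrightarrow> i \<in> line_cycle c x)"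
proof -
  let ?e = "sref p q" and ?d = "sref p (- q)"
  have CU: "C \<in> A \<union> B \<union> D" using C by blast
  have nz: "p \<noteq> 0" "q \<noteq> 0" using pq spts_nonzero by auto
  have ed: "?d \<noteq> ?e" by (rule sref_uminus_right_ne[OF nz(2)])
  have qC: "\<bar>q\<bar> \<in> C" by (rule S_end_block[OF CU C(2) e(1)])
  obtain u v where uv: "ws = u @ ?d # v" using e(2) set_ws by (metis split_list)
  \<comment> \<open>Cyclic rotation of the word: up to conjugation by \<open>g = evalw u\<close> the
    doubled partner becomes the leftmost letter, so that \<open>c\<close> turns into its product
    with \<open>f\<close>.\<close>
  let ?vs = "v @ u"
  have vs: "distinct ?vs" "set ?vs = S - {?d}" using uv distinct_ws set_ws by auto
  define f where "f = evalw ?vs"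
  define g where "g = evalw u"
  have fW: "f \<in> W" unfolding f_def by (rule evalw_W) (use vs in auto)
  have gW: "g \<in> W" unfolding g_def by (rule evalw_W) (use vs in auto)
  note fWn = W_Wn[OF fW] and gWn = W_Wn[OF gW]
  have cg: "c (g x) = g (?d (f x))" for x unfolding uv f_def g_def by simp
  have "?e \<in> set ?vs" using vs(2) e ed by auto
  then obtain a b where ab: "?vs = a @ ?e # b" by (metis split_list)
  have sub: "set a \<union> set b = S - {?e, ?d}" "set a \<inter> set b = {}" using vs ab by (auto simp: set_eq_iff)
  have fixes_word: "evalw w x = x" if "\<And>s. s \<in> set w \<Longrightarrow> s x = x" for w x
    using that by (induction w) auto
  have aq: "evalw a q = q" "evalw b q = q"
    by (rule fixes_word, rule q_leaf; use sub in blast)+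
  \<comment> \<open>The only other letter that may move \<open>p\<close> stands on one side of
    \<open>?e\<close>. If it is not in \<open>a\<close>, then \<open>f q = p\<close>; if it is not
    in \<open>b\<close>, then \<open>f p = q\<close>.\<close>
  have "evalw a p = p \<or> evalw b p = p"
  proof (rule ccontr)
    assume "\<not> ?thesis"
    then obtain s t where "s \<in> set a" "s p \<noteq> p" "t \<in> set b" "t p \<noteq> p" using fixes_word by metis
    moreover from this have "s = t" using p_next[of s t] sub by blast
    ultimately show False using sub(2) by blast
  qed
  moreover have "f q = evalw a p" unfolding f_def ab using aq by simp
  moreover have "f p = q" if "evalw b p = p" unfolding f_def ab using aq that by simp
  ultimately have fpq: "f q = p \<or> f p = q" by metis
  have f_opow: "(x, y) \<in> opow f" if "\<bar>x\<bar> \<in> C" "(x, y) \<in> reach (S - {?d})" for x y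
    unfolding f_def
  proof (rule opow_of_reach[OF CU vs(1)])
    show "set ?vs \<subseteq> S" using vs by blast
    show "(x, y) \<in> reach (set ?vs)" using that vs by simp
    fix i j assume ij: "i \<in> spts n" "j \<in> spts n" "\<bar>i\<bar> \<noteq> \<bar>j\<bar>" "\<bar>i\<bar> \<in> C" "sref i j \<in> set ?vs" "sref i (- j) \<in> set ?vs"
    then have "sref i j \<in> S - {?d}" "sref i (- j) \<in> S - {?d}" using vs by auto
    then have "sref i j = ?e" "sref i (- j) = ?e"
      using double_edge_unique'[OF C ij(4) pq e, of j] double_edge_unique'[OF C ij(4) pq e, of "- j"] by auto
    then have "j = - j" by (metis sref_simps(1))
    then show False using ij(2) spts_nonzero by fastforce
  qed (use that in auto)
  have reach_f: "(x, y) \<in> reach (S - {?d})" if "(x, y) \<in> opow f" for x y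
    using opow_evalw_subset_reach[of ?vs "S - {?d}"] that vs unfolding f_def by blast
  have neg: "(- x, - y) \<in> reach (S - {?d})" if "(x, y) \<in> reach (S - {?d})" for x y
    by (rule reach_uminus[OF _ that]) (use S_refls in blast)
  have epq: "(p, q) \<in> reach (S - {?d})" using reach_step[of ?e "S - {?d}" p] e ed by auto
  have no1: "(p, - q) \<notin> reach (S - {?d})"
  proof -
    have "p \<noteq> - q" using pq by auto
    then show ?thesis using not_reach[OF e(2) pq(1)] pq(2) by simp
  qed
  then have no2: "(p, - p) \<notin> reach (S - {?d})" using neg[OF epq] reach_trans by blast
  have no3: "(q, - p) \<notin> reach (S - {?d})" using no2 epq reach_trans by blast
  have no4: "(q, - q) \<notin> reach (S - {?d})" using no1 epq reach_trans by blast
  obtain x y where xy: "f y = x" "{x, y} = {p, q}" "?d = sref x (- y)" "(x, - x) \<notin> reach (S - {?d})" "(x, - y) \<notin> reach (S - {?d})"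
  proof (cases "f q = p")
    case True
    then show ?thesis using that[of q p] no1 no2 by blast
  next
    case False
    then have "f p = q" using fpq by blast
    moreover have "?d = sref q (- p)" using sref_commute[of p "- q"] sref_uminus[of q "- p"] nz by simp
    moreover have "{q, p} = {p, q}" by blast
    ultimately show ?thesis using that[of p q] no3 no4 by blast
  qed
  have xyC: "\<bar>x\<bar> \<in> C" "\<bar>y\<bar> \<in> C" "x \<in> spts n" "y \<in> spts n" "\<bar>x\<bar> \<noteq> \<bar>y\<bar>" 
    using xy(2) C(2) qC pq by (auto simp: doubleton_eq_iff)
  have all: "(x, i) \<in> opow f \<or> (x, - i) \<in> opow f" if "\<bar>i\<bar> \<in> C" for i
  proof -
    have "(x, i) \<in> reach S" by (rule reach_in_block'[OF _ xyC(1) that]) (use C in blast)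
    moreover have "(x, i) \<in> reach (S - {sref p (- q)}) \<or> (x, - i) \<in> reach (S - {sref p (- q)})"
      by (rule reach_without_double_edge[OF pq(1) _ _ e(2)]) (use pq e calculation in auto)
    ultimately show ?thesis using f_opow[OF xyC(1)] by blast
  qed
  have no: "(x, - x) \<notin> opow f" "(x, - y) \<notin> opow f" using xy(4,5) reach_f by blast+
  define c0 where "c0 = sref x (- y) \<circ> f"
  have c0: "\<bar>i\<bar> \<in> line_cycle c0 x" if "\<bar>i\<bar> \<in> C" "\<bar>i\<bar> \<noteq> \<bar>y\<bar>" for i
    unfolding c0_def by (rule sref_split_cycle[OF fWn xy(1) xyC(3-5) no all[OF that(1)] that(2)])
  have cgx: "c (g z) = g (c0 z)" for z unfolding cg xy(3) c0_def by simp
  have cgk: "(c ^^ k) (g z) = g ((c0 ^^ k) z)" for k z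
    by (induction k) (simp_all add: cgx)
  have gy: "c (g y) = - g y"
    using xy(1) Wn_uminus[OF gWn] by (simp add: cgx c0_def)
  have "i \<in> line_cycle c (g x)" if i: "i \<in> C" "i \<noteq> \<bar>g y\<bar>" for i
  proof -
    define j where "j = inv g i"
    have gj: "g j = i" using gWn by (simp add: j_def)
    have ipos: "\<bar>i\<bar> = i" using block_abs[OF CU i(1)] .
    have "\<bar>j\<bar> \<in> C" using W_block[OF gW CU, of j] gj i ipos by simp
    moreover have "\<bar>j\<bar> \<noteq> \<bar>y\<bar>" using Wn_abs_eq_iff[OF gWn, of j y] gj i(2) ipos by simp
    ultimately have "\<bar>j\<bar> \<in> line_cycle c0 x" by (rule c0)
    then obtain k where "\<bar>j\<bar> = \<bar>(c0 ^^ k) x\<bar>" by (auto simp: line_cycle_def)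
    then have "\<bar>g j\<bar> = \<bar>g ((c0 ^^ k) x)\<bar>" using Wn_abs_eq_iff[OF gWn] by simp
    then have "i = \<bar>(c ^^ k) (g x)\<bar>" using gj ipos by (simp add: cgk)
    then show ?thesis by (auto simp: line_cycle_def)
  qed
  moreover have "\<bar>g x\<bar> \<in> C" "\<bar>g y\<bar> \<in> C" "g x \<in> spts n" "g y \<in> spts n" "\<bar>g x\<bar> \<noteq> \<bar>g y\<bar>"
    using W_block[OF gW CU] xyC Wn_in_spts[OF gWn] Wn_abs_eq_iff[OF gWn] by auto
  ultimately show ?thesis using gy by blast
qed

text \<open>The line \<open>z\<close> is split off with a sign change, and parity in type D then
  makes the cycle on the other lines negative. The requirements of \<open>split_D\<close> hold for
  one of the two ends of the doubled edge.\<close>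

lemma block_D:
  assumes C: "C \<in> D"
  shows "\<exists>z\<in>C. line_cycle c z = {z} \<and> neg_cycle c {z} \<and> C - {z} \<noteq> {} \<and>
    (\<forall>i\<in>C - {z}. line_cycle c i = C - {z}) \<and> neg_cycle c (C - {z})"
proof -
  have CU: "C \<in> A \<union> B \<union> D" using C by blast
  obtain p q where pq: "p \<in> spts n" "q \<in> spts n" "\<bar>p\<bar> \<noteq> \<bar>q\<bar>" "\<bar>p\<bar> \<in> C" "sref p q \<in> S" "sref p (- q) \<in> S"
    using double_edge_D[OF C] by blast
  have nz: "p \<noteq> 0" "q \<noteq> 0" using pq spts_nonzero by auto
  have qC: "\<bar>q\<bar> \<in> C" by (rule S_end_block[OF CU pq(4,5)])
  let ?E = "{sref p q, sref p (- q)}"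
  have one: "s = t" if "s \<in> S" "t \<in> S" "s \<notin> ?E" "t \<notin> ?E" "s p \<noteq> p \<or> s q \<noteq> q" "t p \<noteq> p \<or> t q \<noteq> q" for s t
    by (rule double_edge_neighbours[OF pq(1-3,5,6) that(1,2) _ _ that(3-6)])
      (use that block_edge_D[OF C pq(4)] block_edge_D[OF C qC] in blast)+
  have excl: "s p = p \<or> s q = q" if "s \<in> S" "s \<notin> ?E" for s
    using refls_fixes_cases[of s n p q] pq that S_refls by blast
  have "\<exists>x y. x \<in> spts n \<and> y \<in> spts n \<and> \<bar>x\<bar> \<in> C \<and> \<bar>y\<bar> \<in> C \<and> \<bar>x\<bar> \<noteq> \<bar>y\<bar> \<and> c y = - y \<and>
    (\<forall>i\<in>C. i \<noteq> \<bar>y\<bar> \<longrightarrow> i \<in> line_cycle c x)"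
  \<comment> \<open>At most one further generator meets the doubled edge, so one of its ends is a
    leaf; in the second case the roles of \<open>p\<close> and \<open>q\<close> are
    exchanged.\<close>
  proof (cases "\<forall>s\<in>S. s \<notin> ?E \<longrightarrow> s q = q")
    case True
    show ?thesis by (rule split_D[OF C pq(4,1-3,5,6)]) (use True one in blast)+
  next
    case False
    then obtain t where t: "t \<in> S" "t \<notin> ?E" "t q \<noteq> q" by blast
    have E: "{sref q p, sref q (- p)} = ?E" 
      using sref_commute[of p q] sref_commute[of p "- q"] sref_uminus[of q "- p"] nz by simp
    have "sref q p \<in> S" "sref q (- p) \<in> S"
      using pq(5,6) sref_commute[of p q] sref_commute[of p "- q"] sref_uminus[of q "- p"] nz by simp_all
    moreover have "s p = p" if "s \<in> S" "s \<notin> ?E" for s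
      using one[OF that(1) t(1) that(2) t(2)] t(3) excl[OF that] by metis
    ultimately show ?thesis
      by (intro split_D[OF C qC pq(2,1) pq(3)[symmetric]]) (use one E in blast)+
  qed
  then obtain x y where xy: "x \<in> spts n" "y \<in> spts n" "\<bar>x\<bar> \<in> C" "\<bar>y\<bar> \<in> C" "\<bar>x\<bar> \<noteq> \<bar>y\<bar>" "c y = - y"
    "\<And>i. i \<in> C \<Longrightarrow> i \<noteq> \<bar>y\<bar> \<Longrightarrow> i \<in> line_cycle c x" by blast
  define z where "z = \<bar>y\<bar>"
  have zC: "z \<in> C" using xy by (simp add: z_def)
  have cz: "c z = - z" using xy(6) Wn_uminus[OF c_Wn] by (simp add: z_def abs_if)
  have zpos: "z > 0" using block_pos[OF CU zC] .
  have "\<bar>(c ^^ k) z\<bar> = z" for k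
  proof (induction k)
    case (Suc k)
    then have "(c ^^ k) z = z \<or> (c ^^ k) z = - z" by linarith
    then show ?case using cz Wn_uminus[OF c_Wn, of z] zpos by auto
  qed (use zpos in simp)
  then have lz: "line_cycle c z = {z}" by (auto simp: line_cycle_def)
  have "{j\<in>{z}. c j < 0} = {z}" using cz zpos by auto
  then have nz': "neg_cycle c {z}" by (simp add: neg_cycle_def)
  have xz: "\<bar>x\<bar> \<in> C - {z}" using xy by (simp add: z_def)
  have lx: "line_cycle c x = C - {z}"
  proof
    show "C - {z} \<subseteq> line_cycle c x" using xy(7) by (auto simp: z_def)
    have "z \<notin> line_cycle c x"
    proof
      assume "z \<in> line_cycle c x"
      then have "line_cycle c x = {z}" using line_cycle_cong[OF c_Wn] lz by metis
      moreover have "\<bar>x\<bar> \<in> line_cycle c x" unfolding line_cycle_def by (intro CollectI exI[of _ 0]) simp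
      ultimately show False using xz by simp
    qed
    then show "line_cycle c x \<subseteq> C - {z}" using line_cycle_subset[OF CU xy(3)] by blast
  qed
  have "line_cycle c i = C - {z}" if "i \<in> C - {z}" for i
    using line_cycle_cong[OF c_Wn, of i x] lx that by simp
  moreover have "neg_cycle c (C - {z})"
  proof -
    have fin: "finite {j\<in>C. c j < 0}" using block_finite[OF CU] by simp
    have "even (card {j\<in>C. c j < 0})" using c_W C by (simp add: Wstr_def)
    moreover have "z \<in> {j\<in>C. c j < 0}" using zC cz zpos by simp
    moreover have "{j\<in>C - {z}. c j < 0} = {j\<in>C. c j < 0} - {z}" by blast
    moreover have "card {j\<in>C. c j < 0} > 0" using fin calculation(2) by (metis card_gt_0_iff empty_iff)
    ultimately have "card {j\<in>C - {z}. c j < 0} = card {j\<in>C. c j < 0} - 1"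
      by (simp only: card_Diff_singleton)
    moreover have "odd (m - 1)" if "even m" "m > 0" for m :: nat using that by presburger
    ultimately show ?thesis
      unfolding neg_cycle_def using \<open>even (card {j\<in>C. c j < 0})\<close> \<open>card {j\<in>C. c j < 0} > 0\<close> by metis
  qed
  ultimately show ?thesis using zC lz nz' xz by blast
qed

text \<open>Each block of \<open>D\<close> contributes the two negative cycles \<open>{z C}\<close>
  and \<open>C - {z C}\<close>. For blocks of size 2 both are singletons, so the disjointness of
  \<open>D1\<close> and \<open>D2\<close> rests on the disjointness of the blocks and not on
  sizes.\<close>

lemma cycle_type_c:
  "cycle_type n c = (image_mset card (mset_set A),
     image_mset card (mset_set B) + image_mset (\<lambda>C. card C - 1) (mset_set D) + replicate_mset (card D) 1)"
proof -
  obtain z where z: "\<And>C. C \<in> D \<Longrightarrow> z C \<in> C \<and> line_cycle c (z C) = {z C} \<and> neg_cycle c {z C} \<and> C - {z C} \<noteq> {} \<and>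
    (\<forall>i\<in>C - {z C}. line_cycle c i = C - {z C}) \<and> neg_cycle c (C - {z C})"
    using block_D by metis
  define D1 where "D1 = (\<lambda>C. {z C}) ` D"
  define D2 where "D2 = (\<lambda>C. C - {z C}) ` D"
  have ne: "C \<noteq> {}" if "C \<in> A \<union> B \<union> D" for C using nonempty that by blast
  have cyc: "cycles n c = A \<union> B \<union> D1 \<union> D2"
  proof
    show "cycles n c \<subseteq> A \<union> B \<union> D1 \<union> D2"
    proof
      fix X assume "X \<in> cycles n c"
      then obtain i where i: "i \<in> {1..int n}" "X = line_cycle c i" by (auto simp: cycles_def)
      then obtain C where C: "C \<in> A \<union> B \<union> D" "i \<in> C" using cover by blast
      consider "C \<in> A" | "C \<in> B" | "C \<in> D" "i = z C" | "C \<in> D" "i \<in> C - {z C}" using C by blast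
      then show "X \<in> A \<union> B \<union> D1 \<union> D2"
      proof cases
        case 1
        then show ?thesis using block_A[OF 1 C(2)] i by simp
      next
        case 2
        then show ?thesis using block_B[OF 2 C(2)] i by simp
      next
        case 3
        then show ?thesis using z[OF 3(1)] i by (auto simp: D1_def)
      next
        case 4
        then show ?thesis using z[OF 4(1)] i by (auto simp: D2_def)
      qed
    qed
    have lc: "line_cycle c i \<in> cycles n c" if "i \<in> C" "C \<in> A \<union> B \<union> D" for i C
      using block_subset[OF that(2)] that(1) by (auto simp: cycles_def)
    show "A \<union> B \<union> D1 \<union> D2 \<subseteq> cycles n c"
    proof
      fix X assume "X \<in> A \<union> B \<union> D1 \<union> D2"
      then consider "X \<in> A" | "X \<in> B" | C where "C \<in> D" "X = {z C}" | C where "C \<in> D" "X = C - {z C}"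
        by (auto simp: D1_def D2_def)
      then show "X \<in> cycles n c"
      proof cases
        case 1
        then obtain i where "i \<in> X" using ne by blast
        then show ?thesis using block_A[OF 1] lc 1 by (metis UnI1)
      next
        case 2
        then obtain i where "i \<in> X" using ne by blast
        then show ?thesis using block_B[OF 2] lc 2 by (metis UnI1 UnI2)
      next
        case 3
        then show ?thesis using z[OF 3(1)] lc[of "z C" C] by auto
      next
        case 4
        then obtain i where "i \<in> C - {z C}" using z by blast
        then show ?thesis using z[OF 4(1)] lc[of i C] 4 by auto
      qed
    qed
  qed
  have neg: "\<And>X. X \<in> A \<Longrightarrow> \<not> neg_cycle c X" "\<And>X. X \<in> B \<union> D1 \<union> D2 \<Longrightarrow> neg_cycle c X"
  proof -
    show "\<not> neg_cycle c X" if "X \<in> A" for X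
      using block_A(2)[OF that] ne[of X] that by blast
    show "neg_cycle c X" if "X \<in> B \<union> D1 \<union> D2" for X
      using that block_B(2)[of X] ne[of X] z by (auto simp: D1_def D2_def)
  qed
  have parts: "{X \<in> cycles n c. \<not> neg_cycle c X} = A" "{X \<in> cycles n c. neg_cycle c X} = B \<union> D1 \<union> D2"
    unfolding cyc using neg by blast+
  have fin: "finite A" "finite B" "finite D" using finite_blocks by auto
  then have fin': "finite D1" "finite D2" by (auto simp: D1_def D2_def)
  have D12: "\<exists>C\<in>D. X \<subseteq> C \<and> X \<noteq> {}" if "X \<in> D1 \<union> D2" for X using that z by (auto simp: D1_def D2_def)
  have eq: "C = C'" if "C \<in> A \<union> B \<union> D" "C' \<in> A \<union> B \<union> D" "X \<subseteq> C" "X \<subseteq> C'" "X \<noteq> {}" for C C' X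
    using that disj[of C C'] by blast
  have "X \<notin> B" if X: "X \<in> D1 \<union> D2" for X
  proof
    assume B: "X \<in> B"
    obtain C where C: "C \<in> D" "X \<subseteq> C" "X \<noteq> {}" using D12[OF X] by blast
    have "X = C" by (rule eq[of _ _ X]) (use B C in auto)
    then show False using B C(1) types by blast
  qed
  then have 1: "B \<inter> D1 = {}" "B \<inter> D2 = {}" by blast+
  have 2: "D1 \<inter> D2 = {}"
  proof (rule ccontr)
    assume "D1 \<inter> D2 \<noteq> {}"
    then obtain C C' where C: "C \<in> D" "C' \<in> D" "{z C} = C' - {z C'}" by (auto simp: D1_def D2_def)
    then have "z C \<in> C'" "z C \<in> C" using z by blast+
    then have "C = C'" using C disj[of C C' "z C"] by blast
    then show False using C by blast
  qed
  have inj1: "inj_on (\<lambda>C. {z C}) D" using z disj by (intro inj_onI) (metis UnI2 singleton_inject)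
  have inj2: "inj_on (\<lambda>C. C - {z C}) D" 
  proof (rule inj_onI)
    fix C C' assume C: "C \<in> D" "C' \<in> D" "C - {z C} = C' - {z C'}"
    show "C = C'" by (rule eq[of _ _ "C - {z C}"]) (use C z in blast)+
  qed
  have "mset_set (B \<union> D1 \<union> D2) = mset_set B + mset_set D1 + mset_set D2"
    using fin fin' 1 2 by (simp add: mset_set_Union Int_Un_distrib2)
  moreover have "mset_set D1 = image_mset (\<lambda>C. {z C}) (mset_set D)"
    unfolding D1_def using inj1 by (simp add: image_mset_mset_set)
  moreover have "mset_set D2 = image_mset (\<lambda>C. C - {z C}) (mset_set D)"
    unfolding D2_def using inj2 by (simp add: image_mset_mset_set)
  moreover have "image_mset (\<lambda>C. card (C - {z C})) (mset_set D) = image_mset (\<lambda>C. card C - 1) (mset_set D)"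
    by (rule image_mset_cong) (use z fin in auto)
  moreover have "image_mset (\<lambda>C. 1) (mset_set D) = replicate_mset (card D) (1::nat)"
    using fin by (simp add: image_mset_const_eq)
  ultimately show ?thesis
    unfolding cycle_type_def parts by (simp add: multiset.map_comp o_def add.commute add.left_commute)
qed

end

section \<open>Coxeter presentations\<close>

lemma coxeq_context: "coxeq S u v \<Longrightarrow> coxeq S (a @ u @ b) (a @ v @ b)"
proof (induction rule: coxeq.induct)
  case (sq s u v)
  then show ?case using coxeq.sq[of s S "a @ u" "v @ b"] by simp
next
  case (braid s t u v)
  then show ?case using coxeq.braid[of s S t "a @ u" "v @ b"] by simp
qed (auto intro: coxeq.refl coxeq.sym coxeq.trans)

lemma coxeq_left: "coxeq S u v \<Longrightarrow> coxeq S (a @ u) (a @ v)"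
  using coxeq_context[of S u v a "[]"] by simp

lemma coxeq_right: "coxeq S u v \<Longrightarrow> coxeq S (u @ b) (v @ b)"
  using coxeq_context[of S u v "[]" b] by simp

lemma coxeq_mono:
  assumes "coxeq S u v" "S \<subseteq> T"
  shows "coxeq T u v"
  using assms(1)
proof (induction rule: coxeq.induct)
  case (sq s u v)
  then show ?case using assms(2) by (intro coxeq.sq) auto
next
  case (braid s t u v)
  then show ?case using assms(2) by (intro coxeq.braid) auto
qed (auto intro: coxeq.refl coxeq.sym coxeq.trans)

lemma coxeq_rev_cancel: "set w \<subseteq> S \<Longrightarrow> coxeq S (w @ rev w) []"
proof (induction w)
  case (Cons s w)
  have "coxeq S ([s] @ (w @ rev w) @ [s]) ([s] @ [] @ [s])"
    by (rule coxeq_context) (use Cons in simp)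
  moreover have "coxeq S ([] @ [s, s] @ []) ([] @ [])" by (rule coxeq.sq) (use Cons in simp)
  ultimately show ?case using coxeq.trans by fastforce
qed (simp add: coxeq.refl)

lemma coxeq_swap:
  assumes "coxeq S (a @ b) []" "set b \<subseteq> S"
  shows "coxeq S a (rev b)"
proof -
  have "coxeq S (a @ (b @ rev b)) (a @ [])" by (rule coxeq_left, rule coxeq_rev_cancel[OF assms(2)])
  moreover have "coxeq S ((a @ b) @ rev b) ([] @ rev b)" by (rule coxeq_right[OF assms(1)])
  ultimately show ?thesis by (simp, meson coxeq.sym coxeq.trans)
qed

lemma elt_order_eqI:
  assumes "k > 0" "g ^^ k = id" "\<And>j. 0 < j \<Longrightarrow> j < k \<Longrightarrow> g ^^ j \<noteq> id"
  shows "elt_order g = k"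
  unfolding elt_order_def by (rule Least_equality) (use assms in \<open>auto simp: not_less[symmetric]\<close>)

lemma coxeq_relation: "s \<in> S \<Longrightarrow> t \<in> S \<Longrightarrow> elt_order (s \<circ> t) = m \<Longrightarrow> coxeq S (concat (replicate m [s, t])) []"
  using coxeq.braid[of s S t "[]" "[]"] by simp

lemma coxeq_commute:
  assumes S: "S \<subseteq> refls n" "s \<in> S" "t \<in> S" and "s \<circ> t = t \<circ> s"
  shows "coxeq S [s, t] [t, s]"
proof (cases "s = t")
  case False
  have ss: "s (s x) = x" "t (t x) = x" "s (t x) = t (s x)" for x 
    using S refls_involution[of s n] refls_involution[of t n] assms(4) by (auto simp: fun_eq_iff)
  have "elt_order (s \<circ> t) = 2"
  proof (rule elt_order_eqI)
    show "(s \<circ> t) ^^ 2 = id" by (rule ext) (simp add: numeral_2_eq_2 ss)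
    show "(s \<circ> t) ^^ j \<noteq> id" if "0 < j" "j < 2" for j
    proof
      assume "(s \<circ> t) ^^ j = id"
      moreover have "j = 1" using that by simp
      ultimately have "s (t x) = x" for x by (simp add: fun_eq_iff)
      then have "t x = s x" for x using ss(1)[of "t x"] by metis
      then show False using False by (simp add: fun_eq_iff)
    qed
  qed simp
  from coxeq_relation[OF S(2,3) this] have "coxeq S ([s, t] @ [s, t]) []" by (simp add: numeral_2_eq_2)
  from coxeq_swap[OF this] show ?thesis using S by simp
qed (simp add: coxeq.refl)

lemma coxeq_braid3:
  assumes S: "S \<subseteq> refls n" "s \<in> S" "t \<in> S" and "adj s t"
  shows "coxeq S [s, t, s] [t, s, t]"
proof -
  have st: "s \<in> refls n" "t \<in> refls n" using S by auto
  have "elt_order (s \<circ> t) = 3"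
  proof (rule elt_order_eqI)
    show "(s \<circ> t) ^^ 3 = id"
      by (rule braid_funpow_3[OF _ _ adj_braid[OF st assms(4)]]) (use st refls_comp_self in auto)
    show "(s \<circ> t) ^^ j \<noteq> id" if "0 < j" "j < 3" for j
      using adj_order_dvd[OF st assms(4), of j] dvd_imp_le[of 3 j] that by auto
  qed simp
  from coxeq_relation[OF S(2,3) this] have "coxeq S ([s, t, s] @ [t, s, t]) []" by (simp add: numeral_3_eq_3)
  from coxeq_swap[OF this] show ?thesis using S by simp
qed

text \<open>The product of \<open>t\<close> and \<open>h\<close> is a quarter turn taking
  \<open>b\<close> to \<open>c\<close>, \<open>- b\<close>, \<open>- c\<close> in turn, so its order
  is 4. This is the bond between a sign change and an edge.\<close>

lemma coxeq_braid4:
  assumes S: "t = sref (- b) c" "h = sref b (- b)" "t \<in> S" "h \<in> S" and bc: "b \<noteq> 0" "c \<noteq> 0" "\<bar>b\<bar> \<noteq> \<bar>c\<bar>"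
  shows "coxeq S [t, h, t, h] [h, t, h, t]"
proof -
  define g where "g = t \<circ> h"
  have ne: "b \<noteq> c" "b \<noteq> - c" "c \<noteq> - b" "- b \<noteq> c" using bc by auto
  have g: "g b = c" "g c = - b" "g (- b) = - c" "g (- c) = b" "p \<noteq> b \<Longrightarrow> p \<noteq> - b \<Longrightarrow> p \<noteq> c \<Longrightarrow> p \<noteq> - c \<Longrightarrow> g p = p" for p
    using bc ne unfolding g_def S(1,2) by (auto simp: sref_def)
  have "elt_order (t \<circ> h) = 4"
  proof (rule elt_order_eqI)
    show "(t \<circ> h) ^^ 4 = id"
    proof
      fix p
      consider "p = b" | "p = - b" | "p = c" | "p = - c" | "p \<noteq> b" "p \<noteq> - b" "p \<noteq> c" "p \<noteq> - c" by blast
      then have "g (g (g (g p))) = p" by cases (simp_all add: g)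
      then show "((t \<circ> h) ^^ 4) p = id p" unfolding g_def[symmetric] by (simp add: numeral_eq_Suc)
    qed
    show "(t \<circ> h) ^^ j \<noteq> id" if "0 < j" "j < 4" for j
    proof
      assume "(t \<circ> h) ^^ j = id"
      then have "(g ^^ j) b = b" unfolding g_def by simp
      moreover have "(g ^^ 1) b = c" "(g ^^ 2) b = - b" "(g ^^ 3) b = - c"
        by (simp_all add: numeral_eq_Suc g(1-4))
      moreover have "j = 1 \<or> j = 2 \<or> j = 3" using that by arith
      moreover have "c \<noteq> b" "- b \<noteq> b" "- c \<noteq> b" using ne bc(1) by auto
      ultimately show False by metis
    qed
  qed simp
  from coxeq_relation[OF S(3,4) this] have "coxeq S ([t, h, t, h] @ [t, h, t, h]) []" by (simp add: numeral_eq_Suc)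
  from coxeq_swap[OF this] show ?thesis using S by simp
qed

lemma coxeq_evalw:
  assumes "S \<subseteq> refls n" "coxeq S u v"
  shows "evalw u = evalw v"
proof -
  have SW: "s \<in> Wn n" if "s \<in> S" for s using that assms(1) refls_Wn by blast
  have "hom_eval (\<lambda>s. s) u = hom_eval (\<lambda>s. s) v"
  proof (rule coxeq_hom[OF assms(2)])
    show "s \<circ> s = id" if "s \<in> S" for s using that assms(1) refls_comp_self by blast
    show "(s \<circ> t) ^^ elt_order (s \<circ> t) = id" if "s \<in> S" "t \<in> S" for s t
      using funpow_elt_order[OF comp_Wn[OF SW[OF that(1)] SW[OF that(2)]]] by simp
  qed
  then show ?thesis by (simp add: hom_eval_def evalw_def)
qed

section \<open>Coset enumeration along the orbit of a point\<close>

text \<open>Stated for the set alone, without the group it generates, so that generators can be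
  removed one at a time.\<close>

definition presented :: "(int \<Rightarrow> int) set \<Rightarrow> bool" where
  "presented S \<longleftrightarrow> (\<forall>ws. set ws \<subseteq> S \<longrightarrow> evalw ws = id \<longrightarrow> coxeq S ws [])"

lemma refls_fix_commute:
  assumes s: "s \<in> refls n" and "s i = i" "s j = j"
  shows "s \<circ> sref i j = sref i j \<circ> s"
proof -
  have sW: "s \<in> Wn n" using s refls_Wn by blast
  have "s \<circ> sref i j \<circ> inv s = sref i j" using sref_conj[OF sW, of i j] assms by simp
  then have "s \<circ> sref i j \<circ> (inv s \<circ> s) = sref i j \<circ> s" by (simp only: o_assoc)
  then show ?thesis using sW by simp
qed

text \<open>The words \<open>q 1, \<dots>, q k\<close> represent the cosets of the subgroup fixing the point \<open>p 0\<close>, and the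
  \<open>k\<close>-th one carries \<open>p k\<close> to \<open>p 0\<close>.\<close>

locale orbit_chain =
  fixes n :: nat and S :: "(int \<Rightarrow> int) set" and p :: "nat \<Rightarrow> int" and M :: nat
  assumes S_refls: "S \<subseteq> refls n"
    and p_spts: "k \<le> M \<Longrightarrow> p k \<in> spts n"
    and p_inj: "k \<le> M \<Longrightarrow> l \<le> M \<Longrightarrow> p k = p l \<Longrightarrow> k = l"
    and chain: "k < M \<Longrightarrow> sref (p k) (p (Suc k)) \<in> S"
    and movers: "s \<in> S \<Longrightarrow> k \<le> M \<Longrightarrow> s (p k) \<noteq> p k \<Longrightarrow>
      (k > 0 \<and> s = sref (p (k - 1)) (p k)) \<or> (k < M \<and> s = sref (p k) (p (Suc k)))"
begin

definition q :: "nat \<Rightarrow> int \<Rightarrow> int" where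
  "q k = sref (p (k - 1)) (p k)"

definition coset :: "nat \<Rightarrow> (int \<Rightarrow> int) list" where
  "coset k = map q [1..<Suc k]"

lemma coset_0: "coset 0 = []" by (simp add: coset_def)

lemma coset_Suc: "coset (Suc k) = coset k @ [q (Suc k)]" by (simp add: coset_def)

lemma q_S: "0 < k \<Longrightarrow> k \<le> M \<Longrightarrow> q k \<in> S"
  using chain[of "k - 1"] by (simp add: q_def)

lemma evalw_coset: "evalw (coset k) (p k) = p 0"
  by (induction k) (simp_all add: coset_0 coset_Suc q_def)

lemma q_ne: "0 < k \<Longrightarrow> k \<le> M \<Longrightarrow> p (k - 1) \<noteq> p k"
  using p_inj[of "k - 1" k] by (cases k) auto

text \<open>A generator fixing \<open>p k\<close> is moved leftwards through the coset word. It
  commutes with the last letter or trades places by a braid relation, and induction handles the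
  shorter prefix. What emerges on the left fixes \<open>p 0\<close>, so it is not
  \<open>q 1\<close>.\<close>

lemma coset_fix:
  assumes "k \<le> M" "s \<in> S" "s (p k) = p k"
  shows "\<exists>s'\<in>S - {q 1}. coxeq S (coset k @ [s]) (s' # coset k)"
  using assms
proof (induction k arbitrary: s rule: less_induct)
  case (less k)
  have sr: "s \<in> refls n" using less.prems S_refls by blast
  show ?case
  proof (cases "k = 0")
    case True
    have "s \<noteq> q 1" 
    proof
      assume s: "s = q 1"
      then have "p 1 = p 0" using less.prems(3) True by (simp add: q_def)
      then have "s = id" using s by (simp add: q_def)
      then show False using refls_not_id[OF sr] by simp
    qed
    then show ?thesis using less.prems True by (intro bexI[of _ s]) (auto simp: coset_0 coxeq.refl)
  next
    case False
    then obtain j where j: "k = Suc j" by (cases k) auto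
    have jM: "j < M" using less.prems j by simp
    have q: "q k = sref (p j) (p k)" "q k \<in> S" using q_S[of k] less.prems(1) j by (auto simp: q_def)
    have qr: "q k \<in> refls n" using q(2) S_refls by blast
    have D: "coset k = coset j @ [q k]" using coset_Suc j by simp
    show ?thesis
    proof (cases "s (p j) = p j")
      case True
      have "coxeq S [q k, s] [s, q k]"
        by (rule coxeq_commute[OF S_refls q(2) less.prems(2)])
          (use refls_fix_commute[OF sr True less.prems(3)] q(1) in simp)
      then have 1: "coxeq S (coset j @ [q k, s]) (coset j @ [s, q k])" by (rule coxeq_left)
      obtain s' where s': "s' \<in> S - {q 1}" "coxeq S (coset j @ [s]) (s' # coset j)"
        using less.IH[of j s] j jM less.prems(2) True by auto
      from coxeq_right[OF this(2), of "[q k]"] have "coxeq S (coset j @ [s, q k]) (s' # coset k)" by (simp add: D)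
      with 1 have "coxeq S (coset k @ [s]) (s' # coset k)" using coxeq.trans by (fastforce simp: D)
      then show ?thesis using s'(1) by blast
    next
      case moved: False
      have "s \<noteq> sref (p j) (p (Suc j))"
      proof
        assume s: "s = sref (p j) (p (Suc j))"
        then have "p j = p k" using less.prems(3) j by simp
        then show False using q_ne[of k] less.prems(1) j by simp
      qed
      then have "j > 0" and s: "s = sref (p (j - 1)) (p j)" using movers[OF less.prems(2) _ moved] jM by auto
      then obtain i where i: "j = Suc i" by (cases j) auto
      have si: "s = sref (p i) (p j)" "s = q j" using s i by (auto simp: q_def)
      have sp: "p i \<in> spts n" "p j \<in> spts n" "p k \<in> spts n" using p_spts less.prems(1) i j by auto
      have nz: "p i \<noteq> 0" "p j \<noteq> 0" "p k \<noteq> 0" using sp spts_nonzero by auto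
      have ij: "p i \<noteq> p j" using q_ne[of j] i jM by simp
      have abs: "\<bar>p k\<bar> \<noteq> \<bar>p i\<bar>" "\<bar>p k\<bar> \<noteq> \<bar>p j\<bar>"
        using refls_fixes_iff[OF sr si(1) sp(1,2) ij nz(3)] less.prems(3) by auto
      have Dj: "coset k = coset i @ [s, q k]" using D coset_Suc[of i] i si(2) by simp
      show ?thesis
      \<comment> \<open>Here \<open>s\<close> and \<open>q k\<close> are consecutive steps of the
        chain. They satisfy the braid relation of length 3, unless \<open>s\<close> is the sign
        change in the middle of a symmetric chain.\<close>
      proof (cases "\<bar>p i\<bar> = \<bar>p j\<bar>")
        case False
        have "is_edge s" "is_edge (q k)" using nz False abs by (simp_all add: si(1) q(1) is_edge_sref)
        moreover have "s \<circ> q k \<noteq> q k \<circ> s"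
        proof
          assume "s \<circ> q k = q k \<circ> s"
          then have "s (q k (p k)) = q k (s (p k))" by (metis comp_apply)
          then show False using less.prems(3) moved q(1) by simp
        qed
        ultimately have adj: "adj s (q k)" by (simp add: adj_def)
        have "coxeq S (coset i @ [s, q k, s]) (coset i @ [q k, s, q k])"
          by (rule coxeq_left, rule coxeq_braid3[OF S_refls less.prems(2) q(2) adj])
        then have 1: "coxeq S (coset k @ [s]) (coset i @ [q k, s, q k])" by (simp add: Dj)
        have "q k (p i) = p i" unfolding q(1) using False abs by (intro sref_other) auto
        then obtain s' where s': "s' \<in> S - {q 1}" "coxeq S (coset i @ [q k]) (s' # coset i)"
          using less.IH[of i "q k"] i j jM q(2) by auto
        from coxeq_right[OF this(2), of "[s, q k]"] 
        have "coxeq S (coset i @ [q k, s, q k]) (s' # coset k)" by (simp add: Dj)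
        with 1 have "coxeq S (coset k @ [s]) (s' # coset k)" by (rule coxeq.trans)
        then show ?thesis using s'(1) by blast
      next
        case True
        \<comment> \<open>Around the middle the chain retraces itself with opposite signs:
          \<open>p l = - p k\<close>, so \<open>q k\<close> and \<open>q i\<close> are one
          reflection and the last letters of the coset word before \<open>s\<close> alternate. The
          relation of length 4 applies, and \<open>s\<close> fixes \<open>p l\<close>.\<close>
        then have pj: "p j = - p i" using ij by linarith
        have "q k (p j) \<noteq> p j" using q(1) abs by auto
        moreover have "q k \<in> Wn n" using qr refls_Wn by blast
        ultimately have qi: "q k (p i) \<noteq> p i" using Wn_uminus[of "q k" n "p i"] pj by auto
        have "q k \<noteq> s" using qr q(1) less.prems(3) abs by auto
        then have "q k \<noteq> sref (p i) (p (Suc i))" using si i by simp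
        then have i0: "i > 0" "q k = sref (p (i - 1)) (p i)" using movers[OF q(2) _ qi] i jM by auto
        then obtain l where l: "i = Suc l" by (cases i) auto
        have qil: "q k = sref (p l) (p i)" "q k = q i" using i0 l by (auto simp: q_def)
        have "p l = q k (p i)" using qil by simp
        also have "\<dots> = - p k" using q(1) pj nz by (simp add: sref_def)
        finally have pl: "p l = - p k" .
        have Di: "coset k = coset l @ [q k, s, q k]" using Dj coset_Suc[of l] l qil(2) by simp
        have "coxeq S (coset l @ [q k, s, q k, s]) (coset l @ [s, q k, s, q k])"
          by (rule coxeq_left, rule coxeq_braid4[of _ "p i" "p k"]) (use q si pj less.prems nz abs in auto)
        then have 1: "coxeq S (coset k @ [s]) (coset l @ [s, q k, s, q k])" by (simp add: Di)
        have "s (p l) = p l" unfolding si(1) pl using abs by (intro sref_other) auto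
        then obtain s' where s': "s' \<in> S - {q 1}" "coxeq S (coset l @ [s]) (s' # coset l)"
          using less.IH[of l s] l i j jM less.prems(2) by auto
        from coxeq_right[OF this(2), of "[q k, s, q k]"] 
        have "coxeq S (coset l @ [s, q k, s, q k]) (s' # coset k)" by (simp add: Di)
        with 1 have "coxeq S (coset k @ [s]) (s' # coset k)" by (rule coxeq.trans)
        then show ?thesis using s'(1) by blast
      qed
    qed
  qed
qed

text \<open>Right multiplication by a generator keeps the coset or moves to a neighbouring one, so
  the listed cosets are closed.\<close>

lemma coset_step:
  assumes "k \<le> M" "s \<in> S"
  shows "\<exists>u l. set u \<subseteq> S - {q 1} \<and> l \<le> M \<and> coxeq S (coset k @ [s]) (u @ coset l)"
proof (cases "s (p k) = p k")
  case True
  then obtain s' where "s' \<in> S - {q 1}" "coxeq S (coset k @ [s]) ([s'] @ coset k)"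
    using coset_fix[OF assms] by auto
  then show ?thesis using assms(1) by (intro exI[of _ "[s']"] exI[of _ k]) auto
next
  case False
  then consider "k > 0" "s = q k" | "k < M" "s = q (Suc k)" using movers[OF assms(2,1)] by (auto simp: q_def)
  then show ?thesis
  proof cases
    case 1
    then obtain j where j: "k = Suc j" by (cases k) auto
    have "coxeq S (coset k @ [s]) (coset j)" 
      using coxeq.sq[OF assms(2), of "coset j" "[]"] 1 j by (simp add: coset_Suc)
    then show ?thesis using j assms(1) by (intro exI[of _ "[]"] exI[of _ j]) auto
  next
    case 2
    then have "coset k @ [s] = coset (Suc k)" by (simp add: coset_Suc)
    then show ?thesis using 2 by (intro exI[of _ "[]"] exI[of _ "Suc k"]) (auto simp: coxeq.refl)
  qed
qed

lemma coset_normal_form: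
  "set ws \<subseteq> S \<Longrightarrow> \<exists>u k. set u \<subseteq> S - {q 1} \<and> k \<le> M \<and> coxeq S ws (u @ coset k)"
proof (induction ws rule: rev_induct)
  case Nil
  show ?case by (intro exI[of _ "[]"] exI[of _ 0]) (simp add: coset_0 coxeq.refl)
next
  case (snoc s ws)
  then obtain u k where u: "set u \<subseteq> S - {q 1}" "k \<le> M" "coxeq S ws (u @ coset k)" by auto
  obtain u' l where u': "set u' \<subseteq> S - {q 1}" "l \<le> M" "coxeq S (coset k @ [s]) (u' @ coset l)"
    using coset_step[OF u(2), of s] snoc.prems by auto
  have "coxeq S (ws @ [s]) ((u @ coset k) @ [s])" by (rule coxeq_right[OF u(3)])
  moreover have "coxeq S (u @ (coset k @ [s])) (u @ (u' @ coset l))" by (rule coxeq_left[OF u'(3)])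
  ultimately have "coxeq S (ws @ [s]) ((u @ u') @ coset l)" using coxeq.trans by fastforce
  then show ?case using u(1) u'(1,2) by (intro exI[of _ "u @ u'"] exI[of _ l]) auto
qed

text \<open>In the normal form of a trivial word the left factor fixes \<open>p 0\<close> while the
  coset word carries \<open>p k\<close> to \<open>p 0\<close>. Hence \<open>k\<close> is 0, and what
  remains is a trivial word in \<open>S - {q 1}\<close>.\<close>

lemma presented_step:
  assumes "presented (S - {q 1})"
  shows "presented S"
  unfolding presented_def
proof (intro allI impI)
  fix ws assume ws: "set ws \<subseteq> S" "evalw ws = id"
  obtain u k where u: "set u \<subseteq> S - {q 1}" "k \<le> M" "coxeq S ws (u @ coset k)"
    using coset_normal_form[OF ws(1)] by blast
  have ev: "evalw u (evalw (coset k) x) = x" for x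
    using coxeq_evalw[OF S_refls u(3)] ws(2) by (simp add: fun_eq_iff)
  have "s (p 0) = p 0" if "s \<in> S - {q 1}" for s
    using movers[of s 0] that by (auto simp: q_def)
  then have "evalw u (p 0) = p 0" using u(1) by (induction u) auto
  then have "p k = p 0" using ev[of "p k"] by (simp add: evalw_coset)
  then have k: "k = 0" using p_inj[OF u(2), of 0] by simp
  then have "evalw u = id" using ev by (simp add: coset_0 fun_eq_iff)
  then have "coxeq (S - {q 1}) u []" using assms u(1) by (simp add: presented_def)
  then have "coxeq S u []" by (rule coxeq_mono) blast
  then show "coxeq S ws []" using u(3) k coxeq.trans by (fastforce simp: coset_0)
qed

end

section \<open>Words along chains of types A and B\<close>

text \<open>A pair \<open>(b, [x\<^sub>0, \<dots>, x\<^sub>m])\<close> stands for the reflections between consecutive points, a diagram of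
  type \<open>A\<^sub>m\<close>, joined if \<open>b\<close> holds by the sign change at \<open>x\<^sub>m\<close>, which makes it \<open>B\<^sub>m\<^sub>+\<^sub>1\<close>. Points are
  added at the head of the list, so the reflection that moves \<open>x\<^sub>0\<close> is the last letter of the word.\<close>

fun block_word :: "(bool \<times> int list) list \<Rightarrow> (int \<Rightarrow> int) list" where
  "block_word [] = []"
| "block_word ((b, []) # L) = block_word L"
| "block_word ((b, [x]) # L) = block_word L @ (if b then [sref x (- x)] else [])"
| "block_word ((b, x # y # xs) # L) = block_word ((b, y # xs) # L) @ [sref y x]"

definition block_points :: "(bool \<times> int list) list \<Rightarrow> int list" where
  "block_points L = concat (map snd L)"

lemma block_points_simps [simp]:
  "block_points [] = []" "block_points ((b, xs) # L) = xs @ block_points L"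
  by (simp_all add: block_points_def)

lemma block_word_fix:
  "s \<in> set (block_word L) \<Longrightarrow> \<bar>z\<bar> \<notin> abs ` set (block_points L) \<Longrightarrow> s z = z"
  by (induction L rule: block_word.induct) (auto split: if_splits intro!: sref_other)

lemma block_word_refls:
  "distinct (map abs (block_points L)) \<Longrightarrow> set (block_points L) \<subseteq> spts n \<Longrightarrow> set (block_word L) \<subseteq> refls n"
proof (induction L rule: block_word.induct)
  case (3 b x L)
  have "x \<in> spts n" using 3 by simp
  then have "x \<noteq> - x" using spts_nonzero[of x n] by auto
  then have "sref x (- x) \<in> refls n" using \<open>x \<in> spts n\<close> by (intro sref_in_refls) auto
  then show ?case using 3 by auto
next
  case (4 b x y xs L)
  have "x \<in> spts n" "y \<in> spts n" "y \<noteq> x" using 4 by auto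
  then have "sref y x \<in> refls n" by (intro sref_in_refls)
  then show ?case using 4 by auto
qed auto

lemma distinct_block_word:
  "distinct (map abs (block_points L)) \<Longrightarrow> 0 \<notin> set (block_points L) \<Longrightarrow> distinct (block_word L)"
proof (induction L rule: block_word.induct)
  case (3 b x L)
  have "sref x (- x) \<notin> set (block_word L)"
  proof
    assume s: "sref x (- x) \<in> set (block_word L)"
    have "\<bar>x\<bar> \<notin> abs ` set (block_points L)" using 3 by auto
    from block_word_fix[OF s this] show False using 3 by auto
  qed
  then show ?case using 3 by auto
next
  case (4 b x y xs L)
  have "sref y x \<notin> set (block_word ((b, y # xs) # L))"
  proof
    assume s: "sref y x \<in> set (block_word ((b, y # xs) # L))"
    have "\<bar>x\<bar> \<notin> abs ` set (block_points ((b, y # xs) # L))" using 4 by auto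
    from block_word_fix[OF s this] show False using 4 by auto
  qed
  then show ?case using 4 by auto
qed auto

fun consecutive :: "int list \<Rightarrow> (int \<Rightarrow> int) set" where
  "consecutive (x # y # zs) = insert (sref x y) (consecutive (y # zs))"
| "consecutive _ = {}"

lemma consecutive_nth: "s \<in> consecutive ps \<longleftrightarrow> (\<exists>k. Suc k < length ps \<and> s = sref (ps ! k) (ps ! Suc k))"
proof (induction ps rule: consecutive.induct)
  case (1 x y zs)
  show ?case
  proof
    assume "s \<in> consecutive (x # y # zs)"
    then consider "s = sref x y" | k where "Suc k < length (y # zs)" "s = sref ((y # zs) ! k) ((y # zs) ! Suc k)"
      using 1 by auto
    then show "\<exists>k. Suc k < length (x # y # zs) \<and> s = sref ((x # y # zs) ! k) ((x # y # zs) ! Suc k)"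
    proof cases
      case 1
      then show ?thesis by (intro exI[of _ 0]) simp
    next
      case (2 k)
      then show ?thesis by (intro exI[of _ "Suc k"]) simp
    qed
  next
    assume "\<exists>k. Suc k < length (x # y # zs) \<and> s = sref ((x # y # zs) ! k) ((x # y # zs) ! Suc k)"
    then obtain k where k: "Suc k < length (x # y # zs)" "s = sref ((x # y # zs) ! k) ((x # y # zs) ! Suc k)" by blast
    show "s \<in> consecutive (x # y # zs)"
    proof (cases k)
      case 0
      then show ?thesis using k by simp
    next
      case (Suc l)
      then have "\<exists>k. Suc k < length (y # zs) \<and> s = sref ((y # zs) ! k) ((y # zs) ! Suc k)" using k by auto
      then show ?thesis using 1 by simp
    qed
  qed
qed auto

lemma consecutive_snoc: "zs \<noteq> [] \<Longrightarrow> consecutive (zs @ [x]) = insert (sref (last zs) x) (consecutive zs)"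
  by (induction zs rule: consecutive.induct) auto

text \<open>In type B the path continues through the sign change at the last point and back along
  the negated points. The list is thus the whole orbit of its first point under the reflections of
  the chain.\<close>

definition chain_points :: "bool \<Rightarrow> int list \<Rightarrow> int list" where
  "chain_points b xs = xs @ (if b then rev (map uminus xs) else [])"

text \<open>The mirrored half of the path yields no new reflections, because negating both points
  leaves \<open>sref\<close> unchanged.\<close>

lemma set_block_word:
  "xs \<noteq> [] \<Longrightarrow> 0 \<notin> set xs \<Longrightarrow> set (block_word ((b, xs) # L)) = set (block_word L) \<union> consecutive (chain_points b xs)"
proof (induction xs)
  case (Cons x xs)
  show ?case
  proof (cases xs)
    case Nil
    then show ?thesis by (simp add: chain_points_def)
  next
    case (Cons y ys)
    have nz: "x \<noteq> 0" "y \<noteq> 0" using Cons.prems \<open>xs = y # ys\<close> by auto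
    have IH: "set (block_word ((b, y # ys) # L)) = set (block_word L) \<union> consecutive (chain_points b (y # ys))"
      using Cons.IH Cons.prems \<open>xs = y # ys\<close> by simp
    have "consecutive (chain_points b (x # y # ys)) = insert (sref y x) (consecutive (chain_points b (y # ys)))"
    proof (cases b)
      case True
      have cp: "chain_points b (x # y # ys) = x # (chain_points b (y # ys) @ [- x])"
        using True by (simp add: chain_points_def)
      have 1: "chain_points b (y # ys) = y # (ys @ rev (map uminus (y # ys)))" using True by (simp add: chain_points_def)
      have 2: "last (chain_points b (y # ys)) = - y" using True by (simp add: chain_points_def)
      have "consecutive (chain_points b (x # y # ys)) = insert (sref x y) (consecutive (chain_points b (y # ys) @ [- x]))"
        unfolding cp 1 by simp
      also have "\<dots> = insert (sref x y) (insert (sref (- y) (- x)) (consecutive (chain_points b (y # ys))))"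
        using consecutive_snoc[of "chain_points b (y # ys)" "- x"] 1 2 by simp
      finally show ?thesis using sref_uminus[OF nz(2,1)] sref_commute[of x y] by simp
    next
      case False
      then show ?thesis by (simp add: chain_points_def sref_commute)
    qed
    then show ?thesis using IH \<open>xs = y # ys\<close> by simp
  qed
qed simp

lemma chain_points_nth_uminus:
  assumes "k < length (chain_points True xs)"
  shows "chain_points True xs ! (length (chain_points True xs) - 1 - k) = - chain_points True xs ! k"
proof -
  let ?ps = "chain_points True xs"
  have "rev ?ps = map uminus ?ps" by (simp add: chain_points_def rev_map o_def)
  then have "rev ?ps ! k = - ?ps ! k" using assms by simp
  then show ?thesis using assms by (simp add: rev_nth)
qed

lemma block_word_orbit_chain:
  assumes wf: "distinct (map abs (block_points ((b, xs) # L)))" "set (block_points ((b, xs) # L)) \<subseteq> spts n"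
    and len: "length (chain_points b xs) > 1"
  shows "orbit_chain n (set (block_word ((b, xs) # L))) (\<lambda>k. chain_points b xs ! k) (length (chain_points b xs) - 1)"
proof
  let ?ps = "chain_points b xs"
  let ?N = "length ?ps"
  have xs: "xs \<noteq> []" using len by (auto simp: chain_points_def split: if_splits)
  have nz: "0 \<notin> set xs" using wf(2) spts_nonzero by auto
  note S = set_block_word[OF xs nz, of b L]
  have ps_abs: "abs ` set ?ps = abs ` set xs" by (auto simp: chain_points_def)
  have abs: "\<bar>?ps ! k\<bar> \<in> abs ` set xs" if "k < ?N" for k using that ps_abs by (metis imageI nth_mem)
  show "set (block_word ((b, xs) # L)) \<subseteq> refls n" by (rule block_word_refls[OF wf])
  show sp: "?ps ! k \<in> spts n" if "k \<le> ?N - 1" for k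
  proof -
    have "?ps ! k \<in> set ?ps" using that len by simp
    then show ?thesis using wf(2) by (auto simp: chain_points_def split: if_splits)
  qed
  have dabs: "distinct (map abs xs)" using wf(1) by simp
  have opp: "a \<noteq> - b" if "a \<in> set xs" "b \<in> set xs" for a b
  proof
    assume "a = - b"
    then have "\<bar>a\<bar> = \<bar>b\<bar>" by simp
    then have "a = b" using dabs that unfolding distinct_map by (blast dest: inj_onD)
    then show False using \<open>a = - b\<close> that nz by auto
  qed
  have "distinct ?ps"
    using dabs opp by (auto simp: chain_points_def distinct_map inj_on_def)
  then have inj: "k = l" if "k < ?N" "l < ?N" "?ps ! k = ?ps ! l" for k l
    using that by (simp add: nth_eq_iff_index_eq)
  then show "k = l" if "k \<le> ?N - 1" "l \<le> ?N - 1" "?ps ! k = ?ps ! l" for k l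
    using that len by simp
  have nzp: "?ps ! k \<noteq> 0" if "k < ?N" for k using sp[of k] that spts_nonzero by fastforce
  show "sref (?ps ! k) (?ps ! Suc k) \<in> set (block_word ((b, xs) # L))" if "k < ?N - 1" for k
  proof -
    have "Suc k < ?N" using that by simp
    then have "sref (?ps ! k) (?ps ! Suc k) \<in> consecutive ?ps" unfolding consecutive_nth by blast
    then show ?thesis unfolding S by blast
  qed
  \<comment> \<open>A reflection also moves the negatives of its points. These lie on the path only
    in type B, at the mirrored position, where the same reflection is again a step of the
    path.\<close>
  have mirror: "b \<and> j = ?N - 1 - k" if "k < ?N" "j < ?N" "?ps ! k = - ?ps ! j" for k j
  proof (cases b)
    case True
    then have "?ps ! (?N - 1 - k) = ?ps ! j" using chain_points_nth_uminus[of k xs] that by simp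
    then have "?N - 1 - k = j" by (rule inj[rotated 2]) (use that(1,2) in linarith)+
    then show ?thesis using True by simp
  next
    case False
    then have "?ps = xs" by (simp add: chain_points_def)
    then show ?thesis using opp[of "xs ! k" "xs ! j"] that by simp
  qed
  fix s k assume s: "s \<in> set (block_word ((b, xs) # L))" and k: "k \<le> ?N - 1" and moved: "s (?ps ! k) \<noteq> ?ps ! k"
  have kN: "k < ?N" using k len by simp
  have "\<bar>?ps ! k\<bar> \<notin> abs ` set (block_points L)" using abs[OF kN] wf(1) by auto
  then have "s \<notin> set (block_word L)" using block_word_fix moved by blast
  then have "s \<in> consecutive ?ps" using s unfolding S by blast
  then obtain j where j: "Suc j < ?N" "s = sref (?ps ! j) (?ps ! Suc j)" unfolding consecutive_nth by blast
  note nzj = nzp[of j] nzp[of "Suc j"]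
  have s': "s = sref (- ?ps ! j) (- ?ps ! Suc j)" using j nzj by (simp add: sref_uminus)
  consider "?ps ! k = ?ps ! j" | "?ps ! k = ?ps ! Suc j" | "?ps ! k = - ?ps ! j" | "?ps ! k = - ?ps ! Suc j"
    using sref_moves moved j(2) by blast
  then show "k > 0 \<and> s = sref (?ps ! (k - 1)) (?ps ! k) \<or> k < ?N - 1 \<and> s = sref (?ps ! k) (?ps ! Suc k)"
  proof cases
    case 1
    then have "k = j" using inj[OF kN, of j] j by simp
    then show ?thesis using j by auto
  next
    case 2
    then have "k = Suc j" using inj[OF kN, of "Suc j"] j by simp
    then show ?thesis using j by auto
  next
    case 3
    then have m: b "j = ?N - 1 - k" using mirror[OF kN _ 3] j by auto
    then have "k > 0" using j(1) by (cases k) auto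
    have "- ?ps ! Suc j = ?ps ! (?N - 1 - Suc j)" using chain_points_nth_uminus[of "Suc j" xs] j m(1) by simp
    also have "?N - 1 - Suc j = k - 1" using m(2) kN \<open>k > 0\<close> by simp
    finally have "s = sref (?ps ! k) (?ps ! (k - 1))" using s' 3 by simp
    then show ?thesis using \<open>k > 0\<close> sref_commute by metis
  next
    case 4
    then have m: b "Suc j = ?N - 1 - k" using mirror[OF kN _ 4] j by auto
    have "- ?ps ! j = ?ps ! (?N - 1 - j)" using chain_points_nth_uminus[of j xs] j m(1) by simp
    also have "?N - 1 - j = Suc k" using m(2) by simp
    finally have "s = sref (?ps ! Suc k) (?ps ! k)" using s' 4 by simp
    moreover have "k < ?N - 1" using m(2) by simp
    ultimately show ?thesis using sref_commute by metis
  qed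
qed

text \<open>The step \<open>q 1\<close> is the last letter of the word, and deleting it leaves the
  word of the chain with its head point removed (for a single point with sign change, the word of
  the remaining blocks). Thus \<open>presented_step\<close> drives the induction.\<close>

lemma presented_block_word:
  "distinct (map abs (block_points L)) \<Longrightarrow> set (block_points L) \<subseteq> spts n \<Longrightarrow> presented (set (block_word L))"
proof (induction L rule: block_word.induct)
  case 1
  then show ?case by (auto simp: presented_def intro: coxeq.refl)
next
  case (3 b x L)
  show ?case
  proof (cases b)
    case True
    interpret orbit_chain n "set (block_word ((b, [x]) # L))" "\<lambda>k. chain_points b [x] ! k" "length (chain_points b [x]) - 1"
      using 3 True by (intro block_word_orbit_chain) (auto simp: chain_points_def)
    have q1: "q 1 = sref x (- x)" unfolding q_def using True by (simp add: chain_points_def)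
    have "sref x (- x) \<notin> set (block_word L)"
    proof
      assume s: "sref x (- x) \<in> set (block_word L)"
      have "\<bar>x\<bar> \<notin> abs ` set (block_points L)" using 3 by auto
      from block_word_fix[OF s this] show False using 3 spts_nonzero[of x n] by auto
    qed
    then have "set (block_word ((b, [x]) # L)) - {q 1} = set (block_word L)" using True q1 by auto
    then show ?thesis using presented_step 3 by simp
  qed (use 3 in simp)
next
  case (4 b x y xs L)
  interpret orbit_chain n "set (block_word ((b, x # y # xs) # L))" "\<lambda>k. chain_points b (x # y # xs) ! k" 
      "length (chain_points b (x # y # xs)) - 1"
    using 4 by (intro block_word_orbit_chain) (auto simp: chain_points_def)
  have q1: "q 1 = sref y x" unfolding q_def by (simp add: chain_points_def sref_commute)
  have "sref y x \<notin> set (block_word ((b, y # xs) # L))"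
  proof
    assume s: "sref y x \<in> set (block_word ((b, y # xs) # L))"
    have "\<bar>x\<bar> \<notin> abs ` set (block_points ((b, y # xs) # L))" using 4 by auto
    from block_word_fix[OF s this] show False using 4 by auto
  qed
  then have "set (block_word ((b, x # y # xs) # L)) - {q 1} = set (block_word ((b, y # xs) # L))" using q1 by auto
  then show ?case using presented_step 4 by simp
qed auto

section \<open>Every signed permutation is a Coxeter element\<close>

lemma coxeter_gen_if_presented:
  assumes "S \<subseteq> refls n" "presented S"
  shows "coxeter_gen n (gen n S) S"
  unfolding coxeter_gen_def coxeter_system_def
proof (intro conjI ballI)
  show "S \<subseteq> gen n S" by (rule gen_superset)
  show "\<And>s. s \<in> S \<Longrightarrow> s \<noteq> id" "\<And>s. s \<in> S \<Longrightarrow> s \<circ> s = id" using assms(1) refls_not_id refls_comp_self by blast+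
qed (use assms in \<open>auto simp: presented_def\<close>)

lemma coxeter_elem_block_word:
  assumes "distinct (map abs (block_points L))" "set (block_points L) \<subseteq> spts n"
  shows "refl_subgroup n (gen n (set (block_word L)))"
    "coxeter_elem n (gen n (set (block_word L))) (evalw (block_word L))"
proof -
  have 1: "set (block_word L) \<subseteq> refls n" by (rule block_word_refls[OF assms])
  then show "refl_subgroup n (gen n (set (block_word L)))" unfolding refl_subgroup_def by blast
  have "0 \<notin> set (block_points L)" using assms(2) spts_nonzero by auto
  then show "coxeter_elem n (gen n (set (block_word L))) (evalw (block_word L))"
    unfolding coxeter_elem_def using coxeter_gen_if_presented[OF 1 presented_block_word[OF assms]]
      distinct_block_word[OF assms(1)] by blast
qed

text \<open>Follow the cycle of \<open>w\<close> through \<open>y\<close> backwards: with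
  \<open>z = inv w y\<close>, the product \<open>w \<circ> sref z y\<close> fixes \<open>y\<close>,
  and its chain is continued from \<open>z\<close>. A positive cycle ends in a fixed point and a
  negative one in a sign change, which sets the flag \<open>b\<close>. Prescribing the head
  \<open>y\<close> lets the induction extend an existing chain.\<close>

lemma ex_block_word:
  assumes "finite P" "P \<subseteq> {1..int n}" "w \<in> Wn n" "\<And>i. \<bar>i\<bar> \<notin> P \<Longrightarrow> w i = i" "\<bar>y\<bar> \<in> P"
  shows "\<exists>b xs L. distinct (map abs (block_points ((b, y # xs) # L))) \<and>
     abs ` set (block_points ((b, y # xs) # L)) = P \<and> evalw (block_word ((b, y # xs) # L)) = w"
  using assms
proof (induction "card P" arbitrary: P w y rule: less_induct)
  case less
  define Q where "Q = P - {\<bar>y\<bar>}"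
  have Q: "finite Q" "Q \<subseteq> {1..int n}" "card Q < card P" "insert \<bar>y\<bar> Q = P" "\<bar>y\<bar> \<notin> Q"
    using less.prems card_Diff1_less[of P "\<bar>y\<bar>"] by (auto simp: Q_def)
  have ysp: "y \<in> spts n" using less.prems abs_spts by blast
  have nz: "y \<noteq> 0" using ysp spts_nonzero by auto
  \<comment> \<open>The chain through \<open>y\<close> is complete: on the other lines a new chain
    is begun, at an arbitrary point if any line is left.\<close>
  have rest: "\<exists>L. distinct (map abs (block_points L)) \<and> abs ` set (block_points L) = Q \<and> evalw (block_word L) = v"
    if v: "v \<in> Wn n" "\<And>i. \<bar>i\<bar> \<notin> Q \<Longrightarrow> v i = i" for v
  proof (cases "Q = {}")
    case True
    then have "v = id" using v by auto
    then show ?thesis using True by (intro exI[of _ "[]"]) simp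
  next
    case False
    then obtain z where "z \<in> Q" by blast
    then have "\<bar>z\<bar> \<in> Q" using Q(2) by fastforce
    from less.hyps[OF Q(3,1,2) v this] show ?thesis by blast
  qed
  consider "w y = y" | "w y = - y" | "\<bar>w y\<bar> \<noteq> \<bar>y\<bar>" by linarith
  then show ?case
  proof cases
    case 1
    have "w i = i" if "\<bar>i\<bar> \<notin> Q" for i
    proof (cases "\<bar>i\<bar> = \<bar>y\<bar>")
      case True
      then have "i = y \<or> i = - y" by linarith
      then show ?thesis using 1 Wn_uminus[OF less.prems(3)] by auto
    next
      case False
      then show ?thesis using that Q less.prems(4) by blast
    qed
    from rest[OF less.prems(3) this] obtain L where L: "distinct (map abs (block_points L))" 
      "abs ` set (block_points L) = Q" "evalw (block_word L) = w" by blast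
    show ?thesis
      by (rule exI[of _ False], rule exI[of _ "[]"], rule exI[of _ L]) (use L Q in auto)
  next
    case 2
    let ?v = "w \<circ> sref y (- y)"
    have vW: "?v \<in> Wn n" using less.prems(3) ysp by (intro comp_Wn sref_Wn) auto
    have "?v i = i" if "\<bar>i\<bar> \<notin> Q" for i
    proof (cases "\<bar>i\<bar> = \<bar>y\<bar>")
      case True
      then have "i = y \<or> i = - y" by linarith
      then show ?thesis using 2 Wn_uminus[OF less.prems(3)] by auto
    next
      case False
      then show ?thesis using that Q less.prems(4) by (auto simp: sref_other)
    qed
    from rest[OF vW this] obtain L where L: "distinct (map abs (block_points L))" 
      "abs ` set (block_points L) = Q" "evalw (block_word L) = ?v" by blast
    have "evalw (block_word ((True, [y]) # L)) = w"
      using L(3) nz by (simp add: fun_eq_iff)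
    then show ?thesis
      by (intro exI[of _ True] exI[of _ "[]"] exI[of _ L]) (use L Q in auto)
  next
    case 3
    define z where "z = inv w y"
    have wz: "w z = y" using less.prems(3) by (simp add: z_def)
    have zy: "\<bar>z\<bar> \<noteq> \<bar>y\<bar>" using 3 wz Wn_abs_eq_iff[OF less.prems(3), of z y] by simp
    have zP: "\<bar>z\<bar> \<in> P" 
    proof (rule ccontr)
      assume "\<bar>z\<bar> \<notin> P"
      then have "w z = z" by (rule less.prems(4))
      then show False using wz zy by simp
    qed
    then have zQ: "\<bar>z\<bar> \<in> Q" using zy by (simp add: Q_def)
    have zsp: "z \<in> spts n" using zP less.prems abs_spts by blast
    then have znz: "z \<noteq> 0" using spts_nonzero by auto
    let ?v = "w \<circ> sref z y"
    have vW: "?v \<in> Wn n" using less.prems(3) ysp zsp by (intro comp_Wn sref_Wn) auto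
    have "?v i = i" if "\<bar>i\<bar> \<notin> Q" for i
    proof (cases "\<bar>i\<bar> = \<bar>y\<bar>")
      case True
      then have "i = y \<or> i = - y" by linarith
      moreover have "?v y = y" using wz by simp
      ultimately show ?thesis using Wn_uminus[OF vW, of y] by auto
    next
      case False
      then have "\<bar>i\<bar> \<notin> P" "\<bar>i\<bar> \<noteq> \<bar>z\<bar>" using that zQ Q by auto
      then show ?thesis using False less.prems(4) by (simp add: sref_other)
    qed
    from less.hyps[OF Q(3,1,2) vW this zQ] obtain b xs L where L: "distinct (map abs (block_points ((b, z # xs) # L)))"
     "abs ` set (block_points ((b, z # xs) # L)) = Q" "evalw (block_word ((b, z # xs) # L)) = ?v" by blast
    have "evalw (block_word ((b, y # z # xs) # L)) = w"
      using L(3) nz znz by (simp add: fun_eq_iff)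
    then show ?thesis
      by (intro exI[of _ b] exI[of _ "z # xs"] exI[of _ L]) (use L Q in auto)
  qed
qed

lemma ex_coxeter_elem:
  assumes "w \<in> Wn n" "n > 0"
  shows "\<exists>R. refl_subgroup n R \<and> coxeter_elem n R w"
proof -
  have out: "w i = i" if "\<bar>i\<bar> \<notin> {1..int n}" for i
    using Wn_not_in[OF assms(1)] that abs_spts by blast
  have "\<bar>1\<bar> \<in> {1..int n}" using assms(2) by simp
  from ex_block_word[OF finite_atLeastAtMost_int subset_refl assms(1) out this]
  obtain L where L: "distinct (map abs (block_points L))"
     "abs ` set (block_points L) = {1..int n}" "evalw (block_word L) = w" by blast
  have "set (block_points L) \<subseteq> spts n" using L(2) abs_spts by blast
  from coxeter_elem_block_word[OF L(1) this] L(3) show ?thesis by auto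
qed

section \<open>Failure of injectivity\<close>

lemma coxeq_commuting_pair:
  assumes S: "S = {s, t}" "s \<in> refls n" "t \<in> refls n" and comm: "s \<circ> t = t \<circ> s" and "set ws \<subseteq> S"
  shows "\<exists>u\<in>{[], [s], [t], [s, t]}. coxeq S ws u"
  using assms(5)
proof (induction ws)
  case Nil
  then show ?case by (auto intro: coxeq.refl)
next
  case (Cons r ws)
  then obtain u where u: "u \<in> {[], [s], [t], [s, t]}" "coxeq S ws u" by auto
  have 1: "coxeq S (r # ws) (r # u)" using coxeq_left[OF u(2), of "[r]"] by simp
  have sub: "S \<subseteq> refls n" "s \<in> S" "t \<in> S" using S by auto
  have ss: "coxeq S (s # s # v) v" "coxeq S (t # t # v) v" for v
    using coxeq.sq[of s S "[]" v] coxeq.sq[of t S "[]" v] sub by auto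
  have ts: "coxeq S (t # s # v) (s # t # v)" for v
    using coxeq_right[OF coxeq_commute[OF sub(1,3,2) comm[symmetric]], of v] by simp
  have "r = s \<or> r = t" using Cons.prems S by auto
  then have "\<exists>v\<in>{[], [s], [t], [s, t]}. coxeq S (r # u) v"
  proof
    assume "r = s"
    then show ?thesis using u(1) ss(1)[of "[]"] ss(1)[of "[t]"] coxeq.refl[of S] by auto
  next
    assume "r = t"
    moreover have "coxeq S (t # s # [t]) [s]"
      using coxeq.trans[OF ts[of "[t]"]] coxeq_left[OF ss(2)[of "[]"], of "[s]"] by simp
    ultimately show ?thesis using u(1) ss(2)[of "[]"] ts[of "[]"] coxeq.refl[of S] by auto
  qed
  then show ?case using 1 coxeq.trans by blast
qed

text \<open>The words of \<open>block_word\<close> cover chains of types A and B; the two commuting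
  generators of D_2 get their own presentation here.\<close>

lemma presented_commuting_pair:
  assumes st: "s \<in> refls n" "t \<in> refls n" "s \<circ> t = t \<circ> s" "s \<noteq> t"
  shows "presented {s, t}"
  unfolding presented_def
proof (intro allI impI)
  fix ws assume ws: "set ws \<subseteq> {s, t}" "evalw ws = id"
  obtain u where u: "u \<in> {[], [s], [t], [s, t]}" "coxeq {s, t} ws u"
    using coxeq_commuting_pair[OF HOL.refl st(1-3) ws(1)] by blast
  have "evalw u = id" using coxeq_evalw[OF _ u(2), of n] ws(2) st by simp
  moreover have "s \<circ> t \<noteq> id"
  proof
    assume "s \<circ> t = id"
    then have "s (s (t x)) = s x" for x by (simp add: fun_eq_iff)
    then have "t = s" using refls_involution[OF st(1)] by (simp add: fun_eq_iff)
    then show False using st(4) by simp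
  qed
  ultimately have "u = []" using u(1) refls_not_id[OF st(1)] refls_not_id[OF st(2)] by auto
  then show "coxeq {s, t} ws []" using u(2) by simp
qed

lemma gen_commuting_pair:
  assumes st: "s \<in> refls n" "t \<in> refls n" "s \<circ> t = t \<circ> s"
  shows "gen n {s, t} \<subseteq> {id, s, t, s \<circ> t}"
proof
  fix g assume "g \<in> gen n {s, t}"
  then obtain ws where ws: "g = evalw ws" "set ws \<subseteq> {s, t}" using gen_evalw[of "{s, t}" n] st by auto
  obtain u where u: "u \<in> {[], [s], [t], [s, t]}" "coxeq {s, t} ws u"
    using coxeq_commuting_pair[OF HOL.refl st ws(2)] by blast
  have "g = evalw u" using coxeq_evalw[OF _ u(2), of n] ws st by simp
  then show "g \<in> {id, s, t, s \<circ> t}" using u(1) by auto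
qed

text \<open>The groups are B_1 x B_1 and D_2 on the first two coordinates. Both have the
  simultaneous sign change of these coordinates as Coxeter element, but the second one contains no
  single sign change, and conjugates of a single sign change are again of that kind.\<close>

lemma same_coxeter_elem:
  assumes "n \<ge> 2"
  shows "\<exists>R1 R2 c. refl_subgroup n R1 \<and> refl_subgroup n R2 \<and> \<not> conj_sub n R1 R2 \<and>
    coxeter_elem n R1 c \<and> coxeter_elem n R2 c"
proof -
  define L :: "(bool \<times> int list) list" where "L = [(True, [1]), (True, [2])]"
  have sp: "1 \<in> spts n" "2 \<in> spts n" "- 2 \<in> spts n" "- 1 \<in> spts n" using assms by (auto simp: spts_def)
  have L: "distinct (map abs (block_points L))" "set (block_points L) \<subseteq> spts n" using sp by (auto simp: L_def)
  define R1 where "R1 = gen n (set (block_word L))"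
  define c where "c = evalw (block_word L)"
  define s where "s = sref 1 2"
  define t where "t = sref 1 (- 2)"
  define R2 where "R2 = gen n {s, t}"
  have st: "s \<in> refls n" "t \<in> refls n" unfolding s_def t_def using sp by (auto intro!: sref_in_refls)
  have comm: "s \<circ> t = t \<circ> s" unfolding s_def t_def by (rule sref_parallel_commute) auto
  have ne: "s \<noteq> t"
  proof
    assume "s = t"
    then have "s 1 = t 1" by simp
    then show False by (simp add: s_def t_def)
  qed
  have sub: "{s, t} \<subseteq> refls n" using st by simp
  have c: "c = s \<circ> t"
    by (rule ext) (auto simp: c_def L_def s_def t_def sref_def)
  have "coxeter_elem n R2 c"
    unfolding coxeter_elem_def R2_def
    using coxeter_gen_if_presented[OF sub presented_commuting_pair[OF st comm ne]] ne
    by (intro exI[of _ "{s, t}"] exI[of _ "[s, t]"]) (simp add: c)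
  moreover have "\<not> conj_sub n R1 R2"
  proof
    assume "conj_sub n R1 R2"
    then obtain g where g: "g \<in> Wn n" "R2 = (\<lambda>h. g \<circ> h \<circ> inv g) ` R1" by (auto simp: conj_sub_def)
    have "sref 1 (- 1) \<in> R1" unfolding R1_def using gen_superset by (force simp: L_def)
    then have "g \<circ> sref 1 (- 1) \<circ> inv g \<in> R2" using g(2) by blast
    then have "sref (g 1) (g (- 1)) \<in> R2" using sref_conj[OF g(1)] by simp
    then have h: "sref (g 1) (- g 1) \<in> {id, s, t, s \<circ> t}"
      using gen_commuting_pair[OF st comm] Wn_uminus[OF g(1), of 1] by (auto simp: R2_def)
    define a where "a = g 1"
    have "a \<in> spts n" using Wn_in_spts[OF g(1)] sp by (simp add: a_def)
    then have a: "a \<noteq> 0" by (rule spts_nonzero)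
    have val: "sref a (- a) p = (if p = a \<or> p = - a then - p else p)" for p using a by (auto simp: sref_def)
    have "sref a (- a) \<noteq> id" using val[of a] a by (metis id_apply neg_equal_zero)
    moreover have "sref a (- a) \<noteq> s" "sref a (- a) \<noteq> t"
      using val[of 1] by (auto simp: s_def t_def dest!: fun_cong[of _ _ 1] split: if_splits)
    moreover have "sref a (- a) \<noteq> s \<circ> t"
    proof
      assume "sref a (- a) = s \<circ> t"
      then have "sref a (- a) 1 = - 1" "sref a (- a) 2 = - 2" by (auto simp: s_def t_def sref_def)
      then show False unfolding val by (auto split: if_splits)
    qed
    ultimately show False using h by (simp add: a_def)
  qed
  moreover have "refl_subgroup n R2" unfolding refl_subgroup_def R2_def using sub by blast
  ultimately show ?thesis using coxeter_elem_block_word[OF L] unfolding R1_def c_def by blast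
qed

lemma cycle_type_coxeter_elem:
  assumes "triple_part n l1 l2 l3" "\<forall>x\<in>set l3. x > 1" "coxeter_elem n (Wlam n l1 l2 l3) c"
  shows "cycle_type n c = (mset l1, mset l2 + mset (map (\<lambda>x. x - 1) l3) + replicate_mset (length l3) 1)"
proof -
  let ?A = "blocksA l1 l2 l3" and ?B = "blocksB l1 l2 l3" and ?D = "blocksD l1 l2 l3"
  have W: "Wlam n l1 l2 l3 = Wstr n ?A ?B ?D"
    by (rule Wlam_eq_Wstr) (use assms(1) in \<open>simp add: triple_part_def\<close>)
  interpret blocks n ?A ?B ?D using assms(1,2) by (rule triple_part_blocks)
  obtain S ws where S: "coxeter_gen n W S" "distinct ws" "set ws = S" "c = evalw ws"
    using assms(3) unfolding coxeter_elem_def W by blast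
  interpret coxeter_word n ?A ?B ?D S ws
    by unfold_locales (use S in auto)
  note cls = Wlam_blocks(2-4)[OF assms(1,2), unfolded W cls_W]
  have "image_mset (\<lambda>C. card C - 1) (mset_set ?D) = image_mset (\<lambda>x. x - 1) (image_mset card (mset_set ?D))"
    by (simp add: multiset.map_comp o_def)
  then have "image_mset (\<lambda>C. card C - 1) (mset_set ?D) = mset (map (\<lambda>x. x - 1) l3)"
    using cls(3) by simp
  moreover have "card ?D = length l3"
    using arg_cong[OF cls(3), of size] by simp
  ultimately show ?thesis using cycle_type_c cls S(4) by simp
qed

theorem theorem3p2:
  fixes n :: nat
  assumes "n \<ge> 2"
  shows
  \<comment> \<open>(1) representatives of conjugacy classes of reflection subgroups\<close>
  "((\<forall>l1 l2 l3. triple_part n l1 l2 l3 \<and> (\<forall>x\<in>set l3. x > 1)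
        \<longrightarrow> refl_subgroup n (Wlam n l1 l2 l3))
    \<and> (\<forall>R. refl_subgroup n R \<longrightarrow>
          (\<exists>l1 l2 l3. triple_part n l1 l2 l3 \<and> (\<forall>x\<in>set l3. x > 1)
                     \<and> conj_sub n (Wlam n l1 l2 l3) R))
    \<and> (\<forall>l1 l2 l3 m1 m2 m3.
          triple_part n l1 l2 l3 \<and> (\<forall>x\<in>set l3. x > 1)
        \<and> triple_part n m1 m2 m3 \<and> (\<forall>x\<in>set m3. x > 1)
        \<and> conj_sub n (Wlam n l1 l2 l3) (Wlam n m1 m2 m3)
        \<longrightarrow> Wlam n l1 l2 l3 = Wlam n m1 m2 m3))
   \<and>
  \<comment> \<open>(2) parabolic closure is of type B_(n-m) x prod A_(l1_i - 1)\<close>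
   (\<forall>l1 l2 l3. triple_part n l1 l2 l3 \<and> (\<forall>x\<in>set l3. x > 1) \<longrightarrow>
      conj_sub n
        (Wlam n l1 (if sum_list l1 = n then [] else [n - sum_list l1]) [])
        (pclos n (Wlam n l1 l2 l3)))
   \<and>
  \<comment> \<open>(3) cycle type of Coxeter elements\<close>
   (\<forall>l1 l2 l3 c. triple_part n l1 l2 l3 \<and> (\<forall>x\<in>set l3. x > 1)
      \<and> coxeter_elem n (Wlam n l1 l2 l3) c \<longrightarrow>
      cycle_type n c = (mset l1,
          mset l2 + mset (map (\<lambda>x. x - 1) l3) + replicate_mset (length l3) 1))
   \<and>
  \<comment> \<open>(4) gamma is surjective but not injective\<close>
   (\<forall>w\<in>Wn n. \<exists>R c. refl_subgroup n R \<and> coxeter_elem n R c \<and> conj_el n c w)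
   \<and>
   (\<exists>R1 R2 c1 c2. refl_subgroup n R1 \<and> refl_subgroup n R2 \<and> \<not> conj_sub n R1 R2
      \<and> coxeter_elem n R1 c1 \<and> coxeter_elem n R2 c2 \<and> conj_el n c1 c2)"
proof (intro conjI allI impI ballI; (elim conjE)?)
  show "refl_subgroup n (Wlam n l1 l2 l3)" if "triple_part n l1 l2 l3" "\<forall>x\<in>set l3. x > 1" for l1 l2 l3
    using that by (rule Wlam_blocks(1))
  show "\<exists>l1 l2 l3. triple_part n l1 l2 l3 \<and> (\<forall>x\<in>set l3. x > 1) \<and> conj_sub n (Wlam n l1 l2 l3) R"
    if "refl_subgroup n R" for R
    using that by (rule refl_subgroup_conj_Wlam)
  show "Wlam n l1 l2 l3 = Wlam n m1 m2 m3"
    if "triple_part n l1 l2 l3" "\<forall>x\<in>set l3. x > 1" "triple_part n m1 m2 m3" "\<forall>x\<in>set m3. x > 1"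
      "conj_sub n (Wlam n l1 l2 l3) (Wlam n m1 m2 m3)" for l1 l2 l3 m1 m2 m3
    using that by (rule Wlam_conj_imp_eq)
  show "conj_sub n (Wlam n l1 (if sum_list l1 = n then [] else [n - sum_list l1]) []) (pclos n (Wlam n l1 l2 l3))"
    if "triple_part n l1 l2 l3" "\<forall>x\<in>set l3. x > 1" for l1 l2 l3
    unfolding pclos_Wlam[OF that] by (rule conj_sub_refl) (auto simp: Wlam_def Let_def)
  show "cycle_type n c = (mset l1, mset l2 + mset (map (\<lambda>x. x - 1) l3) + replicate_mset (length l3) 1)"
    if "triple_part n l1 l2 l3" "\<forall>x\<in>set l3. x > 1" "coxeter_elem n (Wlam n l1 l2 l3) c" for l1 l2 l3 c
    using that by (rule cycle_type_coxeter_elem)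
  have conj_refl: "conj_el n w w" for w
    unfolding conj_el_def by (intro bexI[of _ id]) (simp_all add: inv_id)
  show "\<exists>R c. refl_subgroup n R \<and> coxeter_elem n R c \<and> conj_el n c w" if "w \<in> Wn n" for w
    using ex_coxeter_elem[OF that] conj_refl assms by fastforce
  show "\<exists>R1 R2 c1 c2. refl_subgroup n R1 \<and> refl_subgroup n R2 \<and> \<not> conj_sub n R1 R2
      \<and> coxeter_elem n R1 c1 \<and> coxeter_elem n R2 c2 \<and> conj_el n c1 c2"
    using same_coxeter_elem[OF assms] conj_refl by blast
qed

end
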